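(* Let $\mathfrak a\subseteq\mathbb C[x_1,\dots,x_n]$ be a non-zero ideal and let $g\in\mathbb C[y_1,\dots,y_m]$ be a non-zero polynomial. Then $$b_{\mathfrak a}\cdot b_g=b_{\mathfrak a\cdot(g)},$$ where $\mathfrak a\cdot(g)$ is the ideal of $\mathbb C[x_1,\dots,x_n,y_1,\dots,y_m]$ generated by all products $f\cdot g$ with $f\in\mathfrak a$.
   Context: Bernstein-Sato polynomial of an ideal. Let $\mathfrak a\subseteq\mathbb C[z_1,\dots,z_N]$ be a non-zero ideal with non-zero generators $f_1,\dots,f_r$, let $s_1,\dots,s_r$ be variables, and let $A_N(\mathbb C)$ be the Weyl algebra. The free rank-one module $\mathbb C[z_1,\dots,z_N][\frac{1}{f_1\cdots f_r}][s_1,\dots,s_r]\cdot f_1^{s_1}\cdots f_r^{s_r}$ on the formal symbol $f_1^{s_1}\cdots f_r^{s_r}$ is a left $A_N(\mathbb C)[s_1,\dots,s_r]$-module with polynomials acting by multiplication and $\partial_{z_j}(h f_1^{s_1}\cdots f_r^{s_r})=\left(\frac{\partial h}{\partial z_j}+h\sum_i s_i\frac{\partial f_i/\partial z_j}{f_i}\right)f_1^{s_1}\cdots f_r^{s_r}$. For $\bm u\in\mathbb Z^r$ put $|\bm u|=u_1+\dots+u_r$ and $f_1^{s_1+u_1}\cdots f_r^{s_r+u_r}:=f_1^{u_1}\cdots f_r^{u_r}\cdot f_1^{s_1}\cdots f_r^{s_r}$. Then $b_{\mathfrak a}$ is the non-zero monic polynomial in one variable of minimal degree such that $$b_{\mathfrak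 a}(s_1+\dots+s_r)\,f_1^{s_1}\cdots f_r^{s_r}\in\sum_{\bm u\in\mathbb Z^r,\ |\bm u|=1}A_N(\mathbb C)[s_1,\dots,s_r]\cdot\Big(\prod_{u_i<0}\binom{s_i}{-u_i}\Big)f_1^{s_1+u_1}\cdots f_r^{s_r+u_r}.$$ It exists and is independent of the choice of generators. Bernstein-Sato polynomial of a polynomial. For a non-zero polynomial $g$ in $m$ variables, $b_g$ is the non-zero monic polynomial of minimal degree with $b_g(s)g^s\in A_m(\mathbb C)[s]\cdot g^{s+1}$, i.e. $b_g=b_{(g)}$ (the case $r=1$). *)

theory Defs
  imports Complex_Main "HOL-Library.Poly_Mapping" "HOL-Algebra.Ideal"
    "HOL-Computational_Algebra.Fraction_Field" "HOL-Computational_Algebra.Polynomial"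
begin

section \<open>Polynomials in finitely many of the variables indexed by nat\<close>

text \<open>All polynomials live in one type, with one indeterminate for every natural number; the ring
  of polynomials in the indeterminates indexed by \<open>V\<close> is the carrier of \<open>mpoly_ring V\<close>.\<close>

type_synonym mpoly = "(nat \<Rightarrow>\<^sub>0 nat) \<Rightarrow>\<^sub>0 complex"

definition mpoly_vars :: "mpoly \<Rightarrow> nat set" where
  "mpoly_vars p = (\<Union>m \<in> Poly_Mapping.keys p. Poly_Mapping.keys m)"

definition mpoly_ring :: "nat set \<Rightarrow> mpoly ring" where
  "mpoly_ring V = \<lparr>carrier = {p. mpoly_vars p \<subseteq> V}, monoid.mult = (*), one = 1, zero = 0, add = (+)\<rparr>"

definition mpoly_const :: "complex \<Rightarrow> mpoly" where
  "mpoly_const c = Poly_Mapping.single 0 c"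

definition mpoly_var :: "nat \<Rightarrow> mpoly" where
  "mpoly_var j = Poly_Mapping.single (Poly_Mapping.single j 1) 1"

definition mpoly_deriv :: "nat \<Rightarrow> mpoly \<Rightarrow> mpoly" where
  "mpoly_deriv j p = (\<Sum>m \<in> Poly_Mapping.keys p.
     Poly_Mapping.single (m - Poly_Mapping.single j 1)
       (of_nat (Poly_Mapping.lookup m j) * Poly_Mapping.lookup p m))"

lemma mpoly_deriv_superset:
  assumes "finite A" "Poly_Mapping.keys p \<subseteq> A"
  shows "mpoly_deriv j p = (\<Sum>m \<in> A. Poly_Mapping.single (m - Poly_Mapping.single j 1)
       (of_nat (Poly_Mapping.lookup m j) * Poly_Mapping.lookup p m))"
  unfolding mpoly_deriv_def
  by (rule sum.mono_neutral_left) (use assms in \<open>auto simp: in_keys_iff\<close>)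

lemma mpoly_deriv_add: "mpoly_deriv j (p + q) = mpoly_deriv j p + mpoly_deriv j q"
proof -
  let ?A = "Poly_Mapping.keys p \<union> Poly_Mapping.keys q"
  have "finite ?A" "Poly_Mapping.keys p \<subseteq> ?A" "Poly_Mapping.keys q \<subseteq> ?A"
    "Poly_Mapping.keys (p + q) \<subseteq> ?A"
    by (auto simp: keys_add)
  then show ?thesis
    by (simp add: mpoly_deriv_superset[of ?A] lookup_add distrib_left single_add sum.distrib)
qed

lemma mpoly_deriv_0: "mpoly_deriv j 0 = 0"
  by (simp add: mpoly_deriv_def)

lemma mpoly_deriv_single:
  "mpoly_deriv j (Poly_Mapping.single m c) =
     Poly_Mapping.single (m - Poly_Mapping.single j 1) (of_nat (Poly_Mapping.lookup m j) * c)"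
  by (subst mpoly_deriv_superset[of "{m}"]) auto

lemma mpoly_induct:
  fixes p :: mpoly
  assumes "P 0" "\<And>m c. P (Poly_Mapping.single m c)" "\<And>p q. P p \<Longrightarrow> P q \<Longrightarrow> P (p + q)"
  shows "P p"
proof (induction p rule: update_induct)
  case const
  then show ?case by (rule assms(1))
next
  case (update p m c)
  have "Poly_Mapping.update m c p = p + Poly_Mapping.single m c"
    using update by (intro poly_mapping_eqI)
      (auto simp: lookup_update lookup_add lookup_single in_keys_iff when_def)
  then show ?case using update assms by simp
qed

lemma mpoly_deriv_mult_single:
  "mpoly_deriv j (Poly_Mapping.single m c * Poly_Mapping.single m' c') =
     mpoly_deriv j (Poly_Mapping.single m c) * Poly_Mapping.single m' c'
     + Poly_Mapping.single m c * mpoly_deriv j (Poly_Mapping.single m' c')"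
proof -
  let ?e = "Poly_Mapping.single j (1::nat)"
  have *: "m - ?e + m' = m + m' - ?e" if "Poly_Mapping.lookup m j \<noteq> 0" for m m' :: "nat \<Rightarrow>\<^sub>0 nat"
    using that by (intro poly_mapping_eqI)
      (auto simp: lookup_add lookup_minus lookup_single when_def)
  show ?thesis
  proof (cases "Poly_Mapping.lookup m j = 0"; cases "Poly_Mapping.lookup m' j = 0")
  qed (use *[of m m'] *[of m' m] in
      \<open>simp_all add: mpoly_deriv_single mult_single lookup_add algebra_simps flip: single_add\<close>)
qed

lemma mpoly_deriv_mult:
  "mpoly_deriv j (p * q) = mpoly_deriv j p * q + p * mpoly_deriv j q"
proof (induction p rule: mpoly_induct)
  case (2 m c)
  show ?case
    by (induction q rule: mpoly_induct)
      (simp_all add: mpoly_deriv_0 mpoly_deriv_mult_single mpoly_deriv_add algebra_simps)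
qed (simp_all add: mpoly_deriv_0 mpoly_deriv_add algebra_simps)

section \<open>Rational functions\<close>

type_synonym ratfun = "mpoly fract"

definition ratfun_of :: "mpoly \<Rightarrow> ratfun" where
  "ratfun_of p = Fraction_Field.Fract p 1"

lift_definition ratfun_deriv :: "nat \<Rightarrow> ratfun \<Rightarrow> ratfun"
  is "\<lambda>j (p, q). (mpoly_deriv j p * q - p * mpoly_deriv j q, q ^ 2)"
proof -
  fix j :: nat and x y :: "mpoly \<times> mpoly"
  assume xy: "fractrel x y"
  obtain p q p' q' where [simp]: "x = (p, q)" "y = (p', q')" by (cases x, cases y)
  let ?D = "mpoly_deriv j"
  have q: "q \<noteq> 0" "q' \<noteq> 0" and e: "p * q' = p' * q" using xy by auto
  have d: "?D p * q' + p * ?D q' = ?D p' * q + p' * ?D q"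
    using arg_cong[OF e, of ?D] by (simp add: mpoly_deriv_mult)
  have "(?D p * q - p * ?D q) * q' ^ 2 - (?D p' * q' - p' * ?D q') * q ^ 2
      = q * q' * ((?D p * q' + p * ?D q') - (?D p' * q + p' * ?D q))
        - (p * q' - p' * q) * (q * ?D q' + q' * ?D q)"
    by (simp add: algebra_simps power2_eq_square)
  also have "\<dots> = 0" by (simp add: d e)
  finally show "fractrel (case x of (p, q) \<Rightarrow> (?D p * q - p * ?D q, q ^ 2))
                  (case y of (p, q) \<Rightarrow> (?D p * q - p * ?D q, q ^ 2))"
    using q by simp
qed

section \<open>The module generated by the formal product of powers\<close>

text \<open>The generators \<open>f\<^sub>1, \<dots>, f\<^sub>r\<close> are the entries of a list \<open>fs\<close>, and \<open>s\<^sub>1, \<dots>, s\<^sub>r\<close> are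
  indexed from 0. An element \<open>h f\<^sub>1\<^bsup>s\<^sub>1\<^esup> \<cdots> f\<^sub>r\<^bsup>s\<^sub>r\<^esup>\<close> is represented by its coefficient \<open>h\<close>, a
  polynomial in the \<open>s\<^sub>i\<close> over the rational functions in \<open>z\<close>. The module proper consists
  of the \<open>h\<close> whose coefficients have a power of \<open>f\<^sub>1 \<cdots> f\<^sub>r\<close> as denominator; it is stable under
  the operators below and contains every element they are applied to, so that the larger ambient
  type does not change anything.\<close>

type_synonym smod = "(nat \<Rightarrow>\<^sub>0 nat) \<Rightarrow>\<^sub>0 ratfun"

definition s_const :: "ratfun \<Rightarrow> smod" where
  "s_const a = Poly_Mapping.single 0 a"

definition s_var :: "nat \<Rightarrow> smod" where
  "s_var i = Poly_Mapping.single (Poly_Mapping.single i 1) 1"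

definition s_scalar :: "complex \<Rightarrow> smod" where
  "s_scalar c = s_const (ratfun_of (mpoly_const c))"

definition s_binom :: "nat \<Rightarrow> nat \<Rightarrow> smod" where
  "s_binom i k = s_scalar (1 / fact k) * (\<Prod>l<k. s_var i - of_nat l)"

text \<open>In \<open>smod_partial\<close>, \<open>Poly_Mapping.map (ratfun_deriv j) h\<close> is the derivative of \<open>h\<close> with
  respect to \<open>z\<^sub>j\<close>, taken coefficientwise with the \<open>s\<^sub>i\<close> as constants.\<close>

definition smod_partial :: "mpoly list \<Rightarrow> nat \<Rightarrow> smod \<Rightarrow> smod" where
  "smod_partial fs j h = Poly_Mapping.map (ratfun_deriv j) h
     + h * (\<Sum>i<length fs.
         s_var i * s_const (ratfun_of (mpoly_deriv j (fs ! i)) / ratfun_of (fs ! i)))"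

text \<open>The operators by which the elements of the Weyl algebra in the variables \<open>V\<close>, with
  \<open>s\<^sub>1, \<dots>, s\<^sub>r\<close> adjoined, act on the module: the algebra of operators generated by the complex
  scalars, the \<open>z\<^sub>j\<close>, the \<open>\<partial>\<^sub>j\<close> and the \<open>s\<^sub>i\<close>.\<close>

inductive_set weyl_ops :: "nat set \<Rightarrow> mpoly list \<Rightarrow> (smod \<Rightarrow> smod) set"
  for V :: "nat set" and fs :: "mpoly list" where
  scalar: "(\<lambda>h. s_scalar c * h) \<in> weyl_ops V fs"
| var: "j \<in> V \<Longrightarrow> (\<lambda>h. s_const (ratfun_of (mpoly_var j)) * h) \<in> weyl_ops V fs"
| partial: "j \<in> V \<Longrightarrow> smod_partial fs j \<in> weyl_ops V fs"
| svar: "i < length fs \<Longrightarrow> (\<lambda>h. s_var i * h) \<in> weyl_ops V fs"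
| add: "P \<in> weyl_ops V fs \<Longrightarrow> Q \<in> weyl_ops V fs \<Longrightarrow> (\<lambda>h. P h + Q h) \<in> weyl_ops V fs"
| mult: "P \<in> weyl_ops V fs \<Longrightarrow> Q \<in> weyl_ops V fs \<Longrightarrow> P \<circ> Q \<in> weyl_ops V fs"

section \<open>Bernstein-Sato polynomials\<close>

definition bs_shifts :: "nat \<Rightarrow> int list set" where
  "bs_shifts r = {u. length u = r \<and> sum_list u = 1}"

text \<open>The element \<open>(\<Prod>u\<^sub>i<0. binom(s\<^sub>i, -u\<^sub>i)) f\<^sub>1\<^bsup>s\<^sub>1+u\<^sub>1\<^esup> \<cdots> f\<^sub>r\<^bsup>s\<^sub>r+u\<^sub>r\<^esup>\<close>.\<close>

definition bs_gen :: "mpoly list \<Rightarrow> int list \<Rightarrow> smod" where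
  "bs_gen fs u = (\<Prod>i | i < length fs \<and> u ! i < 0. s_binom i (nat (- (u ! i))))
     * s_const (\<Prod>i<length fs. ratfun_of (fs ! i) powi (u ! i))"

definition bs_submodule :: "nat set \<Rightarrow> mpoly list \<Rightarrow> smod set" where
  "bs_submodule V fs = {(\<Sum>u\<in>U. P u (bs_gen fs u)) | U P.
     finite U \<and> U \<subseteq> bs_shifts (length fs) \<and> (\<forall>u\<in>U. P u \<in> weyl_ops V fs)}"

text \<open>The functional equation; its left-hand side is \<open>b(s\<^sub>1 + \<cdots> + s\<^sub>r)\<close>.\<close>

definition bs_equation :: "nat set \<Rightarrow> mpoly list \<Rightarrow> complex poly \<Rightarrow> bool" where
  "bs_equation V fs b \<longleftrightarrow>
     poly (map_poly s_scalar b) (\<Sum>i<length fs. s_var i) \<in> bs_submodule V fs"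

definition is_bs_poly :: "nat set \<Rightarrow> mpoly list \<Rightarrow> complex poly \<Rightarrow> bool" where
  "is_bs_poly V fs b \<longleftrightarrow> lead_coeff b = 1 \<and> bs_equation V fs b
     \<and> (\<forall>c. c \<noteq> 0 \<and> bs_equation V fs c \<longrightarrow> degree b \<le> degree c)"

definition ideal_generators :: "nat set \<Rightarrow> mpoly set \<Rightarrow> mpoly list \<Rightarrow> bool" where
  "ideal_generators V I fs \<longleftrightarrow>
     set fs \<subseteq> carrier (mpoly_ring V) \<and> 0 \<notin> set fs \<and> I = genideal (mpoly_ring V) (set fs)"

text \<open>The polynomials below always exist for a non-zero ideal or polynomial (and do not depend on
  the generators); the value 0 only makes the functions total.\<close>

definition the_or_zero :: "(complex poly \<Rightarrow> bool) \<Rightarrow> complex poly" where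
  "the_or_zero Q = (if \<exists>b. Q b then THE b. Q b else 0)"

definition bs_poly_ideal :: "nat set \<Rightarrow> mpoly set \<Rightarrow> complex poly" where
  "bs_poly_ideal V I = the_or_zero (\<lambda>b. \<exists>fs. ideal_generators V I fs \<and> is_bs_poly V fs b)"

definition bs_poly :: "nat set \<Rightarrow> mpoly \<Rightarrow> complex poly" where
  "bs_poly V g = the_or_zero (is_bs_poly V [g])"

end

theory Submission
  imports Defs "HOL-Computational_Algebra.Fundamental_Theorem_Algebra"
begin

text \<open>
  Let \<open>\<sigma> = s\<^sub>1 + \<cdots> + s\<^sub>r\<close>, let \<open>A\<close> be the submodule in the functional equation of generators
  \<open>f\<^sub>1, \<dots>, f\<^sub>r\<close> of the ideal, and let \<open>B\<close> be the one of \<open>g\<close>, both as \<open>\<complex>[\<sigma>]\<close>-modules. They are torsion free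
  and live in different variables, so the submodule of \<open>f\<^sub>1 g, \<dots>, f\<^sub>r g\<close> is \<open>A \<otimes>\<^bsub>\<complex>[\<sigma>]\<^esub> B\<close>. Comparing
  coefficients, \<open>b(\<sigma>) \<in> A \<otimes> B\<close> implies \<open>b(\<sigma>) \<in> A\<close> and \<open>b(\<sigma>) \<in> B\<close>. If the minimal polynomial of the product
  were a proper divisor of the product of the minimal polynomials \<open>b\<close> and \<open>c\<close>, then \<open>b \<otimes> c\<close> would be
  divisible by some \<open>p = \<sigma> - \<alpha>\<close> in \<open>A \<otimes> B\<close>, hence vanish in \<open>A/pA \<otimes> B/pB\<close>, a tensor product over a
  field; so \<open>b \<in> pA\<close> or \<open>c \<in> pB\<close>, against minimality. The existence of Bernstein-Sato polynomials is
  not needed, as the argument shows that they exist for both factors as soon as they exist for the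
  product.

  Independence of the generators comes from the delta-function picture. There the submodule
  consists of the derivatives of the elements \<open>h \<tau>\<^bsup>\<nu>\<^esup> exp (\<Sum>\<^sub>i \<tau>\<^sub>i f\<^sub>i)\<close>, where \<open>h\<close> lies in the power \<open>|\<nu>| + 1\<close> of the
  ideal, and \<open>\<sigma>\<close> acts as \<open>\<Sum>\<^sub>i \<tau>\<^sub>i \<partial>/\<partial>\<tau>\<^sub>i\<close>. If \<open>f'\<^sub>k = \<Sum>\<^sub>i a\<^sub>k\<^sub>i f\<^sub>i\<close>, then the substitution
  \<open>\<tau>\<^sub>i \<mapsto> \<Sum>\<^sub>k a\<^sub>k\<^sub>i \<tau>'\<^sub>k\<close> maps one exponential to the other and respects this description.
\<close>

section \<open>Polynomials as finitely supported maps\<close>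

text \<open>Between the modules of two generator lists there is no evident map, because the s_i
  belong to the individual generators. The delta-function picture trades them for variables \<tau>_i
  that transform linearly under a change of generators; \<open>mellin\<close> links the two pictures
  and is injective, so the functional equation can be read in either. Independence of the generators
  is also needed for the product ideal: its generators are multiples of g, but the cofactors may
  involve the variables of g.

  No tensor product is constructed. Both modules are subsets of the one ring \<open>smod\<close>,
  and A \<otimes> B is replaced by the span of the products a b. For this the module of g, with its
  own variable s, is first moved by s \<mapsto> \<sigma>. Injectivity is replaced by linear
  disjointness over \<complex>[\<sigma>], obtained from the monomials in the variables of g.

  Since the Bernstein-Sato functions take the value 0 where nothing exists, a default on the left
  must be matched on the right; this requires generators of the ideal to be recovered from
  generators of the product.\<close>

lemma poly_mapping_add_induct [case_names zero single add]:
  fixes p :: "'m \<Rightarrow>\<^sub>0 'a::comm_monoid_add"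
  assumes "P 0" "\<And>m c. P (Poly_Mapping.single m c)" "\<And>p q. P p \<Longrightarrow> P q \<Longrightarrow> P (p + q)"
  shows "P p"
proof (induction p rule: update_induct)
  case const
  then show ?case by (rule assms(1))
next
  case (update p m c)
  have "Poly_Mapping.update m c p = p + Poly_Mapping.single m c"
    using update by (intro poly_mapping_eqI)
      (auto simp: lookup_update lookup_add lookup_single in_keys_iff when_def)
  then show ?case using update assms by simp
qed

lemma exponent_induct [case_names zero add]:
  fixes m :: "'i \<Rightarrow>\<^sub>0 nat"
  assumes "P 0" "\<And>m i. P m \<Longrightarrow> P (m + Poly_Mapping.single i 1)"
  shows "P m"
proof -
  have "P (m' + m)" if "P m'" for m'
    using that
  proof (induction m arbitrary: m' rule: poly_mapping_add_induct)
    case (single i c)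
    show ?case
    proof (induction c)
      case 0 then show ?case using single by simp
    next
      case (Suc c)
      have "m' + Poly_Mapping.single i (Suc c) = m' + Poly_Mapping.single i c + Poly_Mapping.single i 1"
        by (simp add: add.assoc flip: single_add)
      then show ?case using assms(2) Suc by metis
    qed
  qed (simp, metis add.assoc)
  from this[of 0] assms(1) show ?thesis by simp
qed

lemma poly_induct [case_names const var add mult]:
  fixes p :: "('i \<Rightarrow>\<^sub>0 nat) \<Rightarrow>\<^sub>0 'a::comm_ring_1"
  assumes "\<And>c. P (Poly_Mapping.single 0 c)"
    and "\<And>i. P (Poly_Mapping.single (Poly_Mapping.single i 1) 1)"
    and "\<And>p q. P p \<Longrightarrow> P q \<Longrightarrow> P (p + q)" and "\<And>p q. P p \<Longrightarrow> P q \<Longrightarrow> P (p * q)"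
  shows "P p"
proof (induction p rule: poly_mapping_add_induct)
  case zero
  then show ?case using assms(1)[of 0] by simp
next
  case (single m c)
  have "P (Poly_Mapping.single m 1)"
  proof (induction m rule: exponent_induct)
    case zero
    then show ?case using assms(1)[of 1] by simp
  next
    case (add m i)
    then show ?case using assms(4)[OF add assms(2)[of i]] by (simp add: mult_single)
  qed
  then show ?case using assms(4)[OF assms(1)[of c], of "Poly_Mapping.single m 1"] by (simp add: mult_single)
qed (rule assms(3))

text \<open>Left general in \<open>e\<close> because it serves three ends: substitution
  homomorphisms for \<open>e = monomial_at v\<close>, and the non-multiplicative maps
  \<open>s_deriv\<close> and \<open>mellin\<close>.\<close>

definition lin_ext :: "('a \<Rightarrow> 'b) \<Rightarrow> ('m \<Rightarrow> 'b) \<Rightarrow> ('m \<Rightarrow>\<^sub>0 'a::comm_ring_1) \<Rightarrow> 'b::comm_ring_1" where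
  "lin_ext \<kappa> e p = (\<Sum>m\<in>Poly_Mapping.keys p. \<kappa> (Poly_Mapping.lookup p m) * e m)"

definition monomial_at :: "('i \<Rightarrow> 'b::comm_ring_1) \<Rightarrow> ('i \<Rightarrow>\<^sub>0 nat) \<Rightarrow> 'b" where
  "monomial_at v m = (\<Prod>i\<in>Poly_Mapping.keys m. v i ^ Poly_Mapping.lookup m i)"

lemma monomial_at_superset:
  assumes "finite A" "Poly_Mapping.keys m \<subseteq> A"
  shows "monomial_at v m = (\<Prod>i\<in>A. v i ^ Poly_Mapping.lookup m i)"
  unfolding monomial_at_def
  by (rule prod.mono_neutral_left) (use assms in \<open>auto simp: in_keys_iff\<close>)

lemma monomial_at_0 [simp]: "monomial_at v 0 = 1"
  by (simp add: monomial_at_def)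

lemma monomial_at_single [simp]: "monomial_at v (Poly_Mapping.single i n) = v i ^ n"
  by (subst monomial_at_superset[of "{i}"]) auto

lemma monomial_at_add: "monomial_at v (m + n) = monomial_at v m * monomial_at v n"
proof -
  let ?A = "Poly_Mapping.keys m \<union> Poly_Mapping.keys n"
  have "Poly_Mapping.keys (m + n) \<subseteq> ?A"
    by (rule keys_add)
  then show ?thesis
    by (simp add: monomial_at_superset[of ?A] lookup_add power_add prod.distrib)
qed

locale coeff_hom =
  fixes \<kappa> :: "'a::comm_ring_1 \<Rightarrow> 'b::comm_ring_1"
  assumes hom_add: "\<kappa> (x + y) = \<kappa> x + \<kappa> y"
    and hom_mult: "\<kappa> (x * y) = \<kappa> x * \<kappa> y"
    and hom_1 [simp]: "\<kappa> 1 = 1"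
begin

lemma hom_0 [simp]: "\<kappa> 0 = 0"
  using hom_add[of 0 0] by simp

lemma hom_uminus: "\<kappa> (- x) = - \<kappa> x"
  using hom_add[of x "- x"] by (simp add: eq_neg_iff_add_eq_0 add.commute)

lemma hom_diff: "\<kappa> (x - y) = \<kappa> x - \<kappa> y"
  using hom_add[of x "- y"] by (simp add: hom_uminus)

lemma hom_sum: "\<kappa> (sum h A) = (\<Sum>x\<in>A. \<kappa> (h x))"
  by (induction A rule: infinite_finite_induct) (simp_all add: hom_add)

lemma hom_prod: "\<kappa> (prod h A) = (\<Prod>x\<in>A. \<kappa> (h x))"
  by (induction A rule: infinite_finite_induct) (simp_all add: hom_mult)

lemma hom_power: "\<kappa> (x ^ n) = \<kappa> x ^ n"
  by (induction n) (simp_all add: hom_mult)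

lemma hom_of_nat: "\<kappa> (of_nat n) = of_nat n"
  by (induction n) (simp_all add: hom_add)

lemma lin_ext_superset:
  assumes "finite A" "Poly_Mapping.keys p \<subseteq> A"
  shows "lin_ext \<kappa> e p = (\<Sum>m\<in>A. \<kappa> (Poly_Mapping.lookup p m) * e m)"
  unfolding lin_ext_def
  by (rule sum.mono_neutral_left) (use assms in \<open>auto simp: in_keys_iff\<close>)

lemma lin_ext_0 [simp]: "lin_ext \<kappa> e 0 = 0"
  by (simp add: lin_ext_def)

lemma lin_ext_single: "lin_ext \<kappa> e (Poly_Mapping.single m c) = \<kappa> c * e m"
  by (subst lin_ext_superset[of "{m}"]) auto

lemma lin_ext_add: "lin_ext \<kappa> e (p + q) = lin_ext \<kappa> e p + lin_ext \<kappa> e q"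
proof -
  let ?A = "Poly_Mapping.keys p \<union> Poly_Mapping.keys q"
  have "Poly_Mapping.keys (p + q) \<subseteq> ?A"
    by (rule keys_add)
  then show ?thesis
    by (simp add: lin_ext_superset[of ?A] lookup_add hom_add distrib_right sum.distrib)
qed

lemma lin_ext_sum: "lin_ext \<kappa> e (sum h A) = (\<Sum>x\<in>A. lin_ext \<kappa> e (h x))"
  by (induction A rule: infinite_finite_induct) (simp_all add: lin_ext_add)

lemma coeff_hom_poly_hom: "coeff_hom (lin_ext \<kappa> (monomial_at v))"
proof
  fix p q :: "('c \<Rightarrow>\<^sub>0 nat) \<Rightarrow>\<^sub>0 'a"
  show "lin_ext \<kappa> (monomial_at v) (p * q) = lin_ext \<kappa> (monomial_at v) p * lin_ext \<kappa> (monomial_at v) q"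
  proof (induction p rule: poly_mapping_add_induct)
    case (single m c)
    show ?case
      by (induction q rule: poly_mapping_add_induct)
        (simp_all add: mult_single lin_ext_single hom_mult monomial_at_add lin_ext_add algebra_simps)
  qed (simp_all add: lin_ext_add algebra_simps)
  show "lin_ext \<kappa> (monomial_at v) 1 = 1"
    using lin_ext_single[of "monomial_at v" 0 1] by simp
qed (rule lin_ext_add)

lemma poly_hom_const: "lin_ext \<kappa> (monomial_at v) (Poly_Mapping.single 0 c) = \<kappa> c"
  by (simp add: lin_ext_single)

lemma poly_hom_var:
  "lin_ext \<kappa> (monomial_at v) (Poly_Mapping.single (Poly_Mapping.single i 1) 1) = v i"
  by (simp add: lin_ext_single)

end

section \<open>Derivations\<close>

locale derivation =
  fixes D :: "'a::comm_ring_1 \<Rightarrow> 'a"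
  assumes D_add: "D (x + y) = D x + D y"
    and D_mult: "D (x * y) = D x * y + x * D y"
begin

lemma D_0 [simp]: "D 0 = 0"
  using D_add[of 0 0] by simp

lemma D_1 [simp]: "D 1 = 0"
  using D_mult[of 1 1] by simp

lemma D_uminus: "D (- x) = - D x"
  using D_add[of x "- x"] by (simp add: eq_neg_iff_add_eq_0 add.commute)

lemma D_diff: "D (x - y) = D x - D y"
  using D_add[of x "- y"] by (simp add: D_uminus)

lemma D_sum: "D (sum h A) = (\<Sum>x\<in>A. D (h x))"
  by (induction A rule: infinite_finite_induct) (simp_all add: D_add)

lemma D_of_nat [simp]: "D (of_nat n) = 0"
  by (induction n) (simp_all add: D_add)

lemma D_const_power: "D x = 0 \<Longrightarrow> D (x ^ n) = 0"
  by (induction n) (simp_all add: D_mult)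

lemma map_0: "Poly_Mapping.map D 0 = 0"
  by (intro poly_mapping_eqI) (simp add: Poly_Mapping.map.rep_eq)

lemma map_derivation: "derivation (Poly_Mapping.map D :: ('m::comm_monoid_add \<Rightarrow>\<^sub>0 'a) \<Rightarrow> _)"
proof
  show add: "Poly_Mapping.map D (p + q) = Poly_Mapping.map D p + Poly_Mapping.map D q"
    for p q :: "'m \<Rightarrow>\<^sub>0 'a"
    by (intro poly_mapping_eqI)
      (use D_add in \<open>auto simp: Poly_Mapping.map.rep_eq lookup_add when_def simp flip: D_add\<close>)
  show "Poly_Mapping.map D (p * q) = Poly_Mapping.map D p * q + p * Poly_Mapping.map D q"
    for p q :: "'m \<Rightarrow>\<^sub>0 'a"
  proof (induction p rule: poly_mapping_add_induct)
    case (single m c)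
    show ?case
      by (induction q rule: poly_mapping_add_induct)
        (simp_all add: map_0 mult_single add D_mult algebra_simps flip: single_add)
  qed (simp_all add: map_0 add algebra_simps)
qed

end

section \<open>Derivatives of rational functions and of polynomials over them\<close>

lemma mpoly_deriv_derivation: "derivation (mpoly_deriv j)"
  by unfold_locales (simp_all add: mpoly_deriv_add mpoly_deriv_mult)

lemma ratfun_deriv_Fract:
  "q \<noteq> 0 \<Longrightarrow> ratfun_deriv j (Fraction_Field.Fract p q) = Fraction_Field.Fract (mpoly_deriv j p * q - p * mpoly_deriv j q) (q ^ 2)"
  by (transfer fixing: j) (auto simp: fractrel_def)

lemma ratfun_deriv_derivation: "derivation (ratfun_deriv j)"
proof
  interpret D: derivation "mpoly_deriv j"
    by (rule mpoly_deriv_derivation)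
  fix x y :: ratfun
  obtain p q where x: "x = Fraction_Field.Fract p q" "q \<noteq> 0" by (cases x)
  obtain p' q' where y: "y = Fraction_Field.Fract p' q'" "q' \<noteq> 0" by (cases y)
  show "ratfun_deriv j (x + y) = ratfun_deriv j x + ratfun_deriv j y"
    using x y
    by (simp add: ratfun_deriv_Fract eq_fract D.D_add D.D_mult power2_eq_square) (simp add: algebra_simps)
  show "ratfun_deriv j (x * y) = ratfun_deriv j x * y + x * ratfun_deriv j y"
    using x y
    by (simp add: ratfun_deriv_Fract eq_fract D.D_add D.D_mult power2_eq_square) (simp add: algebra_simps)
qed

interpretation RD: derivation "ratfun_deriv j" for j
  by (rule ratfun_deriv_derivation)

interpretation ratfun_of: coeff_hom ratfun_of
  by unfold_locales (simp_all add: ratfun_of_def One_fract_def)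

lemma ratfun_of_eq_0_iff [simp]: "ratfun_of p = 0 \<longleftrightarrow> p = 0"
  by (simp add: ratfun_of_def Zero_fract_def eq_fract)

lemma ratfun_deriv_of: "ratfun_deriv j (ratfun_of p) = ratfun_of (mpoly_deriv j p)"
proof -
  interpret D: derivation "mpoly_deriv j"
    by (rule mpoly_deriv_derivation)
  show ?thesis
    by (simp add: ratfun_of_def ratfun_deriv_Fract)
qed

lemma ratfun_deriv_divide:
  assumes "y \<noteq> 0"
  shows "ratfun_deriv j (x / y) = (ratfun_deriv j x * y - x * ratfun_deriv j y) / y ^ 2"
proof -
  have "ratfun_deriv j x = ratfun_deriv j (x / y) * y + x / y * ratfun_deriv j y"
    using RD.D_mult[of j "x / y" y] assms by simp
  then show ?thesis using assms by (simp add: field_simps power2_eq_square)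
qed

abbreviation coeff_deriv :: "nat \<Rightarrow> smod \<Rightarrow> smod" where
  "coeff_deriv j \<equiv> Poly_Mapping.map (ratfun_deriv j)"

interpretation CD: derivation "coeff_deriv j" for j
  by (rule RD.map_derivation)

interpretation s_const: coeff_hom s_const
  by unfold_locales (simp_all add: s_const_def single_add mult_single)

lemma coeff_deriv_const [simp]: "coeff_deriv j (s_const a) = s_const (ratfun_deriv j a)"
  by (simp add: s_const_def)

lemma coeff_deriv_var [simp]: "coeff_deriv j (s_var i) = 0"
  by (simp add: s_var_def)

lemma smod_induct [case_names const var add mult]:
  fixes p :: smod
  assumes "\<And>a. P (s_const a)" "\<And>i. P (s_var i)"
    and "\<And>p q. P p \<Longrightarrow> P q \<Longrightarrow> P (p + q)" and "\<And>p q. P p \<Longrightarrow> P q \<Longrightarrow> P (p * q)"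
  shows "P p"
  by (induction p rule: poly_induct) (use assms in \<open>simp_all add: s_const_def s_var_def\<close>)

lemma s_const_eq_0_iff [simp]: "s_const a = 0 \<longleftrightarrow> a = 0"
  by (metis lookup_single_eq lookup_zero s_const.hom_0 s_const_def)

definition s_deriv :: "nat \<Rightarrow> smod \<Rightarrow> smod" where
  "s_deriv i = lin_ext s_const (\<lambda>m. Poly_Mapping.single (m - Poly_Mapping.single i 1)
     (of_nat (Poly_Mapping.lookup m i)))"

lemma s_deriv_single: "s_deriv i (Poly_Mapping.single m a) =
    Poly_Mapping.single (m - Poly_Mapping.single i 1) (of_nat (Poly_Mapping.lookup m i) * a)"
  by (simp add: s_deriv_def s_const.lin_ext_single s_const_def mult_single mult.commute)

lemma s_deriv_derivation: "derivation (s_deriv i)"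
proof
  show add: "s_deriv i (p + q) = s_deriv i p + s_deriv i q" for p q
    by (simp add: s_deriv_def s_const.lin_ext_add)
  have 0: "s_deriv i 0 = 0"
    by (simp add: s_deriv_def)
  let ?e = "Poly_Mapping.single i (1::nat)"
  \<comment> \<open>Exponent subtraction truncates at 0; where the exponent of s_i is 0, the factor
    \<open>of_nat\<close> makes the derivative vanish instead.\<close>
  have *: "m - ?e + n = m + n - ?e" if "Poly_Mapping.lookup m i \<noteq> 0" for m n :: "nat \<Rightarrow>\<^sub>0 nat"
    using that by (intro poly_mapping_eqI)
      (auto simp: lookup_add lookup_minus lookup_single when_def)
  have monomials: "s_deriv i (Poly_Mapping.single m c * Poly_Mapping.single n d) =
      s_deriv i (Poly_Mapping.single m c) * Poly_Mapping.single n d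
      + Poly_Mapping.single m c * s_deriv i (Poly_Mapping.single n d)" for m n c d
    using *[of m n] *[of n m]
    by (cases "Poly_Mapping.lookup m i = 0"; cases "Poly_Mapping.lookup n i = 0")
      (simp_all add: s_deriv_single mult_single lookup_add algebra_simps flip: single_add)
  show "s_deriv i (p * q) = s_deriv i p * q + p * s_deriv i q" for p q
  proof (induction p rule: poly_mapping_add_induct)
    case (single m c)
    show ?case
      by (induction q rule: poly_mapping_add_induct)
        (simp add: 0, rule monomials, simp add: add algebra_simps)
  qed (simp_all add: 0 add algebra_simps)
qed

interpretation SD: derivation "s_deriv i" for i
  by (rule s_deriv_derivation)

lemma s_deriv_const [simp]: "s_deriv i (s_const a) = 0"
  by (simp add: s_const_def s_deriv_single)

lemma s_deriv_var: "s_deriv i (s_var l) = (if i = l then 1 else 0)"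
  by (auto simp: s_var_def s_deriv_single lookup_single simp flip: single_one)

lemma s_deriv_coeff_deriv: "s_deriv i (coeff_deriv j p) = coeff_deriv j (s_deriv i p)"
proof (induction p rule: poly_mapping_add_induct)
  case (single m c)
  then show ?case by (simp add: s_deriv_single RD.D_mult)
qed (simp_all add: RD.map_0 CD.D_add SD.D_add)

section \<open>Modules with a connection\<close>

text \<open>The j-th partial derivative of h e, for a formal symbol e whose own derivative is
  \<open>\<omega> j\<close> times e. The form is a parameter because three symbols occur: the
  product of powers, the exponential, and g^\<sigma>.\<close>

definition conn :: "(nat \<Rightarrow> smod) \<Rightarrow> nat \<Rightarrow> smod \<Rightarrow> smod" where
  "conn \<omega> j h = coeff_deriv j h + h * \<omega> j"

lemma conn_0 [simp]: "conn \<omega> j 0 = 0"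
  by (simp add: conn_def)

lemma conn_add: "conn \<omega> j (x + y) = conn \<omega> j x + conn \<omega> j y"
  by (simp add: conn_def CD.D_add algebra_simps)

lemma conn_mult: "conn \<omega> j (a * x) = coeff_deriv j a * x + a * conn \<omega> j x"
  by (simp add: conn_def CD.D_mult algebra_simps)

text \<open>Closure under the Weyl algebra in z only. Multiplication by the s_i behaves differently
  in the two pictures: it preserves the Bernstein-Sato submodule (\<open>bs_module_s_var\<close>)
  but lowers the weight of a delta module (\<open>delta_module_s_var\<close>).\<close>

inductive_set dmod :: "nat set \<Rightarrow> (nat \<Rightarrow> smod) \<Rightarrow> smod set \<Rightarrow> smod set"
  for V \<omega> G where
  gen: "h \<in> G \<Longrightarrow> h \<in> dmod V \<omega> G"
| zero: "0 \<in> dmod V \<omega> G"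
| add: "x \<in> dmod V \<omega> G \<Longrightarrow> y \<in> dmod V \<omega> G \<Longrightarrow> x + y \<in> dmod V \<omega> G"
| scalar: "x \<in> dmod V \<omega> G \<Longrightarrow> s_scalar c * x \<in> dmod V \<omega> G"
| var: "x \<in> dmod V \<omega> G \<Longrightarrow> j \<in> V \<Longrightarrow> s_const (ratfun_of (mpoly_var j)) * x \<in> dmod V \<omega> G"
| conn: "x \<in> dmod V \<omega> G \<Longrightarrow> j \<in> V \<Longrightarrow> conn \<omega> j x \<in> dmod V \<omega> G"

interpretation mpoly_const: coeff_hom mpoly_const
  by unfold_locales (simp_all add: mpoly_const_def single_add mult_single)

interpretation s_scalar: coeff_hom s_scalar
  by unfold_locales
    (simp_all add: s_scalar_def mpoly_const.hom_add mpoly_const.hom_mult ratfun_of.hom_add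
      ratfun_of.hom_mult s_const.hom_add s_const.hom_mult)

lemma s_scalar_eq_0_iff [simp]: "s_scalar c = 0 \<longleftrightarrow> c = 0"
  by (simp add: s_scalar_def mpoly_const_def) (metis lookup_single_eq lookup_zero single_zero)

lemma dmod_uminus: "x \<in> dmod V \<omega> G \<Longrightarrow> - x \<in> dmod V \<omega> G"
  using dmod.scalar[of x V \<omega> G "- 1"] by (simp add: s_scalar.hom_uminus)

lemma dmod_diff: "x \<in> dmod V \<omega> G \<Longrightarrow> y \<in> dmod V \<omega> G \<Longrightarrow> x - y \<in> dmod V \<omega> G"
  using dmod.add[OF _ dmod_uminus, of x V \<omega> G y] by simp

lemma dmod_sum: "(\<And>x. x \<in> A \<Longrightarrow> h x \<in> dmod V \<omega> G) \<Longrightarrow> sum h A \<in> dmod V \<omega> G"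
  by (induction A rule: infinite_finite_induct) (auto intro: dmod.zero dmod.add)

lemma dmod_of_nat: "x \<in> dmod V \<omega> G \<Longrightarrow> of_nat n * x \<in> dmod V \<omega> G"
  using dmod.scalar[of x V \<omega> G "of_nat n"] by (simp add: s_scalar.hom_of_nat)

lemma mpoly_sum_monomials: "(p :: mpoly) = (\<Sum>m\<in>Poly_Mapping.keys p. Poly_Mapping.single m (Poly_Mapping.lookup p m))"
  by (intro poly_mapping_eqI)
    (auto simp: lookup_sum lookup_single when_def in_keys_iff sum.delta' if_distrib cong: if_cong)

lemma mpoly_monomial_induct [consumes 1, case_names one var]:
  assumes "Poly_Mapping.keys m \<subseteq> V" "P 1"
    and "\<And>p j. P p \<Longrightarrow> j \<in> V \<Longrightarrow> P (p * mpoly_var j)"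
  shows "P (Poly_Mapping.single m 1)"
  using assms(1)
proof (induction m rule: exponent_induct)
  case zero
  then show ?case using assms(2) by simp
next
  case (add m i)
  have "Poly_Mapping.keys (m + Poly_Mapping.single i 1) = insert i (Poly_Mapping.keys m)"
    by (auto simp: in_keys_iff lookup_add lookup_single when_def split: if_splits)
  then show ?case
    using add assms(3)[of "Poly_Mapping.single m 1" i] by (simp add: mpoly_var_def mult_single)
qed

lemma mpoly_vars_induct [consumes 1, case_names const var add mult]:
  assumes "mpoly_vars p \<subseteq> V"
    and "\<And>c. P (mpoly_const c)" "\<And>j. j \<in> V \<Longrightarrow> P (mpoly_var j)"
    and "\<And>p q. P p \<Longrightarrow> P q \<Longrightarrow> P (p + q)" "\<And>p q. P p \<Longrightarrow> P q \<Longrightarrow> P (p * q)"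
  shows "P p"
proof -
  \<comment> \<open>Partial sums of p itself: the summands of an arbitrary decomposition could
    involve variables outside \<open>V\<close>.\<close>
  have "P (\<Sum>m\<in>A. Poly_Mapping.single m (Poly_Mapping.lookup p m))"
    if "A \<subseteq> Poly_Mapping.keys p" for A
    using finite_subset[OF that finite_keys] that
  proof (induction A)
    case empty
    then show ?case using assms(2)[of 0] by simp
  next
    case (insert m A)
    then have m: "Poly_Mapping.keys m \<subseteq> V" using assms(1) by (auto simp: mpoly_vars_def)
    have "P (Poly_Mapping.single m 1)"
      using m by (induction rule: mpoly_monomial_induct)
        (use assms(2)[of 1] assms(3,5) in auto)
    from assms(5)[OF assms(2)[of "Poly_Mapping.lookup p m"] this]
    have "P (Poly_Mapping.single m (Poly_Mapping.lookup p m))"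
      by (simp add: mpoly_const_def mult_single)
    then show ?case using insert assms(4) by simp
  qed
  from this[of "Poly_Mapping.keys p"] show ?thesis
    by (simp flip: mpoly_sum_monomials)
qed

lemma dmod_poly_mult:
  assumes "mpoly_vars p \<subseteq> V" "x \<in> dmod V \<omega> G"
  shows "s_const (ratfun_of p) * x \<in> dmod V \<omega> G"
  using assms(1)
proof -
  have "\<forall>x\<in>dmod V \<omega> G. s_const (ratfun_of p) * x \<in> dmod V \<omega> G"
    using assms(1)
  proof (induction rule: mpoly_vars_induct)
    case (const c)
    then show ?case using dmod.scalar by (auto simp: s_scalar_def)
  next
    case (mult p q)
    then show ?case by (simp add: ratfun_of.hom_mult s_const.hom_mult mult.assoc)
  qed (auto intro: dmod.intros simp: ratfun_of.hom_add s_const.hom_add distrib_right)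
  then show ?thesis using assms(2) by simp
qed

text \<open>Linearity is asked for over functions of z only, so that \<open>mellin\<close>, which
  does not commute with the s_i, qualifies as well.\<close>

lemma dmod_map:
  assumes "x \<in> dmod V \<omega> G" "\<Phi> 0 = 0"
    and "\<And>x y. \<Phi> (x + y) = \<Phi> x + \<Phi> y"
    and "\<And>a x. \<Phi> (s_const a * x) = s_const a * \<Phi> x"
    and "\<And>j x. j \<in> V \<Longrightarrow> \<Phi> (conn \<omega> j x) = conn \<omega>' j (\<Phi> x)"
    and "\<And>g. g \<in> G \<Longrightarrow> \<Phi> g \<in> dmod V \<omega>' G'"
  shows "\<Phi> x \<in> dmod V \<omega>' G'"
  using assms(1)
  by induction (use assms(2-) in \<open>auto simp: s_scalar_def intro: dmod.intros dmod.scalar[unfolded s_scalar_def]\<close>)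

section \<open>The Bernstein-Sato submodule without the variables s\<close>

definition falling :: "nat \<Rightarrow> nat \<Rightarrow> smod" where
  "falling i n = (\<Prod>l<n. s_var i - of_nat l)"

lemma falling_0 [simp]: "falling i 0 = 1"
  by (simp add: falling_def)

lemma falling_Suc: "falling i (Suc n) = falling i n * (s_var i - of_nat n)"
  by (simp add: falling_def)

definition log_form :: "mpoly list \<Rightarrow> nat \<Rightarrow> smod" where
  "log_form fs j = (\<Sum>i<length fs.
     s_var i * s_const (ratfun_of (mpoly_deriv j (fs ! i)) / ratfun_of (fs ! i)))"

lemma smod_partial_conn: "smod_partial fs j = conn (log_form fs) j"
  by (simp add: fun_eq_iff smod_partial_def conn_def log_form_def)

text \<open>The element \<open>\<Prod>\<^sub>i s\<^sub>i(s\<^sub>i - 1)\<cdots>(s\<^sub>i - \<nu>\<^sub>i + 1) f\<^sub>i\<^bsup>s\<^sub>i + \<mu>\<^sub>i - \<nu>\<^sub>i\<^esup>\<close>; up to signs it is the result of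
  applying \<open>\<Prod>\<^sub>i \<partial>\<^sub>t\<^sub>i\<^bsup>\<nu>\<^sub>i\<^esup> t\<^sub>i\<^bsup>\<mu>\<^sub>i\<^esup>\<close> to the delta function on the graph of the \<open>f\<^sub>i\<close>.\<close>

definition shift_elem :: "mpoly list \<Rightarrow> (nat \<Rightarrow> nat) \<Rightarrow> (nat \<Rightarrow> nat) \<Rightarrow> smod" where
  "shift_elem fs \<nu> \<mu> = (\<Prod>i<length fs. falling i (\<nu> i)
     * s_const (ratfun_of (fs ! i) ^ \<mu> i / ratfun_of (fs ! i) ^ \<nu> i))"

text \<open>Larger than the family of the \<open>bs_gen fs u\<close>: \<nu> and \<mu> may be
  positive at the same index. This overlap absorbs multiplication by the s_i, so that operators in z
  alone suffice on these generators.\<close>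

definition shift_elems :: "mpoly list \<Rightarrow> smod set" where
  "shift_elems fs = {shift_elem fs \<nu> \<mu> | \<nu> \<mu>. (\<Sum>i<length fs. \<mu> i) = Suc (\<Sum>i<length fs. \<nu> i)}"

abbreviation bs_module :: "nat set \<Rightarrow> mpoly list \<Rightarrow> smod set" where
  "bs_module V fs \<equiv> dmod V (log_form fs) (shift_elems fs)"

lemma shift_elem_cong:
  "(\<And>i. i < length fs \<Longrightarrow> \<nu> i = \<nu>' i \<and> \<mu> i = \<mu>' i) \<Longrightarrow> shift_elem fs \<nu> \<mu> = shift_elem fs \<nu>' \<mu>'"
  unfolding shift_elem_def by (intro prod.cong) auto

text \<open>Raising both exponents keeps the power of f_i and appends one factor to the falling
  factorial. So s_i times a generator is a combination of two generators with the same difference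
  |\<mu>| - |\<nu>|.\<close>

lemma shift_elem_Suc:
  assumes "0 \<notin> set fs" "i < length fs"
  shows "shift_elem fs (\<nu>(i := Suc (\<nu> i))) (\<mu>(i := Suc (\<mu> i)))
    = (s_var i - of_nat (\<nu> i)) * shift_elem fs \<nu> \<mu>"
proof -
  let ?t = "\<lambda>\<nu> \<mu> i. falling i (\<nu> i) * s_const (ratfun_of (fs ! i) ^ \<mu> i / ratfun_of (fs ! i) ^ \<nu> i)"
  have "ratfun_of (fs ! i) \<noteq> 0" using assms by (metis nth_mem ratfun_of_eq_0_iff)
  then have i: "?t (\<nu>(i := Suc (\<nu> i))) (\<mu>(i := Suc (\<mu> i))) i = (s_var i - of_nat (\<nu> i)) * ?t \<nu> \<mu> i"
    by (simp add: falling_Suc)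
  have "prod (?t (\<nu>(i := Suc (\<nu> i))) (\<mu>(i := Suc (\<mu> i)))) ({..<length fs} - {i})
      = prod (?t \<nu> \<mu>) ({..<length fs} - {i})"
    by (rule prod.cong) auto
  then show ?thesis
    unfolding shift_elem_def using assms(2) i
    by (simp add: prod.remove[of "{..<length fs}" i] mult.assoc del: fun_upd_apply)
qed

lemma sum_fun_upd_Suc:
  "i < r \<Longrightarrow> (\<Sum>l<r. (\<nu>(i := Suc (\<nu> i))) l) = Suc (\<Sum>l<r. \<nu> l)" for \<nu> :: "nat \<Rightarrow> nat"
  by (simp add: sum.remove[of "{..<r}" i])

lemma bs_module_s_var:
  assumes "0 \<notin> set fs" "i < length fs" "x \<in> bs_module V fs"
  shows "s_var i * x \<in> bs_module V fs"
  using assms(3)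
proof (rule dmod_map)
  show "s_var i * conn (log_form fs) j x = conn (log_form fs) j (s_var i * x)" for j x
    by (simp add: conn_mult)
next
  fix g assume "g \<in> shift_elems fs"
  then obtain \<nu> \<mu> where g: "g = shift_elem fs \<nu> \<mu>"
    and sum: "(\<Sum>i<length fs. \<mu> i) = Suc (\<Sum>i<length fs. \<nu> i)"
    by (auto simp: shift_elems_def)
  have "shift_elem fs (\<nu>(i := Suc (\<nu> i))) (\<mu>(i := Suc (\<mu> i))) \<in> shift_elems fs"
    unfolding shift_elems_def mem_Collect_eq
    by (intro exI conjI, rule refl) (simp only: sum_fun_upd_Suc[OF assms(2)] sum)
  then have "shift_elem fs (\<nu>(i := Suc (\<nu> i))) (\<mu>(i := Suc (\<mu> i))) + of_nat (\<nu> i) * g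
      \<in> bs_module V fs"
    using \<open>g \<in> _\<close> by (intro dmod.add dmod_of_nat dmod.gen)
  then show "s_var i * g \<in> bs_module V fs"
    using assms by (simp add: shift_elem_Suc g algebra_simps)
qed (simp_all add: algebra_simps)

text \<open>The positive and negative parts of u do not overlap, and binomials differ from falling
  factorials by invertible scalars.\<close>

lemma bs_gen_shift_elem:
  "bs_gen fs u = s_scalar (\<Prod>i | i < length fs \<and> u ! i < 0. 1 / fact (nat (- (u ! i))))
     * shift_elem fs (\<lambda>i. nat (- (u ! i))) (\<lambda>i. nat (u ! i))"
proof -
  let ?N = "{i. i < length fs \<and> u ! i < 0}"
  have "(\<Prod>i\<in>?N. falling i (nat (- (u ! i)))) = (\<Prod>i<length fs. falling i (nat (- (u ! i))))"
  proof (rule prod.mono_neutral_left)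
    show "\<forall>i\<in>{..<length fs} - ?N. falling i (nat (- (u ! i))) = 1"
    proof
      fix i assume "i \<in> {..<length fs} - ?N"
      then have "nat (- (u ! i)) = 0" by auto
      then show "falling i (nat (- (u ! i))) = 1" by (simp only: falling_0)
    qed
  qed auto
  moreover have "ratfun_of (fs ! i) powi (u ! i)
      = ratfun_of (fs ! i) ^ nat (u ! i) / ratfun_of (fs ! i) ^ nat (- (u ! i))" for i
    by (simp add: power_int_def divide_inverse power_inverse)
  ultimately show ?thesis
    by (simp add: bs_gen_def shift_elem_def s_binom_def prod.distrib s_scalar.hom_prod
        s_const.hom_prod mult.assoc flip: falling_def)
qed

section \<open>Closure properties of the submodule in the functional equation\<close>

lemma weyl_ops_additive: "P \<in> weyl_ops V fs \<Longrightarrow> P (x + y) = P x + P y"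
  by (induction arbitrary: x y rule: weyl_ops.induct)
    (simp_all add: distrib_left smod_partial_conn conn_add)

lemma weyl_ops_0: "P \<in> weyl_ops V fs \<Longrightarrow> P 0 = 0"
  using weyl_ops_additive[of P V fs 0 0] by (simp only: add_0_right) (metis add_cancel_right_right)

lemma weyl_ops_sum: "P \<in> weyl_ops V fs \<Longrightarrow> P (sum h A) = (\<Sum>x\<in>A. P (h x))"
  by (induction A rule: infinite_finite_induct) (simp_all add: weyl_ops_additive weyl_ops_0)

lemma bs_module_weyl_ops:
  assumes "0 \<notin> set fs" "P \<in> weyl_ops V fs" "x \<in> bs_module V fs"
  shows "P x \<in> bs_module V fs"
  using assms(2,3)
proof (induction arbitrary: x rule: weyl_ops.induct)
  case (mult P Q)
  then show ?case by simp
qed (simp_all add: smod_partial_conn dmod.scalar dmod.var dmod.conn dmod.add bs_module_s_var[OF assms(1)])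

lemma bs_submodule_weyl_ops:
  assumes "Q \<in> weyl_ops V fs" "x \<in> bs_submodule V fs"
  shows "Q x \<in> bs_submodule V fs"
proof -
  obtain U P where "x = (\<Sum>u\<in>U. P u (bs_gen fs u))" and
    U: "finite U" "U \<subseteq> bs_shifts (length fs)" and P: "\<forall>u\<in>U. P u \<in> weyl_ops V fs"
    using assms(2) by (auto simp: bs_submodule_def)
  then have "Q x = (\<Sum>u\<in>U. (Q \<circ> P u) (bs_gen fs u))"
    using assms(1) by (simp add: weyl_ops_sum)
  moreover have "\<forall>u\<in>U. Q \<circ> P u \<in> weyl_ops V fs"
    using P assms(1) weyl_ops.mult by blast
  ultimately show ?thesis
    unfolding bs_submodule_def using U by (intro CollectI exI[of _ U] exI[of _ "\<lambda>u. Q \<circ> P u"]) simp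
qed

lemma weyl_ops_id: "(\<lambda>h. h) \<in> weyl_ops V fs"
proof -
  have "(\<lambda>h. s_scalar 1 * h) = (\<lambda>h. h)" by (simp add: fun_eq_iff)
  then show ?thesis using weyl_ops.scalar[of 1 V fs] by (simp only:)
qed

lemma weyl_ops_zero: "(\<lambda>h. 0) \<in> weyl_ops V fs"
proof -
  have "(\<lambda>h. s_scalar 0 * h) = (\<lambda>h. 0)" by (simp add: fun_eq_iff)
  then show ?thesis using weyl_ops.scalar[of 0 V fs] by (simp only:)
qed

lemma bs_submodule_add:
  assumes "x \<in> bs_submodule V fs" "y \<in> bs_submodule V fs"
  shows "x + y \<in> bs_submodule V fs"
proof -
  obtain U P where x: "x = (\<Sum>u\<in>U. P u (bs_gen fs u))" and
    U: "finite U" "U \<subseteq> bs_shifts (length fs)" and P: "\<forall>u\<in>U. P u \<in> weyl_ops V fs"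
    using assms(1) by (auto simp: bs_submodule_def)
  obtain U' P' where y: "y = (\<Sum>u\<in>U'. P' u (bs_gen fs u))" and
    U': "finite U'" "U' \<subseteq> bs_shifts (length fs)" and P': "\<forall>u\<in>U'. P' u \<in> weyl_ops V fs"
    using assms(2) by (auto simp: bs_submodule_def)
  \<comment> \<open>\<open>bs_submodule\<close> has one operator per shift, so the two families are
    added over the union of their supports, each continued by the zero operator.\<close>
  define R where "R u = (\<lambda>h. (if u \<in> U then P u else (\<lambda>h. 0)) h + (if u \<in> U' then P' u else (\<lambda>h. 0)) h)" for u
  have "x + y = (\<Sum>u\<in>U \<union> U'. R u (bs_gen fs u))"
    unfolding x y R_def sum.distrib using U(1) U'(1)
    by (intro arg_cong2[of _ _ _ _ "(+)"] sum.mono_neutral_cong_left) auto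
  moreover have "R u \<in> weyl_ops V fs" for u
    unfolding R_def using P P' weyl_ops_zero by (intro weyl_ops.add) auto
  ultimately show ?thesis
    unfolding bs_submodule_def using U U' by (intro CollectI exI[of _ "U \<union> U'"] exI[of _ R]) simp
qed

lemma bs_gen_in_bs_submodule: "u \<in> bs_shifts (length fs) \<Longrightarrow> bs_gen fs u \<in> bs_submodule V fs"
  unfolding bs_submodule_def using weyl_ops_id
  by (intro CollectI exI[of _ "{u}"] exI[of _ "\<lambda>_ h. h"]) simp

text \<open>Overlapping exponents are lowered with \<open>shift_elem_Suc\<close>, whose extra factor
  belongs to \<open>weyl_ops\<close>; when no overlap is left, the element is a nonzero multiple of
  \<open>bs_gen\<close> at u = \<mu> - \<nu>.\<close>

lemma shift_elem_in_bs_submodule: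
  assumes "0 \<notin> set fs" "(\<Sum>i<length fs. \<mu> i) = Suc (\<Sum>i<length fs. \<nu> i)"
  shows "shift_elem fs \<nu> \<mu> \<in> bs_submodule V fs"
  using assms(2)
proof (induction "\<Sum>i<length fs. \<nu> i" arbitrary: \<nu> \<mu> rule: less_induct)
  case less
  show ?case
  proof (cases "\<exists>i<length fs. 0 < \<nu> i \<and> 0 < \<mu> i")
    case True
    then obtain i where i: "i < length fs" "0 < \<nu> i" "0 < \<mu> i" by blast
    define \<nu>' \<mu>' where "\<nu>' = \<nu>(i := \<nu> i - 1)" and "\<mu>' = \<mu>(i := \<mu> i - 1)"
    have upd: "\<nu> = \<nu>'(i := Suc (\<nu>' i))" "\<mu> = \<mu>'(i := Suc (\<mu>' i))"
      using i by (auto simp: \<nu>'_def \<mu>'_def)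
    have sums: "(\<Sum>l<length fs. \<nu> l) = Suc (\<Sum>l<length fs. \<nu>' l)"
        "(\<Sum>l<length fs. \<mu> l) = Suc (\<Sum>l<length fs. \<mu>' l)"
      using sum_fun_upd_Suc[OF i(1), of \<nu>'] sum_fun_upd_Suc[OF i(1), of \<mu>'] upd by simp_all
    have IH: "shift_elem fs \<nu>' \<mu>' \<in> bs_submodule V fs"
      using less(1)[of \<nu>' \<mu>'] less(2) sums by simp
    have "(\<lambda>h. s_var i * h + s_scalar (- of_nat (\<nu>' i)) * h) \<in> weyl_ops V fs"
      by (intro weyl_ops.intros i)
    from bs_submodule_weyl_ops[OF this IH]
    have "(s_var i - of_nat (\<nu>' i)) * shift_elem fs \<nu>' \<mu>' \<in> bs_submodule V fs"
      by (simp add: s_scalar.hom_uminus s_scalar.hom_of_nat algebra_simps)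
    then show ?thesis
      using shift_elem_Suc[OF assms(1) i(1), of \<nu>' \<mu>'] upd by simp
  next
    case False
    define u where "u = map (\<lambda>i. int (\<mu> i) - int (\<nu> i)) [0..<length fs]"
    have "sum_list u = (\<Sum>i<length fs. int (\<mu> i) - int (\<nu> i))"
      by (simp add: u_def interv_sum_list_conv_sum_set_nat atLeast0LessThan)
    also have "\<dots> = int (\<Sum>i<length fs. \<mu> i) - int (\<Sum>i<length fs. \<nu> i)"
      by (simp add: sum_subtractf)
    also have "\<dots> = 1" using less(2) by simp
    finally have u: "u \<in> bs_shifts (length fs)"
      by (simp add: bs_shifts_def u_def)
    define c :: complex where "c = (\<Prod>i | i < length fs \<and> u ! i < 0. 1 / fact (nat (- (u ! i))))"
    have c: "c \<noteq> 0" by (simp add: c_def)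
    have "shift_elem fs \<nu> \<mu> = shift_elem fs (\<lambda>i. nat (- (u ! i))) (\<lambda>i. nat (u ! i))"
      using False by (intro shift_elem_cong) (auto simp: u_def)
    also have "\<dots> = s_scalar (1 / c) * bs_gen fs u"
      using c by (simp add: bs_gen_shift_elem flip: c_def mult.assoc s_scalar.hom_mult)
    finally show ?thesis
      using bs_submodule_weyl_ops[OF weyl_ops.scalar bs_gen_in_bs_submodule[OF u]] by simp
  qed
qed

proposition bs_submodule_eq:
  assumes "0 \<notin> set fs"
  shows "bs_submodule V fs = bs_module V fs"
proof
  have gen: "bs_gen fs u \<in> bs_module V fs" if u: "u \<in> bs_shifts (length fs)" for u
  proof -
    let ?r = "length fs"
    have "(\<Sum>i<?r. int (nat (u ! i))) - (\<Sum>i<?r. int (nat (- (u ! i)))) = (\<Sum>i<?r. u ! i)"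
      unfolding sum_subtractf[symmetric] by (rule sum.cong) auto
    also have "\<dots> = 1"
      using u sum_list_sum_nth[of u] unfolding bs_shifts_def by (auto simp: atLeast0LessThan)
    finally have "(\<Sum>i<?r. nat (u ! i)) = Suc (\<Sum>i<?r. nat (- (u ! i)))"
      unfolding of_nat_sum[symmetric] by linarith
    then show ?thesis
      unfolding bs_gen_shift_elem by (intro dmod.scalar dmod.gen) (auto simp: shift_elems_def)
  qed
  show "bs_submodule V fs \<subseteq> bs_module V fs"
  proof
    fix x assume "x \<in> bs_submodule V fs"
    then obtain U P where x: "x = (\<Sum>u\<in>U. P u (bs_gen fs u))" and
      "U \<subseteq> bs_shifts (length fs)" "\<forall>u\<in>U. P u \<in> weyl_ops V fs"
      by (auto simp: bs_submodule_def)
    then show "x \<in> bs_module V fs"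
      unfolding x by (blast intro: dmod_sum bs_module_weyl_ops[OF assms] gen)
  qed
  have zero: "0 \<in> bs_submodule V fs"
    unfolding bs_submodule_def by (intro CollectI exI[of _ "{}"]) simp
  show "bs_module V fs \<subseteq> bs_submodule V fs"
  proof
    fix x assume "x \<in> bs_module V fs"
    then show "x \<in> bs_submodule V fs"
    proof induction
      case (gen h)
      then show ?case using shift_elem_in_bs_submodule[OF assms] by (auto simp: shift_elems_def)
    next
      case (scalar x c)
      then show ?case using bs_submodule_weyl_ops[OF weyl_ops.scalar] by blast
    next
      case (var x j)
      then show ?case using bs_submodule_weyl_ops[OF weyl_ops.var] by blast
    next
      case (conn x j)
      then show ?case
        using bs_submodule_weyl_ops[OF weyl_ops.partial[of j V fs]] by (simp add: smod_partial_conn)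
    qed (auto intro: bs_submodule_add zero)
  qed
qed

section \<open>The delta-function picture\<close>

lemma mpoly_vars_const [simp]: "mpoly_vars (mpoly_const c) = {}"
  by (auto simp: mpoly_vars_def mpoly_const_def split: if_splits)

lemma mpoly_vars_0 [simp]: "mpoly_vars 0 = {}"
  by (simp add: mpoly_vars_def)

lemma mpoly_vars_1 [simp]: "mpoly_vars 1 = {}"
  using mpoly_vars_const[of 1] by simp

lemma mpoly_vars_var [simp]: "mpoly_vars (mpoly_var j) = {j}"
  by (auto simp: mpoly_vars_def mpoly_var_def split: if_splits)

lemma mpoly_vars_add: "mpoly_vars (p + q) \<subseteq> mpoly_vars p \<union> mpoly_vars q"
  using keys_add[of p q] by (auto simp: mpoly_vars_def)

lemma mpoly_vars_mult: "mpoly_vars (p * q) \<subseteq> mpoly_vars p \<union> mpoly_vars q"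
proof
  fix j assume "j \<in> mpoly_vars (p * q)"
  then obtain m where m: "m \<in> Poly_Mapping.keys (p * q)" "j \<in> Poly_Mapping.keys m"
    by (auto simp: mpoly_vars_def)
  then obtain a b where "m = a + b" "a \<in> Poly_Mapping.keys p" "b \<in> Poly_Mapping.keys q"
    using keys_mult[of p q] by blast
  then show "j \<in> mpoly_vars p \<union> mpoly_vars q"
    using m(2) keys_add[of a b] by (auto simp: mpoly_vars_def)
qed

lemma mpoly_vars_uminus [simp]: "mpoly_vars (- p) = mpoly_vars p"
  by (simp add: mpoly_vars_def)

lemma mpoly_deriv_var: "mpoly_deriv j (mpoly_var i) = (if i = j then 1 else 0)"
  by (auto simp: mpoly_var_def mpoly_deriv_single lookup_single simp flip: single_one)

lemma mpoly_deriv_const [simp]: "mpoly_deriv j (mpoly_const c) = 0"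
  by (simp add: mpoly_const_def mpoly_deriv_single)

lemma mpoly_vars_deriv:
  assumes "mpoly_vars p \<subseteq> V" shows "mpoly_vars (mpoly_deriv j p) \<subseteq> V"
proof -
  \<comment> \<open>The product rule involves p and q themselves, so the bound on their variables
    has to be part of the induction.\<close>
  have "mpoly_vars p \<subseteq> V \<and> mpoly_vars (mpoly_deriv j p) \<subseteq> V"
    using assms
  proof (induction rule: mpoly_vars_induct)
    case (mult p q)
    then show ?case
      using mpoly_vars_mult[of p q] mpoly_vars_mult[of "mpoly_deriv j p" q]
        mpoly_vars_mult[of p "mpoly_deriv j q"]
        mpoly_vars_add[of "mpoly_deriv j p * q" "p * mpoly_deriv j q"]
      by (simp add: mpoly_deriv_mult) blast
  next
    case (add p q)
    then show ?case
      using mpoly_vars_add[of p q] mpoly_vars_add[of "mpoly_deriv j p" "mpoly_deriv j q"]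
      by (simp add: mpoly_deriv_add) blast
  qed (simp_all add: mpoly_deriv_var)
  then show ?thesis ..
qed

text \<open>In this picture \<open>s_var i\<close> stands for \<open>\<tau>\<^sub>i = - \<partial>\<^sub>t\<^sub>i\<close>, and \<open>p\<close> for the element \<open>p \<delta>\<close> of the
  module generated by the delta function \<open>\<delta>\<close> on the graph \<open>t\<^sub>i = f\<^sub>i\<close>. Formally
  \<open>\<delta> = exp (\<Sum>\<^sub>i \<tau>\<^sub>i f\<^sub>i)\<close>, whence the connection form; \<open>nabla\<close> is the action of \<open>t\<^sub>i\<close>.\<close>

definition delta_form :: "mpoly list \<Rightarrow> nat \<Rightarrow> smod" where
  "delta_form fs j = (\<Sum>i<length fs. s_var i * s_const (ratfun_of (mpoly_deriv j (fs ! i))))"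

definition nabla :: "mpoly list \<Rightarrow> nat \<Rightarrow> smod \<Rightarrow> smod" where
  "nabla fs i p = s_deriv i p + s_const (ratfun_of (fs ! i)) * p"

text \<open>Each summand \<tau>_i t_i corresponds to s_i and depends on the generators; the sum
  corresponds to s_1 + ... + s_r and is compatible with a change of generators
  (\<open>euler_\<rho>\<close>).\<close>

definition euler :: "mpoly list \<Rightarrow> smod \<Rightarrow> smod" where
  "euler fs p = (\<Sum>i<length fs. s_var i * nabla fs i p)"

text \<open>The \<open>V\<close>-filtration: \<open>t\<^sub>i\<close>, hence \<open>f\<^sub>i\<close>, has weight 1 and \<open>\<tau>\<^sub>i\<close> has weight \<open>-1\<close>.\<close>

inductive weight :: "nat set \<Rightarrow> mpoly list \<Rightarrow> int \<Rightarrow> smod \<Rightarrow> bool" for V fs where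
  const: "mpoly_vars p \<subseteq> V \<Longrightarrow> weight V fs 0 (s_const (ratfun_of p))"
| zero: "weight V fs k 0"
| gen: "i < length fs \<Longrightarrow> weight V fs 1 (s_const (ratfun_of (fs ! i)))"
| tau: "i < length fs \<Longrightarrow> weight V fs (- 1) (s_var i)"
| add: "weight V fs k p \<Longrightarrow> weight V fs k q \<Longrightarrow> weight V fs k (p + q)"
| mult: "weight V fs k p \<Longrightarrow> weight V fs l q \<Longrightarrow> weight V fs (k + l) (p * q)"

abbreviation delta_module :: "nat set \<Rightarrow> mpoly list \<Rightarrow> int \<Rightarrow> smod set" where
  "delta_module V fs k \<equiv> dmod V (delta_form fs) {p. weight V fs k p}"

lemma weight_1: "weight V fs 0 1"
  using weight.const[of 1 V fs] by simp

lemma weight_sum: "(\<And>x. x \<in> A \<Longrightarrow> weight V fs k (h x)) \<Longrightarrow> weight V fs k (sum h A)"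
  by (induction A rule: infinite_finite_induct) (auto intro: weight.zero weight.add)

lemma nabla_0 [simp]: "nabla fs i 0 = 0"
  by (simp add: nabla_def)

lemma nabla_add: "nabla fs i (p + q) = nabla fs i p + nabla fs i q"
  by (simp add: nabla_def SD.D_add algebra_simps)

lemma nabla_const_mult: "nabla fs i (s_const a * p) = s_const a * nabla fs i p"
  by (simp add: nabla_def SD.D_mult algebra_simps)

lemma s_deriv_delta_form:
  "i < length fs \<Longrightarrow> s_deriv i (delta_form fs j) = s_const (ratfun_of (mpoly_deriv j (fs ! i)))"
  by (simp add: delta_form_def SD.D_sum SD.D_mult s_deriv_var if_distrib[of "\<lambda>x. x * _"] cong: if_cong)

text \<open>The \<tau>_i-derivative of the connection form is the z_j-derivative of f_i, which is
  also what differentiating the term f_i p contributes.\<close>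

lemma nabla_conn:
  assumes "i < length fs"
  shows "nabla fs i (conn (delta_form fs) j p) = conn (delta_form fs) j (nabla fs i p)"
  using s_deriv_delta_form[OF assms, of j]
  by (simp add: nabla_def conn_def SD.D_add SD.D_mult CD.D_add CD.D_mult s_deriv_coeff_deriv
      ratfun_deriv_of algebra_simps)

lemma weight_s_deriv: "weight V fs k p \<Longrightarrow> weight V fs (k + 1) (s_deriv i p)"
proof (induction rule: weight.induct)
  case (tau l)
  then show ?case by (simp add: s_deriv_var weight_1 weight.zero)
next
  case (mult k p l q)
  have "weight V fs ((k + 1) + l) (s_deriv i p * q)" "weight V fs (k + (l + 1)) (p * s_deriv i q)"
    using mult by (auto intro: weight.mult)
  then show ?case
    by (simp add: SD.D_mult) (metis add.assoc add.commute weight.add)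
qed (simp_all add: SD.D_add weight.zero weight.add)

lemma weight_nabla: "weight V fs k p \<Longrightarrow> i < length fs \<Longrightarrow> weight V fs (k + 1) (nabla fs i p)"
  unfolding nabla_def using weight.mult[OF weight.gen, of i fs V k p] weight_s_deriv[of V fs k p i]
  by (simp add: weight.add add.commute[of 1 k])

lemma delta_module_s_var:
  assumes "i < length fs" "x \<in> delta_module V fs (k + 1)"
  shows "s_var i * x \<in> delta_module V fs k"
  using assms(2)
proof (rule dmod_map)
  show "s_var i * g \<in> delta_module V fs k" if "g \<in> {p. weight V fs (k + 1) p}" for g
    using weight.mult[OF weight.tau[OF assms(1)], of V "k + 1" g] that by (intro dmod.gen) simp
qed (simp_all add: conn_mult distrib_left mult.left_commute)

section \<open>Independence of the generators\<close>

text \<open>\<open>a\<close> defines the substitution and matches the exponentials; \<open>b\<close>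
  gives every old generator weight 1 with respect to the new ones
  (\<open>weight_\<rho>\<close>).\<close>

locale generator_change =
  fixes V :: "nat set" and fs fs' :: "mpoly list" and a b :: "nat \<Rightarrow> nat \<Rightarrow> mpoly"
  assumes a: "k < length fs' \<Longrightarrow> fs' ! k = (\<Sum>i<length fs. a k i * fs ! i)"
    and a_vars: "k < length fs' \<Longrightarrow> i < length fs \<Longrightarrow> mpoly_vars (a k i) \<subseteq> V"
    and b: "i < length fs \<Longrightarrow> fs ! i = (\<Sum>k<length fs'. b i k * fs' ! k)"
    and b_vars: "k < length fs' \<Longrightarrow> i < length fs \<Longrightarrow> mpoly_vars (b i k) \<subseteq> V"
begin

text \<open>The value 0 beyond the list lets \<open>coeff_deriv_\<rho>\<close> and
  \<open>sum_s_deriv_\<rho>\<close> hold on all of \<open>smod\<close> with sums over the list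
  only.\<close>

definition pull :: "nat \<Rightarrow> smod" where
  "pull i = (if i < length fs then \<Sum>k<length fs'. s_const (ratfun_of (a k i)) * s_var k else 0)"

definition \<rho> :: "smod \<Rightarrow> smod" where
  "\<rho> = lin_ext s_const (monomial_at pull)"

sublocale rho: coeff_hom \<rho>
  unfolding \<rho>_def by (rule s_const.coeff_hom_poly_hom)

lemma \<rho>_const [simp]: "\<rho> (s_const c) = s_const c"
  unfolding \<rho>_def using s_const.poly_hom_const[of pull c] by (simp flip: s_const_def)

lemma \<rho>_var [simp]: "\<rho> (s_var i) = pull i"
  unfolding \<rho>_def s_var_def by (rule s_const.poly_hom_var)

text \<open>The chain rule: the coefficients of the substitution depend on z.\<close>

lemma coeff_deriv_\<rho>:
  "coeff_deriv j (\<rho> p) = \<rho> (coeff_deriv j p) + (\<Sum>i<length fs. coeff_deriv j (pull i) * \<rho> (s_deriv i p))"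
proof (induction p rule: smod_induct)
  case (var l)
  show ?case
    by (auto simp: s_deriv_var pull_def if_distrib[of \<rho>] if_distrib[of "\<lambda>x. _ * x"] cong: if_cong)
next
  case (add p q)
  then show ?case
    by (simp add: rho.hom_add CD.D_add SD.D_add distrib_left sum.distrib)
next
  case (mult p q)
  then show ?case
    by (simp add: rho.hom_mult rho.hom_add CD.D_mult SD.D_mult distrib_left sum.distrib
        sum_distrib_left sum_distrib_right algebra_simps)
qed simp

text \<open>A homogeneous linear substitution carries one Euler vector field to the other.\<close>

lemma sum_s_deriv_\<rho>:
  "(\<Sum>k<length fs'. s_var k * s_deriv k (\<rho> p)) = \<rho> (\<Sum>i<length fs. s_var i * s_deriv i p)"
proof (induction p rule: smod_induct)
  case (var l)
  have "(\<Sum>k<length fs'. s_var k * s_deriv k (pull l)) = pull l"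
    by (auto simp: pull_def SD.D_sum SD.D_mult s_deriv_var if_distrib[of "\<lambda>x. _ * x"] mult.commute
        cong: if_cong)
  then show ?case
    by (simp add: s_deriv_var if_distrib[of "\<lambda>x. _ * x"] cong: if_cong) (simp add: pull_def)
next
  case (add p q)
  then show ?case
    by (simp add: rho.hom_add SD.D_add distrib_left sum.distrib)
next
  case (mult p q)
  have "(\<Sum>k<length fs'. s_var k * s_deriv k (\<rho> (p * q)))
      = (\<Sum>k<length fs'. s_var k * s_deriv k (\<rho> p)) * \<rho> q + \<rho> p * (\<Sum>k<length fs'. s_var k * s_deriv k (\<rho> q))"
    by (simp add: rho.hom_mult SD.D_mult distrib_left sum.distrib sum_distrib_left sum_distrib_right
        algebra_simps)
  also have "\<dots> = \<rho> ((\<Sum>i<length fs. s_var i * s_deriv i p) * q + p * (\<Sum>i<length fs. s_var i * s_deriv i q))"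
    by (simp only: mult rho.hom_mult rho.hom_add)
  also have "(\<Sum>i<length fs. s_var i * s_deriv i p) * q + p * (\<Sum>i<length fs. s_var i * s_deriv i q)
      = (\<Sum>i<length fs. s_var i * s_deriv i (p * q))"
    by (simp add: SD.D_mult distrib_left sum.distrib sum_distrib_left sum_distrib_right algebra_simps)
  finally show ?case .
qed simp

text \<open>Equality of the exponents, hence of the two delta functions after substitution.\<close>

lemma sum_pull:
  "(\<Sum>i<length fs. s_const (ratfun_of (fs ! i)) * pull i)
    = (\<Sum>k<length fs'. s_const (ratfun_of (fs' ! k)) * s_var k)"
proof -
  have "(\<Sum>i<length fs. s_const (ratfun_of (fs ! i)) * pull i)
      = (\<Sum>i<length fs. \<Sum>k<length fs'. s_const (ratfun_of (a k i * fs ! i)) * s_var k)"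
    by (simp add: pull_def sum_distrib_left ratfun_of.hom_mult s_const.hom_mult mult_ac)
  also have "\<dots> = (\<Sum>k<length fs'. \<Sum>i<length fs. s_const (ratfun_of (a k i * fs ! i)) * s_var k)"
    by (rule sum.swap)
  also have "\<dots> = (\<Sum>k<length fs'. s_const (ratfun_of (fs' ! k)) * s_var k)"
    by (intro sum.cong) (simp_all add: a ratfun_of.hom_sum s_const.hom_sum sum_distrib_right)
  finally show ?thesis .
qed

lemma euler_\<rho>: "euler fs' (\<rho> p) = \<rho> (euler fs p)"
proof -
  have "euler fs' (\<rho> p) = (\<Sum>k<length fs'. s_var k * s_deriv k (\<rho> p))
      + (\<Sum>k<length fs'. s_const (ratfun_of (fs' ! k)) * s_var k) * \<rho> p"
    by (simp add: euler_def nabla_def distrib_left sum.distrib sum_distrib_left mult_ac)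
  also have "\<dots> = \<rho> ((\<Sum>i<length fs. s_var i * s_deriv i p)
      + (\<Sum>i<length fs. s_const (ratfun_of (fs ! i)) * s_var i) * p)"
    by (simp add: sum_s_deriv_\<rho> rho.hom_add rho.hom_mult rho.hom_sum flip: sum_pull)
  also have "(\<Sum>i<length fs. s_var i * s_deriv i p)
      + (\<Sum>i<length fs. s_const (ratfun_of (fs ! i)) * s_var i) * p = euler fs p"
    by (simp add: euler_def nabla_def distrib_left sum.distrib sum_distrib_left mult_ac)
  finally show ?thesis .
qed

text \<open>The correction has two sources: the chain rule contributes the summand
  \<open>s_deriv i p\<close> of \<open>nabla fs i p\<close>, and the derivatives of the substitution
  coefficients inside the exponent contribute f_i p.\<close>

lemma conn_\<rho>:
  "conn (delta_form fs') j (\<rho> p)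
    = \<rho> (conn (delta_form fs) j p) + (\<Sum>i<length fs. coeff_deriv j (pull i) * \<rho> (nabla fs i p))"
proof -
  have "delta_form fs' j = coeff_deriv j (\<Sum>k<length fs'. s_const (ratfun_of (fs' ! k)) * s_var k)"
    by (simp add: delta_form_def CD.D_sum CD.D_mult ratfun_deriv_of mult.commute)
  also have "\<dots> = (\<Sum>i<length fs. s_const (ratfun_of (mpoly_deriv j (fs ! i))) * pull i)
      + (\<Sum>i<length fs. s_const (ratfun_of (fs ! i)) * coeff_deriv j (pull i))"
    by (simp add: CD.D_sum CD.D_mult ratfun_deriv_of sum.distrib flip: sum_pull)
  also have "(\<Sum>i<length fs. s_const (ratfun_of (mpoly_deriv j (fs ! i))) * pull i) = \<rho> (delta_form fs j)"
    by (simp add: delta_form_def rho.hom_sum rho.hom_mult mult.commute)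
  finally have form: "delta_form fs' j = \<rho> (delta_form fs j)
      + (\<Sum>i<length fs. s_const (ratfun_of (fs ! i)) * coeff_deriv j (pull i))" .
  have "(\<Sum>i<length fs. coeff_deriv j (pull i) * \<rho> (nabla fs i p))
      = (\<Sum>i<length fs. coeff_deriv j (pull i) * \<rho> (s_deriv i p))
        + \<rho> p * (\<Sum>i<length fs. s_const (ratfun_of (fs ! i)) * coeff_deriv j (pull i))"
    by (simp add: nabla_def rho.hom_add rho.hom_mult distrib_left sum.distrib sum_distrib_left mult_ac)
  then show ?thesis
    by (simp add: conn_def form coeff_deriv_\<rho> rho.hom_add rho.hom_mult algebra_simps)
qed

lemma weight_\<rho>: "weight V fs k p \<Longrightarrow> weight V fs' k (\<rho> p)"
proof (induction rule: weight.induct)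
  case (gen i)
  have "weight V fs' (0 + 1) (\<Sum>k<length fs'. s_const (ratfun_of (b i k)) * s_const (ratfun_of (fs' ! k)))"
    using gen b_vars by (intro weight_sum weight.mult weight.const weight.gen) auto
  then show ?case
    unfolding \<rho>_const b[OF gen]
    by (simp add: ratfun_of.hom_sum ratfun_of.hom_mult s_const.hom_sum s_const.hom_mult)
next
  case (tau i)
  then have "weight V fs' (0 + - 1) (pull i)"
    unfolding pull_def using a_vars
    by (simp only: if_True, intro weight_sum weight.mult weight.const weight.tau) auto
  then show ?case by simp
qed (auto simp: rho.hom_add rho.hom_mult intro: weight.intros)

text \<open>The substitution does not commute with the connections, and the correction term raises the
  weight by applying \<open>t\<^sub>i\<close>. Carrying along arbitrary iterates of the \<open>t\<^sub>i\<close> makes the induction work.\<close>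

lemma delta_module_\<rho>_iterate:
  assumes "p \<in> delta_module V fs k" "set is \<subseteq> {..<length fs}"
  shows "\<rho> (foldr (nabla fs) is p) \<in> delta_module V fs' (k + int (length is))"
proof -
  have add: "foldr (nabla fs) is (x + y) = foldr (nabla fs) is x + foldr (nabla fs) is y" for "is" x y
    by (induction "is") (simp_all add: nabla_add)
  have zero: "foldr (nabla fs) is 0 = 0" for "is"
    by (induction "is") simp_all
  have const_mult: "foldr (nabla fs) is (s_const c * x) = s_const c * foldr (nabla fs) is x" for "is" c x
    by (induction "is") (simp_all add: nabla_const_mult)
  have conn_iterate: "foldr (nabla fs) is (conn (delta_form fs) j x)
      = conn (delta_form fs) j (foldr (nabla fs) is x)" if "set is \<subseteq> {..<length fs}" for "is" j x
    using that by (induction "is") (simp_all add: nabla_conn)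
  show ?thesis
    using assms
  proof (induction arbitrary: "is")
    case (gen p)
    have "weight V fs (k + int (length is)) (foldr (nabla fs) is p)"
      using gen.prems
    proof (induction "is")
      case (Cons i "is")
      then show ?case
        using weight_nabla[of V fs "k + int (length is)" "foldr (nabla fs) is p" i]
        by (simp add: algebra_simps)
    qed (use gen.hyps in simp)
    then show ?case by (intro dmod.gen) (simp add: weight_\<rho>)
  next
    case (scalar x c)
    then show ?case using dmod.scalar
      by (simp add: s_scalar_def const_mult rho.hom_mult)
  next
    case (var x j)
    then show ?case by (simp add: const_mult rho.hom_mult dmod.var)
  next
    case (conn x j)
    let ?y = "foldr (nabla fs) is x"
    have "\<rho> (conn (delta_form fs) j ?y) = conn (delta_form fs') j (\<rho> ?y)
        - (\<Sum>i<length fs. coeff_deriv j (pull i) * \<rho> (nabla fs i ?y))"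
      by (simp add: conn_\<rho>)
    moreover have "conn (delta_form fs') j (\<rho> ?y) \<in> delta_module V fs' (k + int (length is))"
      using conn by (intro dmod.conn) auto
    moreover have "coeff_deriv j (pull i) * \<rho> (nabla fs i ?y) \<in> delta_module V fs' (k + int (length is))"
      if i: "i < length fs" for i
    proof -
      \<comment> \<open>Prepending i gains weight 1, exactly what the factor \<tau>'_l in the
        derivative of \<open>pull i\<close> costs below.\<close>
      have *: "\<rho> (nabla fs i ?y) \<in> delta_module V fs' (k + int (length is) + 1)"
        using conn.IH[of "i # is"] conn.prems i by (simp add: algebra_simps)
      have "coeff_deriv j (pull i) * \<rho> (nabla fs i ?y)
          = (\<Sum>l<length fs'. s_const (ratfun_of (mpoly_deriv j (a l i))) * (s_var l * \<rho> (nabla fs i ?y)))"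
        using i by (simp add: pull_def CD.D_sum CD.D_mult ratfun_deriv_of sum_distrib_right mult.assoc)
      also have "\<dots> \<in> delta_module V fs' (k + int (length is))"
        using a_vars i *
        by (intro dmod_sum dmod_poly_mult delta_module_s_var mpoly_vars_deriv) auto
      finally show ?thesis .
    qed
    ultimately show ?case
      by (simp add: conn_iterate[OF conn.prems]) (intro dmod_diff dmod_sum, auto)
  qed (simp_all add: add zero rho.hom_add dmod.add dmod.zero)
qed

lemma delta_module_\<rho>: "p \<in> delta_module V fs k \<Longrightarrow> \<rho> p \<in> delta_module V fs' k"
  using delta_module_\<rho>_iterate[of p k "[]"] by simp

end

section \<open>The Mellin transform\<close>

text \<open>The value 1 outside the list is a convention that makes all indices alike.\<close>

definition gen_at :: "mpoly list \<Rightarrow> nat \<Rightarrow> ratfun" where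
  "gen_at fs i = (if i < length fs then ratfun_of (fs ! i) else 1)"

text \<open>Comes from reading \<tau>_i as \<open>s_i t_i^{-1}\<close>, where
  \<open>t_i^{-1}\<close> lowers s_i by 1: iteration yields the falling factorial together with
  \<open>f_i^{-m_i}\<close>.\<close>

definition mellin_monomial :: "mpoly list \<Rightarrow> (nat \<Rightarrow>\<^sub>0 nat) \<Rightarrow> smod" where
  "mellin_monomial fs m = (\<Prod>i\<in>Poly_Mapping.keys m.
     falling i (Poly_Mapping.lookup m i) * s_const (1 / gen_at fs i ^ Poly_Mapping.lookup m i))"

definition mellin :: "mpoly list \<Rightarrow> smod \<Rightarrow> smod" where
  "mellin fs = lin_ext s_const (mellin_monomial fs)"

lemma mellin_monomial_superset:
  assumes "finite A" "Poly_Mapping.keys m \<subseteq> A"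
  shows "mellin_monomial fs m = (\<Prod>i\<in>A.
     falling i (Poly_Mapping.lookup m i) * s_const (1 / gen_at fs i ^ Poly_Mapping.lookup m i))"
  unfolding mellin_monomial_def
  by (rule prod.mono_neutral_left) (use assms in \<open>auto simp: in_keys_iff\<close>)

lemma mellin_monomial_0 [simp]: "mellin_monomial fs 0 = 1"
  by (simp add: mellin_monomial_def)

lemma mellin_monomial_Suc:
  "mellin_monomial fs (m + Poly_Mapping.single i 1)
    = (s_var i - of_nat (Poly_Mapping.lookup m i)) * s_const (1 / gen_at fs i) * mellin_monomial fs m"
proof -
  let ?A = "insert i (Poly_Mapping.keys m)" and ?m = "m + Poly_Mapping.single i (1::nat)"
  let ?t = "\<lambda>m l. falling l (Poly_Mapping.lookup m l) * s_const (1 / gen_at fs l ^ Poly_Mapping.lookup m l)"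
  have keys: "Poly_Mapping.keys ?m \<subseteq> ?A"
    using keys_add[of m "Poly_Mapping.single i 1"] by auto
  have "prod (?t ?m) (?A - {i}) = prod (?t m) (?A - {i})"
    by (rule prod.cong) (auto simp: lookup_add lookup_single)
  moreover have "?t ?m i = (s_var i - of_nat (Poly_Mapping.lookup m i)) * s_const (1 / gen_at fs i) * ?t m i"
    by (simp add: lookup_add falling_Suc divide_inverse s_const.hom_mult mult_ac)
  moreover have "mellin_monomial fs ?m = ?t ?m i * prod (?t ?m) (?A - {i})"
    unfolding mellin_monomial_superset[OF finite.insertI[OF finite_keys] keys]
    by (rule prod.remove) auto
  moreover have "mellin_monomial fs m = ?t m i * prod (?t m) (?A - {i})"
    unfolding mellin_monomial_superset[of ?A m, OF finite.insertI[OF finite_keys] subset_insertI]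
    by (rule prod.remove) auto
  ultimately show ?thesis
    by (simp only: mult.assoc)
qed

lemma mellin_0 [simp]: "mellin fs 0 = 0"
  by (simp add: mellin_def)

lemma mellin_add: "mellin fs (p + q) = mellin fs p + mellin fs q"
  by (simp add: mellin_def s_const.lin_ext_add)

lemma mellin_sum: "mellin fs (sum h A) = (\<Sum>x\<in>A. mellin fs (h x))"
  by (simp add: mellin_def s_const.lin_ext_sum)

lemma mellin_single: "mellin fs (Poly_Mapping.single m c) = s_const c * mellin_monomial fs m"
  by (simp add: mellin_def s_const.lin_ext_single)

lemma s_const_mult_single: "s_const c * Poly_Mapping.single m d = Poly_Mapping.single m (c * d)"
  by (simp add: s_const_def mult_single)

lemma mellin_const_mult: "mellin fs (s_const c * p) = s_const c * mellin fs p"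
  by (induction p rule: poly_mapping_add_induct)
    (simp_all add: s_const_mult_single mellin_single mellin_add s_const.hom_mult algebra_simps)

lemma mellin_1 [simp]: "mellin fs 1 = 1"
  using mellin_single[of fs 0 1] by simp

lemma coeff_deriv_mellin_monomial:
  assumes "0 \<notin> set fs"
  shows "coeff_deriv j (mellin_monomial fs m) = - (\<Sum>i<length fs. s_const (of_nat (Poly_Mapping.lookup m i)
     * ratfun_of (mpoly_deriv j (fs ! i)) / ratfun_of (fs ! i))) * mellin_monomial fs m"
proof (induction m rule: exponent_induct)
  case (add m l)
  let ?d = "\<lambda>i. ratfun_of (mpoly_deriv j (fs ! i)) / ratfun_of (fs ! i)"
  have "(\<Sum>i<length fs. s_const (of_nat (Poly_Mapping.lookup (m + Poly_Mapping.single l 1) i)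
      * ratfun_of (mpoly_deriv j (fs ! i)) / ratfun_of (fs ! i)))
    = (\<Sum>i<length fs. s_const (of_nat (Poly_Mapping.lookup m i)
      * ratfun_of (mpoly_deriv j (fs ! i)) / ratfun_of (fs ! i)) + (if i = l then s_const (?d i) else 0))"
    by (intro sum.cong)
      (auto simp: lookup_add lookup_single when_def add_divide_distrib distrib_right simp flip: s_const.hom_add)
  also have "\<dots> = (\<Sum>i<length fs. s_const (of_nat (Poly_Mapping.lookup m i)
      * ratfun_of (mpoly_deriv j (fs ! i)) / ratfun_of (fs ! i)))
      + (if l < length fs then s_const (?d l) else 0)"
    by (simp add: sum.distrib)
  finally have sum: "(\<Sum>i<length fs. s_const (of_nat (Poly_Mapping.lookup (m + Poly_Mapping.single l 1) i)
      * ratfun_of (mpoly_deriv j (fs ! i)) / ratfun_of (fs ! i))) = \<dots>" .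
  have "ratfun_deriv j (1 / gen_at fs l) = - (if l < length fs then ?d l else 0) * (1 / gen_at fs l)"
  proof (cases "l < length fs")
    case True
    then have "ratfun_of (fs ! l) \<noteq> 0" using assms by (metis nth_mem ratfun_of_eq_0_iff)
    then show ?thesis
      using True by (simp add: gen_at_def ratfun_deriv_divide ratfun_deriv_of power2_eq_square)
  qed (simp add: gen_at_def)
  then have "coeff_deriv j (s_const (1 / gen_at fs l))
      = - (if l < length fs then s_const (?d l) else 0) * s_const (1 / gen_at fs l)"
    by (simp only: coeff_deriv_const s_const.hom_mult s_const.hom_uminus if_distrib[of s_const] s_const.hom_0)
  then show ?case
    unfolding mellin_monomial_Suc sum
    by (simp only: CD.D_mult CD.D_diff coeff_deriv_var CD.D_of_nat add)
      (simp add: algebra_simps)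
qed simp

text \<open>A further \<tau>_i multiplies the transform of \<tau>^m by
  \<open>(s_i - m_i) / f_i\<close>; the number m_i is the eigenvalue of \<tau>_i
  \<partial>/\<partial>\<tau>_i.\<close>

lemma mellin_s_var:
  assumes "0 \<notin> set fs" "i < length fs"
  shows "mellin fs (s_var i * p) = s_const (1 / ratfun_of (fs ! i)) * (s_var i * mellin fs p - mellin fs (s_var i * s_deriv i p))"
proof (induction p rule: poly_mapping_add_induct)
  case (single m c)
  have "s_var i * s_deriv i (Poly_Mapping.single m c) = of_nat (Poly_Mapping.lookup m i) * Poly_Mapping.single m c"
  proof (cases "Poly_Mapping.lookup m i = 0")
    case False
    then have "Poly_Mapping.single i 1 + (m - Poly_Mapping.single i 1) = m"
      by (intro poly_mapping_eqI) (auto simp: lookup_add lookup_minus lookup_single when_def)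
    then show ?thesis
      using s_const_mult_single[of "of_nat (Poly_Mapping.lookup m i)" m c]
      by (simp add: s_deriv_single s_var_def mult_single s_const.hom_of_nat)
  qed (simp add: s_deriv_single)
  then have "mellin fs (s_var i * s_deriv i (Poly_Mapping.single m c))
      = s_const (of_nat (Poly_Mapping.lookup m i)) * mellin fs (Poly_Mapping.single m c)"
    by (simp only: mellin_const_mult flip: s_const.hom_of_nat)
  moreover have "mellin fs (s_var i * Poly_Mapping.single m c)
      = s_const c * mellin_monomial fs (m + Poly_Mapping.single i 1)"
    by (simp add: s_var_def mult_single mellin_single add.commute)
  ultimately show ?case
    using assms(2) unfolding mellin_monomial_Suc
    by (simp add: mellin_single gen_at_def s_const.hom_of_nat algebra_simps)
qed (simp_all add: SD.D_add mellin_add distrib_left right_diff_distrib)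

text \<open>The correction term of \<open>mellin_s_var\<close> cancels the derivative contained in
  \<open>nabla\<close>.\<close>

lemma mellin_nabla:
  assumes "0 \<notin> set fs" "i < length fs"
  shows "mellin fs (s_var i * nabla fs i p) = s_var i * mellin fs p"
proof -
  have "ratfun_of (fs ! i) \<noteq> 0" using assms by (metis nth_mem ratfun_of_eq_0_iff)
  then have 1: "s_const (ratfun_of (fs ! i)) * s_const (1 / ratfun_of (fs ! i)) = 1"
    by (simp flip: s_const.hom_mult)
  have "mellin fs (s_var i * nabla fs i p)
      = mellin fs (s_var i * s_deriv i p) + s_const (ratfun_of (fs ! i)) * mellin fs (s_var i * p)"
    by (simp add: nabla_def distrib_left mellin_add mult.left_commute[of "s_var i"] mellin_const_mult)
  also have "\<dots> = s_var i * mellin fs p"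
    by (simp only: mellin_s_var[OF assms, of p] mult.assoc[symmetric] 1) simp
  finally show ?thesis .
qed

lemma mellin_euler:
  assumes "0 \<notin> set fs"
  shows "mellin fs (euler fs p) = (\<Sum>i<length fs. s_var i) * mellin fs p"
  by (simp add: euler_def mellin_sum mellin_nabla[OF assms] sum_distrib_right)

text \<open>On \<tau>^m the i-th term of the delta form becomes (s_i - m_i) times the logarithmic
  derivative of f_i. The part with s_i belongs to \<open>log_form\<close>, the part with -m_i is the
  derivative of \<open>f_i^{-m_i}\<close>.\<close>

lemma mellin_conn:
  assumes "0 \<notin> set fs"
  shows "mellin fs (conn (delta_form fs) j p) = conn (log_form fs) j (mellin fs p)"
proof (induction p rule: poly_mapping_add_induct)
  case (single m c)
  let ?d = "\<lambda>i. ratfun_of (mpoly_deriv j (fs ! i))" and ?f = "\<lambda>i. ratfun_of (fs ! i)"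
  let ?n = "Poly_Mapping.lookup m"
  have "mellin fs (Poly_Mapping.single m c * (s_var i * s_const (?d i)))
      = s_const c * ((s_var i - of_nat (?n i)) * s_const (?d i / ?f i)) * mellin_monomial fs m"
    if "i < length fs" for i
  proof -
    have "Poly_Mapping.single m c * (s_var i * s_const (?d i))
        = Poly_Mapping.single (m + Poly_Mapping.single i 1) (c * ?d i)"
      by (simp add: s_var_def s_const_def mult_single add_ac)
    then have "mellin fs (Poly_Mapping.single m c * (s_var i * s_const (?d i)))
        = s_const (c * ?d i) * ((s_var i - of_nat (?n i)) * s_const (1 / ?f i) * mellin_monomial fs m)"
      using that by (simp only: mellin_single mellin_monomial_Suc gen_at_def if_True)
    also have "s_const (?d i / ?f i) = s_const (?d i) * s_const (1 / ?f i)"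
      by (simp flip: s_const.hom_mult)
    ultimately show ?thesis by (simp add: s_const.hom_mult mult_ac)
  qed
  then have "mellin fs (conn (delta_form fs) j (Poly_Mapping.single m c))
      = s_const (ratfun_deriv j c) * mellin_monomial fs m
        + (\<Sum>i<length fs. s_const c * ((s_var i - of_nat (?n i)) * s_const (?d i / ?f i)) * mellin_monomial fs m)"
    by (simp add: conn_def delta_form_def mellin_add mellin_single sum_distrib_left mellin_sum)
  also have "(\<Sum>i<length fs. s_const c * ((s_var i - of_nat (?n i)) * s_const (?d i / ?f i)) * mellin_monomial fs m)
      = s_const c * mellin_monomial fs m * log_form fs j
        - s_const c * (\<Sum>i<length fs. s_const (of_nat (?n i) * ?d i / ?f i)) * mellin_monomial fs m"
  proof -
    have "s_const (of_nat (?n i) * ?d i / ?f i) = of_nat (?n i) * s_const (?d i / ?f i)" for i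
      by (simp only: s_const.hom_mult s_const.hom_of_nat flip: times_divide_eq_right)
    then show ?thesis
      unfolding log_form_def sum_distrib_left sum_distrib_right sum_subtractf[symmetric]
      by (intro sum.cong refl) (simp add: left_diff_distrib right_diff_distrib mult_ac)
  qed
  also have "s_const (ratfun_deriv j c) * mellin_monomial fs m + \<dots>
      = conn (log_form fs) j (mellin fs (Poly_Mapping.single m c))"
  proof -
    have "x * M + (y * M * L - y * S * M) = x * M + y * (- S * M) + y * M * L" for x y L M S :: smod
      by (simp add: algebra_simps)
    then show ?thesis
      by (simp only: conn_def mellin_single CD.D_mult coeff_deriv_const coeff_deriv_mellin_monomial[OF assms])
  qed
  finally show ?case .
qed (simp_all add: conn_add mellin_add)

lemma ratfun_of_nat_eq_iff: "(of_nat a :: ratfun) = of_nat b \<longleftrightarrow> a = b"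
proof
  assume "(of_nat a :: ratfun) = of_nat b"
  then have "ratfun_of (of_nat a - of_nat b) = 0"
    by (simp add: ratfun_of.hom_diff ratfun_of.hom_of_nat)
  then show "a = b" by simp
qed simp

text \<open>Evaluation at the point \<open>s\<^sub>i = m\<^sub>i\<close> kills the transforms of all monomials that do not
  divide the one with exponent \<open>m\<close>; so \<open>m\<close> is chosen of minimal degree.\<close>

lemma mellin_eq_0:
  assumes "0 \<notin> set fs" "mellin fs p = 0"
  shows "p = 0"
proof (rule ccontr)
  assume "p \<noteq> 0"
  then have ne: "Poly_Mapping.keys p \<noteq> {}" by simp
  define deg :: "(nat \<Rightarrow>\<^sub>0 nat) \<Rightarrow> nat" where "deg m = (\<Sum>i\<in>Poly_Mapping.keys m. Poly_Mapping.lookup m i)" for m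
  obtain m where m: "m \<in> Poly_Mapping.keys p" and min: "\<And>n. n \<in> Poly_Mapping.keys p \<Longrightarrow> deg m \<le> deg n"
    using ne ex_has_least_nat[of "\<lambda>m. m \<in> Poly_Mapping.keys p" _ deg] by blast
  define pt :: "nat \<Rightarrow> ratfun" where "pt i = of_nat (Poly_Mapping.lookup m i)" for i
  have id: "coeff_hom (\<lambda>x :: ratfun. x)" by unfold_locales simp_all
  define ev where "ev = lin_ext (\<lambda>x :: ratfun. x) (monomial_at pt)"
  interpret ev: coeff_hom ev unfolding ev_def by (rule coeff_hom.coeff_hom_poly_hom[OF id])
  have ev_const: "ev (s_const c) = c" for c
    by (simp add: ev_def s_const_def coeff_hom.poly_hom_const[OF id])
  have ev_var: "ev (s_var i) = pt i" for i
    unfolding ev_def s_var_def by (rule coeff_hom.poly_hom_var[OF id])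
  have ev_falling: "ev (falling i n) = (\<Prod>l<n. of_nat (Poly_Mapping.lookup m i) - of_nat l)" for i n
    by (simp add: falling_def ev.hom_prod ev.hom_diff ev_var ev.hom_of_nat pt_def)
  have gen_at: "gen_at fs i \<noteq> 0" for i
    using assms(1) by (metis gen_at_def nth_mem ratfun_of_eq_0_iff one_neq_zero)
  have ev_m: "ev (mellin_monomial fs m) \<noteq> 0"
  proof -
    have "ev (falling i (Poly_Mapping.lookup m i)) \<noteq> 0" for i
      unfolding ev_falling by (simp add: ratfun_of_nat_eq_iff)
    then show ?thesis
      by (simp add: mellin_monomial_def ev.hom_prod ev.hom_mult ev_const gen_at)
  qed
  have ev_n: "ev (mellin_monomial fs n) = 0" if n: "n \<in> Poly_Mapping.keys p" "n \<noteq> m" for n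
  proof -
    have "\<exists>i. Poly_Mapping.lookup m i < Poly_Mapping.lookup n i"
    proof (rule ccontr)
      assume "\<not> ?thesis"
      then have le: "Poly_Mapping.lookup n i \<le> Poly_Mapping.lookup m i" for i
        by (simp add: not_less)
      then have "Poly_Mapping.keys n \<subseteq> Poly_Mapping.keys m"
        by (metis (full_types) in_keys_iff le_zero_eq subsetI)
      then have deg_n: "deg n = (\<Sum>i\<in>Poly_Mapping.keys m. Poly_Mapping.lookup n i)"
        unfolding deg_def by (intro sum.mono_neutral_left) (auto simp: in_keys_iff)
      obtain i where i: "Poly_Mapping.lookup n i \<noteq> Poly_Mapping.lookup m i"
        using n(2) by (meson poly_mapping_eqI)
      then have "i \<in> Poly_Mapping.keys m"
        using le[of i] by (auto simp: in_keys_iff)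
      then have "deg n < deg m"
        unfolding deg_n deg_def[of m] using le i
        by (intro sum_strict_mono_ex1) (auto simp: le_neq_implies_less intro!: bexI[of _ i])
      then show False using min[OF n(1)] by simp
    qed
    then obtain i where i: "Poly_Mapping.lookup m i < Poly_Mapping.lookup n i" by blast
    then have "ev (falling i (Poly_Mapping.lookup n i)) = 0"
      unfolding ev_falling by (intro prod_zero) auto
    moreover have "i \<in> Poly_Mapping.keys n" using i by (simp add: in_keys_iff)
    ultimately show ?thesis
      unfolding mellin_monomial_def ev.hom_prod by (intro prod_zero bexI[of _ i]) (auto simp: ev.hom_mult)
  qed
  have "0 = ev (mellin fs p)" using assms(2) by simp
  also have "\<dots> = (\<Sum>n\<in>Poly_Mapping.keys p. Poly_Mapping.lookup p n * ev (mellin_monomial fs n))"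
    by (simp add: mellin_def lin_ext_def ev.hom_sum ev.hom_mult ev_const)
  also have "\<dots> = (\<Sum>n\<in>Poly_Mapping.keys p. if n = m then Poly_Mapping.lookup p m * ev (mellin_monomial fs m) else 0)"
    by (intro sum.cong) (auto simp: ev_n)
  also have "\<dots> = Poly_Mapping.lookup p m * ev (mellin_monomial fs m)"
    using m by simp
  finally show False using m ev_m by (simp add: in_keys_iff)
qed

definition delta_elem :: "mpoly list \<Rightarrow> (nat \<Rightarrow> nat) \<Rightarrow> (nat \<Rightarrow> nat) \<Rightarrow> smod" where
  "delta_elem fs \<nu> \<mu> = (\<Prod>i<length fs. s_var i ^ \<nu> i * s_const (ratfun_of (fs ! i) ^ \<mu> i))"

lemma delta_elem_add:
  "delta_elem fs \<nu> \<mu> * delta_elem fs \<nu>' \<mu>' = delta_elem fs (\<lambda>i. \<nu> i + \<nu>' i) (\<lambda>i. \<mu> i + \<mu>' i)"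
  by (simp add: delta_elem_def power_add s_const.hom_mult mult_ac flip: prod.distrib)

lemma mellin_delta_elem: "mellin fs (delta_elem fs \<nu> \<mu>) = shift_elem fs \<nu> \<mu>"
proof -
  let ?r = "length fs"
  define m where "m = (\<Sum>i<?r. Poly_Mapping.single i (\<nu> i))"
  have lookup: "Poly_Mapping.lookup m i = (if i < ?r then \<nu> i else 0)" for i
    by (simp add: m_def lookup_sum lookup_single when_def)
  have "(\<Prod>i<?r. s_var i ^ \<nu> i) = Poly_Mapping.single m 1"
  proof -
    have "s_var i ^ n = Poly_Mapping.single (Poly_Mapping.single i n) 1" for i n
      by (induction n) (simp_all add: s_var_def mult_single flip: single_add)
    moreover have "(\<Prod>i\<in>A. Poly_Mapping.single (e i) 1) = (Poly_Mapping.single (\<Sum>i\<in>A. e i) 1 :: smod)"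
      for e and A :: "nat set"
      by (induction A rule: infinite_finite_induct) (simp_all add: mult_single)
    ultimately show ?thesis by (simp add: m_def)
  qed
  then have "delta_elem fs \<nu> \<mu> = s_const (\<Prod>i<?r. ratfun_of (fs ! i) ^ \<mu> i) * Poly_Mapping.single m 1"
    by (simp add: delta_elem_def prod.distrib s_const.hom_prod)
  then have "mellin fs (delta_elem fs \<nu> \<mu>) = s_const (\<Prod>i<?r. ratfun_of (fs ! i) ^ \<mu> i) * mellin_monomial fs m"
    by (simp add: mellin_const_mult mellin_single)
  also have "mellin_monomial fs m = (\<Prod>i<?r. falling i (\<nu> i) * s_const (1 / ratfun_of (fs ! i) ^ \<nu> i))"
    by (subst mellin_monomial_superset[of "{..<?r}"])
      (auto simp: in_keys_iff lookup gen_at_def intro!: prod.cong split: if_splits)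
  also have "s_const (\<Prod>i<?r. ratfun_of (fs ! i) ^ \<mu> i) * \<dots> = shift_elem fs \<nu> \<mu>"
    by (simp add: shift_elem_def s_const.hom_prod s_const.hom_mult divide_inverse mult_ac flip: prod.distrib)
  finally show ?thesis .
qed

section \<open>Monomial description of the weights\<close>

inductive_set poly_span :: "nat set \<Rightarrow> smod set \<Rightarrow> smod set" for V G where
  zero: "0 \<in> poly_span V G"
| add: "x \<in> poly_span V G \<Longrightarrow> g \<in> G \<Longrightarrow> mpoly_vars p \<subseteq> V \<Longrightarrow> s_const (ratfun_of p) * g + x \<in> poly_span V G"

lemma poly_span_add:
  "x \<in> poly_span V G \<Longrightarrow> y \<in> poly_span V G \<Longrightarrow> x + y \<in> poly_span V G"
  by (induction rule: poly_span.induct) (auto simp: add.assoc intro: poly_span.add)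

lemma poly_span_gen: "g \<in> G \<Longrightarrow> mpoly_vars p \<subseteq> V \<Longrightarrow> s_const (ratfun_of p) * g \<in> poly_span V G"
  using poly_span.add[OF poly_span.zero] by fastforce

lemma poly_span_mult:
  assumes "x \<in> poly_span V G" "y \<in> poly_span V H" "\<And>g h. g \<in> G \<Longrightarrow> h \<in> H \<Longrightarrow> g * h \<in> K"
  shows "x * y \<in> poly_span V K"
  using assms(1)
proof induction
  case (add x g p)
  have "s_const (ratfun_of p) * g * y \<in> poly_span V K"
    using assms(2)
  proof induction
    case (add y h q)
    have "mpoly_vars (p * q) \<subseteq> V"
      using mpoly_vars_mult[of p q] add \<open>mpoly_vars p \<subseteq> V\<close> by blast
    from poly_span.add[OF add.IH assms(3)[OF \<open>g \<in> G\<close> \<open>h \<in> H\<close>] this] show ?case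
      by (simp add: ratfun_of.hom_mult s_const.hom_mult algebra_simps)
  qed (simp add: poly_span.zero)
  then show ?case using poly_span_add add.IH by (simp add: distrib_right)
qed (simp add: poly_span.zero)

definition delta_elems :: "mpoly list \<Rightarrow> int \<Rightarrow> smod set" where
  "delta_elems fs k = {delta_elem fs \<nu> \<mu> | \<nu> \<mu>. (\<Sum>i<length fs. int (\<mu> i)) = (\<Sum>i<length fs. int (\<nu> i)) + k}"

lemma weight_delta_elem:
  "weight V fs ((\<Sum>i<length fs. int (\<mu> i)) - (\<Sum>i<length fs. int (\<nu> i))) (delta_elem fs \<nu> \<mu>)"
proof -
  have pow: "weight V fs (int n * k) (x ^ n)" if "weight V fs k x" for n k x
  proof (induction n)
    case (Suc n)
    have "k + int n * k = int (Suc n) * k" by (simp add: algebra_simps)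
    then show ?case using weight.mult[OF that Suc] by (simp only: power_Suc)
  qed (simp add: weight_1)
  have "weight V fs (\<Sum>i\<in>A. int (\<mu> i) - int (\<nu> i)) (\<Prod>i\<in>A. s_var i ^ \<nu> i * s_const (ratfun_of (fs ! i) ^ \<mu> i))"
    if "A \<subseteq> {..<length fs}" for A
    using finite_subset[OF that finite_lessThan] that
  proof (induction A)
    case (insert i A)
    have "weight V fs (int (\<nu> i) * (- 1) + int (\<mu> i) * 1) (s_var i ^ \<nu> i * s_const (ratfun_of (fs ! i)) ^ \<mu> i)"
      using insert.prems by (intro weight.mult pow weight.tau weight.gen) auto
    with insert show ?case
      using weight.mult by (fastforce simp: s_const.hom_power)
  qed (simp add: weight_1)
  from this[of "{..<length fs}"] show ?thesis
    by (simp add: delta_elem_def sum_subtractf)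
qed

lemma delta_elem_single:
  assumes "i < length fs"
  shows "delta_elem fs (\<lambda>_. 0) (\<lambda>l. if l = i then 1 else 0) = s_const (ratfun_of (fs ! i))"
    and "delta_elem fs (\<lambda>l. if l = i then 1 else 0) (\<lambda>_. 0) = s_var i"
proof -
  show "delta_elem fs (\<lambda>_. 0) (\<lambda>l. if l = i then 1 else 0) = s_const (ratfun_of (fs ! i))"
    using assms by (simp add: delta_elem_def if_distrib[of "\<lambda>n. _ ^ n"] if_distrib[of s_const] cong: if_cong)
  show "delta_elem fs (\<lambda>l. if l = i then 1 else 0) (\<lambda>_. 0) = s_var i"
    using assms by (simp add: delta_elem_def if_distrib[of "\<lambda>n. _ ^ n"] cong: if_cong)
qed

text \<open>\<open>mellin\<close> is not multiplicative, so it cannot be followed through the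
  product rule of \<open>weight\<close>. In terms of the monomials \<tau>^\<nu> f^\<mu> the weight
  becomes the condition |\<mu>| = |\<nu>| + k, and \<open>mellin\<close> sends these monomials to
  shift elements.\<close>

lemma weight_poly_span: "weight V fs k p \<Longrightarrow> p \<in> poly_span V (delta_elems fs k)"
proof (induction rule: weight.induct)
  case (const p)
  have "(1::smod) \<in> delta_elems fs 0"
    unfolding delta_elems_def by (intro CollectI exI[of _ "\<lambda>_. 0"]) (simp add: delta_elem_def)
  from poly_span_gen[OF this const] show ?case by simp
next
  case (gen i)
  have "s_const (ratfun_of (fs ! i)) \<in> delta_elems fs 1"
    unfolding delta_elems_def using delta_elem_single(1)[OF gen] gen
    by (intro CollectI exI[of _ "\<lambda>_. 0"] exI[of _ "\<lambda>l. if l = i then 1 else 0"])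
      (simp add: if_distrib[of int] cong: if_cong)
  from poly_span_gen[OF this, of 1 V] show ?case by simp
next
  case (tau i)
  have "s_var i \<in> delta_elems fs (- 1)"
    unfolding delta_elems_def using delta_elem_single(2)[OF tau] tau
    by (intro CollectI exI[of _ "\<lambda>_. 0"] exI[of _ "\<lambda>l. if l = i then 1 else 0"])
      (simp add: if_distrib[of int] cong: if_cong)
  from poly_span_gen[OF this, of 1 V] show ?case by simp
next
  case (mult k p l q)
  show ?case
  proof (rule poly_span_mult[OF mult.IH])
    fix g h assume "g \<in> delta_elems fs k" "h \<in> delta_elems fs l"
    then show "g * h \<in> delta_elems fs (k + l)"
      unfolding delta_elems_def by (force simp: delta_elem_add sum.distrib)
  qed
qed (auto intro: poly_span.zero poly_span_add)

text \<open>For the direction from left to right, every element of the target is lifted to the delta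
  module; by injectivity of \<open>mellin\<close>, the lift of \<open>mellin fs p\<close> is
  p.\<close>

lemma mellin_delta_module:
  assumes "0 \<notin> set fs"
  shows "mellin fs p \<in> bs_module V fs \<longleftrightarrow> p \<in> delta_module V fs 1"
proof
  assume "p \<in> delta_module V fs 1"
  then show "mellin fs p \<in> bs_module V fs"
  proof (rule dmod_map)
    fix g assume "g \<in> {p. weight V fs 1 p}"
    then have "g \<in> poly_span V (delta_elems fs 1)" by (simp add: weight_poly_span)
    then show "mellin fs g \<in> bs_module V fs"
    proof induction
      case (add x g p)
      then obtain \<nu> \<mu> where g: "g = delta_elem fs \<nu> \<mu>"
        and "(\<Sum>i<length fs. int (\<mu> i)) = (\<Sum>i<length fs. int (\<nu> i)) + 1"
        by (auto simp: delta_elems_def)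
      then have "(\<Sum>i<length fs. \<mu> i) = Suc (\<Sum>i<length fs. \<nu> i)"
        unfolding of_nat_sum[symmetric] by linarith
      then have "mellin fs g \<in> shift_elems fs"
        by (auto simp: g mellin_delta_elem shift_elems_def)
      with add show ?case
        by (simp add: mellin_add mellin_const_mult dmod.add dmod_poly_mult dmod.gen)
    qed (simp add: dmod.zero)
  qed (simp_all add: mellin_add mellin_const_mult mellin_conn[OF assms])
next
  have "\<exists>q\<in>delta_module V fs 1. mellin fs q = x" if "x \<in> bs_module V fs" for x
    using that
  proof induction
    case (gen h)
    then obtain \<nu> \<mu> where h: "h = shift_elem fs \<nu> \<mu>"
      and "(\<Sum>i<length fs. \<mu> i) = Suc (\<Sum>i<length fs. \<nu> i)"
      by (auto simp: shift_elems_def)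
    then have "weight V fs 1 (delta_elem fs \<nu> \<mu>)"
      using weight_delta_elem[of V fs \<mu> \<nu>] by (simp flip: of_nat_sum)
    then show ?case
      unfolding h using mellin_delta_elem by (blast intro: dmod.gen)
  next
    case (scalar x c)
    then show ?case using mellin_const_mult dmod.scalar unfolding s_scalar_def by blast
  next
    case (var x j)
    then show ?case using mellin_const_mult dmod.var by blast
  next
    case (conn x j)
    then show ?case using mellin_conn[OF assms] dmod.conn by metis
  next
    case zero
    show ?case by (rule bexI[of _ 0]) (simp_all add: dmod.zero)
  next
    case (add x y)
    then show ?case using mellin_add dmod.add by metis
  qed
  moreover assume "mellin fs p \<in> bs_module V fs"
  ultimately obtain q where q: "q \<in> delta_module V fs 1" "mellin fs q = mellin fs p"
    by blast
  then have "mellin fs (q + s_const (- 1) * p) = 0"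
    by (simp only: mellin_add mellin_const_mult) (simp add: s_const.hom_uminus)
  then have "q = p"
    using mellin_eq_0[OF assms, of "q + s_const (- 1) * p"] by (simp add: s_const.hom_uminus)
  with q show "p \<in> delta_module V fs 1" by simp
qed

text \<open>The operator b(\<Sum> \<tau>_i t_i) applied to \<delta>, whose coefficient is 1.\<close>

definition euler_poly :: "mpoly list \<Rightarrow> complex poly \<Rightarrow> smod" where
  "euler_poly fs b = (\<Sum>n\<le>degree b. s_scalar (coeff b n) * (euler fs ^^ n) 1)"

lemma poly_map_poly_s_scalar:
  "poly (map_poly s_scalar b) x = (\<Sum>n\<le>degree b. s_scalar (coeff b n) * x ^ n)"
proof -
  have "degree (map_poly s_scalar b) \<le> degree b" by (simp add: degree_map_poly)
  then have "poly (map_poly s_scalar b) x = (\<Sum>n\<le>degree b. coeff (map_poly s_scalar b) n * x ^ n)"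
    unfolding poly_altdef
    by (intro sum.mono_neutral_left) (auto simp: coeff_eq_0 not_le)
  then show ?thesis by (simp add: coeff_map_poly)
qed

lemma bs_equation_iff_bs_module:
  "0 \<notin> set fs \<Longrightarrow> bs_equation V fs b
    \<longleftrightarrow> poly (map_poly s_scalar b) (\<Sum>i<length fs. s_var i) \<in> bs_module V fs"
  by (simp add: bs_equation_def bs_submodule_eq)

lemma bs_equation_iff_euler_poly:
  assumes "0 \<notin> set fs"
  shows "bs_equation V fs b \<longleftrightarrow> euler_poly fs b \<in> delta_module V fs 1"
proof -
  have "mellin fs ((euler fs ^^ n) 1) = (\<Sum>i<length fs. s_var i) ^ n" for n
    by (induction n) (simp_all add: mellin_euler[OF assms])
  then have "mellin fs (euler_poly fs b) = poly (map_poly s_scalar b) (\<Sum>i<length fs. s_var i)"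
    by (simp add: euler_poly_def poly_map_poly_s_scalar mellin_sum s_scalar_def mellin_const_mult)
  then show ?thesis
    using bs_equation_iff_bs_module[OF assms] mellin_delta_module[OF assms] by metis
qed

lemma (in generator_change) bs_equation_transfer:
  assumes "0 \<notin> set fs" "0 \<notin> set fs'" "bs_equation V fs c"
  shows "bs_equation V fs' c"
proof -
  have "\<rho> ((euler fs ^^ n) 1) = (euler fs' ^^ n) 1" for n
    by (induction n) (simp_all add: euler_\<rho>[symmetric])
  then have "\<rho> (euler_poly fs c) = euler_poly fs' c"
    by (simp add: euler_poly_def rho.hom_sum rho.hom_mult s_scalar_def)
  then show ?thesis
    using assms delta_module_\<rho>[of "euler_poly fs c" 1] by (simp add: bs_equation_iff_euler_poly)
qed

section \<open>Linear disjointness\<close>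

definition s_eval :: "smod \<Rightarrow> complex poly \<Rightarrow> smod" where
  "s_eval t c = poly (map_poly s_scalar c) t"

lemma s_eval_pCons: "s_eval t (pCons x c) = s_scalar x + t * s_eval t c"
  by (simp add: s_eval_def map_poly_pCons)

lemma coeff_hom_s_eval: "coeff_hom (s_eval t)"
proof
  have 0: "s_eval t 0 = 0" by (simp add: s_eval_def)
  show add: "s_eval t (c + d) = s_eval t c + s_eval t d" for c d
  proof (induction c arbitrary: d)
    case (pCons x c)
    show ?case
      by (cases d, simp add: pCons.IH s_eval_pCons s_scalar.hom_add, simp add: algebra_simps)
  qed (simp add: 0)
  have smult: "s_eval t (smult x c) = s_scalar x * s_eval t c" for x c
    by (induction c) (simp_all add: 0 s_eval_pCons s_scalar.hom_mult algebra_simps)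
  show "s_eval t (c * d) = s_eval t c * s_eval t d" for c d
    by (induction c) (simp_all add: 0 add smult s_eval_pCons algebra_simps)
  show "s_eval t 1 = 1"
    by (simp add: s_eval_pCons 0 flip: pCons_one)
qed

interpretation s_eval: coeff_hom "s_eval t" for t
  by (rule coeff_hom_s_eval)

lemma s_eval_const: "s_eval t [:x:] = s_scalar x"
  by (simp add: s_eval_pCons)

lemma s_eval_monom: "s_eval t (monom x n) = s_scalar x * t ^ n"
  by (induction n) (simp_all add: monom_0 monom_Suc s_eval_pCons mult_ac)

lemma s_eval_induct:
  assumes "\<And>x y. P x \<Longrightarrow> P y \<Longrightarrow> P (x + y)" "\<And>x y. P x \<Longrightarrow> P y \<Longrightarrow> P (x * y)"
    and "\<And>x. P (s_scalar x)" "P t"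
  shows "P (s_eval t c)"
  by (induction c) (use assms assms(3)[of 0] in \<open>simp_all add: s_eval_pCons\<close>)

lemma coeff_hom_apply_s_eval:
  assumes "coeff_hom \<kappa>" "\<And>x. \<kappa> (s_scalar x) = s_scalar x"
  shows "\<kappa> (s_eval t c) = s_eval (\<kappa> t) c"
proof -
  interpret coeff_hom \<kappa> by (rule assms(1))
  show ?thesis by (induction c) (simp_all add: s_eval_pCons hom_add hom_mult assms(2))
qed

abbreviation z_var :: "nat \<Rightarrow> smod" where
  "z_var j \<equiv> s_const (ratfun_of (mpoly_var j))"

abbreviation z_monomial :: "(nat \<Rightarrow>\<^sub>0 nat) \<Rightarrow> smod" where
  "z_monomial m \<equiv> s_const (ratfun_of (Poly_Mapping.single m 1))"

section \<open>Elements depending rationally on some of the z-variables\<close>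

definition s_monomials :: "smod set" where
  "s_monomials = {Poly_Mapping.single m 1 | m. True}"

text \<open>Membership in the span of \<open>M\<close> over the rational functions in the z_j with j
  in \<open>V\<close>. For one factor of a product \<open>M\<close> consists of all monomials in the
  s_i, for the other only of powers of t; the latter makes its coefficients polynomials in t, which
  can be moved across the product.\<close>

definition denominators :: "nat set \<Rightarrow> smod set \<Rightarrow> smod \<Rightarrow> bool" where
  "denominators V M a \<longleftrightarrow> (\<exists>q. q \<noteq> 0 \<and> mpoly_vars q \<subseteq> V \<and> s_const (ratfun_of q) * a \<in> poly_span V M)"

lemma poly_span_const_mult:
  assumes "x \<in> poly_span V M" "mpoly_vars p \<subseteq> V"
  shows "s_const (ratfun_of p) * x \<in> poly_span V M"
  using assms(1)
proof induction
  case (add x g q)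
  have "mpoly_vars (p * q) \<subseteq> V" using mpoly_vars_mult[of p q] add assms(2) by blast
  from poly_span.add[OF add.IH add.hyps(2) this] show ?case
    by (simp add: ratfun_of.hom_mult s_const.hom_mult algebra_simps)
qed (simp add: poly_span.zero)

lemma poly_span_coeff_deriv:
  assumes "x \<in> poly_span V M" "\<And>g. g \<in> M \<Longrightarrow> coeff_deriv j g = 0"
  shows "coeff_deriv j x \<in> poly_span V M"
  using assms(1)
proof induction
  case (add x g p)
  from poly_span.add[OF add.IH add.hyps(2) mpoly_vars_deriv[OF add.hyps(3)]] show ?case
    by (simp add: CD.D_add CD.D_mult assms(2)[OF add.hyps(2)] ratfun_deriv_of)
qed (simp add: poly_span.zero)

lemma mpoly_deriv_outside: "mpoly_vars p \<subseteq> V \<Longrightarrow> j \<notin> V \<Longrightarrow> mpoly_deriv j p = 0"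
  by (induction rule: mpoly_vars_induct)
    (auto simp: mpoly_deriv_var mpoly_deriv_add mpoly_deriv_mult)

lemma poly_span_deriv_outside:
  assumes "x \<in> poly_span V M" "\<And>g. g \<in> M \<Longrightarrow> coeff_deriv j g = 0" "j \<notin> V"
  shows "coeff_deriv j x = 0"
  using assms(1)
  by induction
    (auto simp: CD.D_add CD.D_mult assms(2) ratfun_deriv_of mpoly_deriv_outside[OF _ assms(3)])

lemma denominators_deriv_outside:
  assumes "denominators V M a" "\<And>g. g \<in> M \<Longrightarrow> coeff_deriv j g = 0" "j \<notin> V"
  shows "coeff_deriv j a = 0"
proof -
  obtain q where q: "q \<noteq> 0" "mpoly_vars q \<subseteq> V" "s_const (ratfun_of q) * a \<in> poly_span V M"
    using assms(1) by (auto simp: denominators_def)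
  have "s_const (ratfun_of q) * coeff_deriv j a = coeff_deriv j (s_const (ratfun_of q) * a)"
    by (simp add: CD.D_mult ratfun_deriv_of mpoly_deriv_outside[OF q(2) assms(3)])
  also have "\<dots> = 0" using poly_span_deriv_outside[OF q(3) assms(2,3)] .
  finally show ?thesis using q(1) by simp
qed

lemma denominators_poly_span: "x \<in> poly_span V M \<Longrightarrow> denominators V M x"
  unfolding denominators_def by (intro exI[of _ 1]) simp

lemma denominators_add:
  assumes "denominators V M a" "denominators V M b"
  shows "denominators V M (a + b)"
proof -
  obtain p q where p: "p \<noteq> 0" "mpoly_vars p \<subseteq> V" "s_const (ratfun_of p) * a \<in> poly_span V M"
    and q: "q \<noteq> 0" "mpoly_vars q \<subseteq> V" "s_const (ratfun_of q) * b \<in> poly_span V M"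
    using assms by (auto simp: denominators_def)
  have "s_const (ratfun_of (p * q)) * (a + b)
      = s_const (ratfun_of q) * (s_const (ratfun_of p) * a) + s_const (ratfun_of p) * (s_const (ratfun_of q) * b)"
    by (simp add: ratfun_of.hom_mult s_const.hom_mult algebra_simps)
  also have "\<dots> \<in> poly_span V M"
    by (rule poly_span_add[OF poly_span_const_mult[OF p(3) q(2)] poly_span_const_mult[OF q(3) p(2)]])
  finally show ?thesis
    using p q mpoly_vars_mult[of p q] unfolding denominators_def by (intro exI[of _ "p * q"]) auto
qed

lemma denominators_mult:
  assumes "denominators V M a" "denominators V M b" "\<And>g h. g \<in> M \<Longrightarrow> h \<in> M \<Longrightarrow> g * h \<in> M"
  shows "denominators V M (a * b)"
proof -
  obtain p q where p: "p \<noteq> 0" "mpoly_vars p \<subseteq> V" "s_const (ratfun_of p) * a \<in> poly_span V M"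
    and q: "q \<noteq> 0" "mpoly_vars q \<subseteq> V" "s_const (ratfun_of q) * b \<in> poly_span V M"
    using assms by (auto simp: denominators_def)
  have "s_const (ratfun_of (p * q)) * (a * b) = s_const (ratfun_of p) * a * (s_const (ratfun_of q) * b)"
    by (simp add: ratfun_of.hom_mult s_const.hom_mult algebra_simps)
  also have "\<dots> \<in> poly_span V M"
    by (rule poly_span_mult[OF p(3) q(3) assms(3)])
  finally show ?thesis
    using p q mpoly_vars_mult[of p q] unfolding denominators_def by (intro exI[of _ "p * q"]) auto
qed

lemma denominators_sum:
  "(\<And>j. j \<in> J \<Longrightarrow> denominators V M (h j)) \<Longrightarrow> denominators V M (sum h J)"
  by (induction J rule: infinite_finite_induct)
    (auto intro: denominators_add denominators_poly_span poly_span.zero)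

lemma denominators_common:
  assumes "finite J" "\<And>j. j \<in> J \<Longrightarrow> denominators V M (h j)"
  shows "\<exists>q. q \<noteq> 0 \<and> mpoly_vars q \<subseteq> V \<and> (\<forall>j\<in>J. s_const (ratfun_of q) * h j \<in> poly_span V M)"
  using assms
proof (induction J)
  case empty
  show ?case by (intro exI[of _ 1]) simp
next
  case (insert j J)
  then obtain q where q: "q \<noteq> 0" "mpoly_vars q \<subseteq> V" "\<forall>j\<in>J. s_const (ratfun_of q) * h j \<in> poly_span V M"
    by auto
  obtain p where p: "p \<noteq> 0" "mpoly_vars p \<subseteq> V" "s_const (ratfun_of p) * h j \<in> poly_span V M"
    using insert.prems[of j] by (auto simp: denominators_def)
  have "s_const (ratfun_of (p * q)) * h i \<in> poly_span V M" if "i \<in> insert j J" for i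
  proof (cases "i = j")
    case True
    then show ?thesis using poly_span_const_mult[OF p(3) q(2)]
      by (simp add: ratfun_of.hom_mult s_const.hom_mult mult_ac)
  next
    case False
    then have "s_const (ratfun_of q) * h i \<in> poly_span V M" using q(3) that by blast
    from poly_span_const_mult[OF this p(2)] show ?thesis
      by (simp add: ratfun_of.hom_mult s_const.hom_mult mult_ac)
  qed
  then show ?case
    using p q mpoly_vars_mult[of p q] by (intro exI[of _ "p * q"]) auto
qed

lemma denominators_dmod:
  assumes "x \<in> dmod V \<omega> G"
    and gen: "\<And>g. g \<in> G \<Longrightarrow> denominators V M g"
    and form: "\<And>j. j \<in> V \<Longrightarrow> denominators V M (\<omega> j)"
    and M: "\<And>g h. g \<in> M \<Longrightarrow> h \<in> M \<Longrightarrow> g * h \<in> M" "1 \<in> M" "\<And>g j. g \<in> M \<Longrightarrow> coeff_deriv j g = 0"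
  shows "denominators V M x"
proof -
  have const: "denominators V M (s_const (ratfun_of p))" if "mpoly_vars p \<subseteq> V" for p
    using poly_span_gen[OF M(2) that] by (simp add: denominators_poly_span)
  show ?thesis
    using assms(1)
  proof induction
    case (conn x j)
    obtain q where q: "q \<noteq> 0" "mpoly_vars q \<subseteq> V" "s_const (ratfun_of q) * x \<in> poly_span V M"
      using conn.IH by (auto simp: denominators_def)
    \<comment> \<open>The quotient rule without division: q^2 x' = q (q x)' - q' (q x).\<close>
    have "s_const (ratfun_of (q * q)) * coeff_deriv j x
        = s_const (ratfun_of q) * coeff_deriv j (s_const (ratfun_of q) * x)
          + s_const (ratfun_of (- mpoly_deriv j q)) * (s_const (ratfun_of q) * x)"
      by (simp add: CD.D_mult ratfun_deriv_of ratfun_of.hom_mult s_const.hom_mult ratfun_of.hom_uminus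
          s_const.hom_uminus algebra_simps)
    also have "\<dots> \<in> poly_span V M"
      using q(2) by (intro poly_span_add[OF poly_span_const_mult[OF poly_span_coeff_deriv[OF q(3) M(3)] q(2)]
            poly_span_const_mult[OF q(3)]]) (simp_all add: mpoly_vars_deriv)
    finally have "denominators V M (coeff_deriv j x)"
      using q mpoly_vars_mult[of q q] unfolding denominators_def by (intro exI[of _ "q * q"]) auto
    then show ?case
      unfolding conn_def using conn form M(1) by (intro denominators_add denominators_mult)
  next
    case zero
    show ?case by (intro denominators_poly_span poly_span.zero)
  next
    case (scalar x c)
    then show ?case unfolding s_scalar_def using M(1) by (intro denominators_mult const) auto
  next
    case (var x j)
    then show ?case using M(1) by (intro denominators_mult const) auto
  qed (auto intro: gen denominators_add)
qed

lemma s_monomials_mult: "g \<in> s_monomials \<Longrightarrow> h \<in> s_monomials \<Longrightarrow> g * h \<in> s_monomials"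
  by (force simp: s_monomials_def mult_single)

lemma one_s_monomials: "1 \<in> s_monomials"
  by (auto simp: s_monomials_def intro!: exI[of _ 0])

lemma coeff_deriv_s_monomials: "g \<in> s_monomials \<Longrightarrow> coeff_deriv j g = 0"
  by (auto simp: s_monomials_def)

lemma denominators_const: "mpoly_vars p \<subseteq> V \<Longrightarrow> denominators V s_monomials (s_const (ratfun_of p))"
  using poly_span_gen[OF one_s_monomials] by (fastforce intro: denominators_poly_span)

lemma denominators_const_divide:
  assumes "mpoly_vars p \<subseteq> V" "mpoly_vars q \<subseteq> V" "q \<noteq> 0" "1 \<in> M"
  shows "denominators V M (s_const (ratfun_of p / ratfun_of q))"
  unfolding denominators_def using assms poly_span_gen[of 1 M p V]
  by (intro exI[of _ q]) (simp flip: s_const.hom_mult)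

lemma denominators_s_var: "denominators V s_monomials (s_var i)"
  using poly_span_gen[of "s_var i" s_monomials 1 V]
  by (auto simp: s_monomials_def s_var_def intro: denominators_poly_span)

lemma denominators_scalar: "denominators V s_monomials (s_scalar c)"
  unfolding s_scalar_def by (intro denominators_const) simp

lemma denominators_s_eval: "denominators V s_monomials t \<Longrightarrow> denominators V s_monomials (s_eval t c)"
  by (rule s_eval_induct)
    (auto intro: denominators_add denominators_mult s_monomials_mult denominators_scalar)

section \<open>Independence of monomials in disjoint variables\<close>

lemma lookup_single_mult:
  "Poly_Mapping.lookup (Poly_Mapping.single m 1 * (p :: mpoly)) k
    = (\<Sum>n\<in>Poly_Mapping.keys p. if m + n = k then Poly_Mapping.lookup p n else 0)"
proof -
  have "Poly_Mapping.single m 1 * p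
      = (\<Sum>n\<in>Poly_Mapping.keys p. Poly_Mapping.single (m + n) (Poly_Mapping.lookup p n))"
    by (subst mpoly_sum_monomials[of p]) (simp add: sum_distrib_left mult_single)
  then show ?thesis by (simp add: lookup_sum lookup_single when_def)
qed

text \<open>An exponent splits uniquely into its parts over \<open>V\<close> and \<open>W\<close>,
  so the coefficient of the sum at k + n is that of \<open>p k\<close> at n.\<close>

lemma mpoly_monomials_independent:
  assumes "finite K" "\<And>m. m \<in> K \<Longrightarrow> Poly_Mapping.keys m \<subseteq> V" "\<And>m. m \<in> K \<Longrightarrow> mpoly_vars (p m) \<subseteq> W"
    and "V \<inter> W = {}" "(\<Sum>m\<in>K. Poly_Mapping.single m 1 * p m) = 0" "k \<in> K"
  shows "p k = 0"
proof (rule poly_mapping_eqI)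
  fix n
  show "Poly_Mapping.lookup (p k) n = Poly_Mapping.lookup 0 n"
  proof (cases "n \<in> Poly_Mapping.keys (p k)")
    case True
    then have n: "Poly_Mapping.keys n \<subseteq> W" using assms(3)[OF assms(6)] by (auto simp: mpoly_vars_def)
    have "Poly_Mapping.lookup (Poly_Mapping.single m 1 * p m) (k + n)
        = (if m = k then Poly_Mapping.lookup (p k) n else 0)" if m: "m \<in> K" for m
    proof -
      have "m = k \<and> l = n" if l: "l \<in> Poly_Mapping.keys (p m)" "m + l = k + n" for l
      proof -
        have "Poly_Mapping.keys l \<subseteq> W" using assms(3)[OF m] l by (auto simp: mpoly_vars_def)
        have "Poly_Mapping.lookup m i = Poly_Mapping.lookup k i" for i
        proof (cases "i \<in> V")
          case True
          then have "Poly_Mapping.lookup l i = 0" "Poly_Mapping.lookup n i = 0"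
            using n \<open>Poly_Mapping.keys l \<subseteq> W\<close> assms(4) by (auto simp: in_keys_iff)
          then show ?thesis using arg_cong[OF l(2), of "\<lambda>x. Poly_Mapping.lookup x i"] by (simp add: lookup_add)
        next
          case False
          then have "i \<notin> Poly_Mapping.keys m" "i \<notin> Poly_Mapping.keys k"
            using assms(2) m assms(6) by blast+
          then show ?thesis by (simp add: in_keys_iff)
        qed
        then have "m = k" by (rule poly_mapping_eqI)
        then show ?thesis using l(2) by simp
      qed
      then have "Poly_Mapping.lookup (Poly_Mapping.single m 1 * p m) (k + n)
          = (\<Sum>l\<in>Poly_Mapping.keys (p m). if l = n \<and> m = k then Poly_Mapping.lookup (p k) n else 0)"
        unfolding lookup_single_mult by (intro sum.cong) auto
      also have "\<dots> = (if m = k then Poly_Mapping.lookup (p k) n else 0)"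
        using True by auto
      finally show ?thesis .
    qed
    then have "Poly_Mapping.lookup (\<Sum>m\<in>K. Poly_Mapping.single m 1 * p m) (k + n)
        = Poly_Mapping.lookup (p k) n"
      using assms(1,6) by (simp add: lookup_sum)
    then show ?thesis using assms(5) by simp
  qed (simp add: in_keys_iff)
qed

text \<open>A common denominator of the u_m involves only variables in \<open>W\<close>. After
  clearing it, comparing each monomial in the s_i reduces the claim to polynomials.\<close>

lemma z_monomials_independent:
  assumes "finite K" "\<And>m. m \<in> K \<Longrightarrow> Poly_Mapping.keys m \<subseteq> V"
    and "\<And>m. m \<in> K \<Longrightarrow> denominators W s_monomials (u m)"
    and "V \<inter> W = {}" "(\<Sum>m\<in>K. z_monomial m * u m) = 0" "k \<in> K"
  shows "u k = 0"
proof -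
  obtain q where q: "q \<noteq> 0" "mpoly_vars q \<subseteq> W"
    and u: "\<And>m. m \<in> K \<Longrightarrow> s_const (ratfun_of q) * u m \<in> poly_span W s_monomials"
    using denominators_common[of K W s_monomials u] assms(1,3) by auto
  have coeffs: "\<exists>p. mpoly_vars p \<subseteq> W \<and> Poly_Mapping.lookup x \<kappa> = ratfun_of p"
    if "x \<in> poly_span W s_monomials" for x \<kappa>
    using that
  proof induction
    case zero
    show ?case by (intro exI[of _ 0]) simp
  next
    case (add x g p)
    then obtain p' m where p': "mpoly_vars p' \<subseteq> W" "Poly_Mapping.lookup x \<kappa> = ratfun_of p'"
      and "g = Poly_Mapping.single m 1" by (auto simp: s_monomials_def)
    then have "Poly_Mapping.lookup (s_const (ratfun_of p) * g + x) \<kappa>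
        = ratfun_of ((if m = \<kappa> then p else 0) + p')"
      by (simp add: lookup_add s_const_mult_single lookup_single when_def ratfun_of.hom_add)
    moreover have "mpoly_vars ((if m = \<kappa> then p else 0) + p') \<subseteq> W"
      using mpoly_vars_add[of p p'] p' add.hyps by auto
    ultimately show ?case by blast
  qed
  have lookup_const_mult: "Poly_Mapping.lookup (s_const c * x) \<kappa> = c * Poly_Mapping.lookup x \<kappa>" for c x \<kappa>
  proof (induction x rule: poly_mapping_add_induct)
    case (single m d)
    then show ?case by (simp add: s_const_mult_single lookup_single when_def)
  qed (simp_all add: lookup_add distrib_left)
  have "Poly_Mapping.lookup (s_const (ratfun_of q) * u k) \<kappa> = 0" for \<kappa>
  proof -
    obtain p where p: "\<And>m. m \<in> K \<Longrightarrow> mpoly_vars (p m) \<subseteq> W"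
        "\<And>m. m \<in> K \<Longrightarrow> Poly_Mapping.lookup (s_const (ratfun_of q) * u m) \<kappa> = ratfun_of (p m)"
      using coeffs[OF u, of _ \<kappa>] by metis
    have "ratfun_of (\<Sum>m\<in>K. Poly_Mapping.single m 1 * p m)
        = Poly_Mapping.lookup (s_const (ratfun_of q) * (\<Sum>m\<in>K. z_monomial m * u m)) \<kappa>"
      by (simp add: ratfun_of.hom_sum ratfun_of.hom_mult sum_distrib_left lookup_sum
          mult.left_commute[of "s_const (ratfun_of q)"] lookup_const_mult[of "ratfun_of (Poly_Mapping.single _ 1)"] p(2))
    then have "(\<Sum>m\<in>K. Poly_Mapping.single m 1 * p m) = 0"
      using assms(5) by simp
    from mpoly_monomials_independent[OF assms(1,2) p(1) assms(4) this assms(6)]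
    show ?thesis using p(2)[OF assms(6)] by simp
  qed
  then have "s_const (ratfun_of q) * u k = 0" by (intro poly_mapping_eqI) simp
  then show ?thesis using q(1) by simp
qed

lemma z_monomial_scalar:
  "s_const (ratfun_of (Poly_Mapping.single m y)) = z_monomial m * s_scalar y"
proof -
  have "Poly_Mapping.single m y = Poly_Mapping.single m 1 * mpoly_const y"
    by (simp add: mpoly_const_def mult_single)
  then show ?thesis by (simp only: s_scalar_def ratfun_of.hom_mult s_const.hom_mult)
qed

lemma s_const_ratfun_of_expand:
  "s_const (ratfun_of p)
    = (\<Sum>m\<in>Poly_Mapping.keys p. z_monomial m * s_scalar (Poly_Mapping.lookup p m))"
  by (subst mpoly_sum_monomials[of p], unfold ratfun_of.hom_sum s_const.hom_sum)
    (intro sum.cong refl z_monomial_scalar)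

text \<open>That c vanishes off \<open>K\<close> allows several expansions to be put over one index
  set.\<close>

lemma poly_span_powers_expand:
  assumes "x \<in> poly_span V {t ^ n | n. True}"
  shows "\<exists>K c. finite K \<and> (\<forall>m\<in>K. Poly_Mapping.keys m \<subseteq> V) \<and> (\<forall>m. m \<notin> K \<longrightarrow> c m = 0)
    \<and> x = (\<Sum>m\<in>K. z_monomial m * s_eval t (c m))"
  using assms
proof induction
  case zero
  show ?case by (intro exI[of _ "{}"] exI[of _ "\<lambda>_. 0"]) simp
next
  case (add x g p)
  then obtain K c n where K: "finite K" "\<forall>m\<in>K. Poly_Mapping.keys m \<subseteq> V" "\<forall>m. m \<notin> K \<longrightarrow> c m = 0"
    and x: "x = (\<Sum>m\<in>K. z_monomial m * s_eval t (c m))" and g: "g = t ^ n" by auto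
  let ?K = "K \<union> Poly_Mapping.keys p"
  define d where "d m = monom (Poly_Mapping.lookup p m) n" for m
  have x': "x = (\<Sum>m\<in>?K. z_monomial m * s_eval t (c m))"
    unfolding x using K by (intro sum.mono_neutral_left) auto
  have "s_const (ratfun_of p) * g = (\<Sum>m\<in>Poly_Mapping.keys p. z_monomial m * s_eval t (d m))"
    unfolding s_const_ratfun_of_expand[of p] sum_distrib_right
    by (simp add: g d_def s_eval_monom mult.assoc)
  also have "\<dots> = (\<Sum>m\<in>?K. z_monomial m * s_eval t (d m))"
    using K(1) by (intro sum.mono_neutral_left) (auto simp: d_def in_keys_iff)
  finally have "s_const (ratfun_of p) * g + x = (\<Sum>m\<in>?K. z_monomial m * s_eval t (d m + c m))"
    unfolding x' by (simp add: s_eval.hom_add distrib_left sum.distrib)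
  moreover have "\<forall>m\<in>?K. Poly_Mapping.keys m \<subseteq> V" using K add.hyps(3) by (auto simp: mpoly_vars_def)
  moreover have "\<forall>m. m \<notin> ?K \<longrightarrow> d m + c m = 0" using K by (auto simp: d_def in_keys_iff)
  ultimately show ?case
    using K(1) by (intro exI[of _ ?K] exI[of _ "\<lambda>m. d m + c m"]) simp
qed

text \<open>Comparing coefficients of the monomials in the \<open>z\<^sub>j\<close>, \<open>j \<in> V\<close>, turns a relation between the \<open>a\<^sub>j\<close>
  over the \<open>b\<^sub>j\<close> into relations with coefficients in \<open>\<complex>[t]\<close>.\<close>

lemma sum_coefficients:
  assumes "finite J" and a: "\<forall>j\<in>J. denominators W s_monomials (a j)"
    and b: "\<forall>j\<in>J. denominators V {t ^ n | n. True} (b j)"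
    and e: "denominators W s_monomials e" and t: "denominators W s_monomials t"
    and "V \<inter> W = {}" and eq: "(\<Sum>j\<in>J. a j * b j) = e"
  shows "\<exists>q K c. q \<noteq> 0 \<and> Poly_Mapping.keys q \<subseteq> K
    \<and> (\<forall>j\<in>J. s_const (ratfun_of q) * b j = (\<Sum>m\<in>K. z_monomial m * s_eval t (c j m)))
    \<and> (\<forall>m\<in>K. (\<Sum>j\<in>J. a j * s_eval t (c j m)) = s_scalar (Poly_Mapping.lookup q m) * e)"
proof -
  obtain q where q: "q \<noteq> 0" "mpoly_vars q \<subseteq> V"
    and qb: "\<And>j. j \<in> J \<Longrightarrow> s_const (ratfun_of q) * b j \<in> poly_span V {t ^ n | n. True}"
    using denominators_common[of J V "{t ^ n | n. True}" b] assms(1) b by auto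
  have "\<forall>j\<in>J. \<exists>K c. finite K \<and> (\<forall>m\<in>K. Poly_Mapping.keys m \<subseteq> V) \<and> (\<forall>m. m \<notin> K \<longrightarrow> c m = 0)
      \<and> s_const (ratfun_of q) * b j = (\<Sum>m\<in>K. z_monomial m * s_eval t (c m))"
    using poly_span_powers_expand[OF qb] by blast
  then obtain L c where "\<forall>j\<in>J. finite (L j) \<and> (\<forall>m\<in>L j. Poly_Mapping.keys m \<subseteq> V) \<and> (\<forall>m. m \<notin> L j \<longrightarrow> c j m = 0)
      \<and> s_const (ratfun_of q) * b j = (\<Sum>m\<in>L j. z_monomial m * s_eval t (c j m))"
    unfolding bchoice_iff by blast
  then have L: "\<And>j. j \<in> J \<Longrightarrow> finite (L j)" "\<And>j m. j \<in> J \<Longrightarrow> m \<in> L j \<Longrightarrow> Poly_Mapping.keys m \<subseteq> V"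
      "\<And>j m. j \<in> J \<Longrightarrow> m \<notin> L j \<Longrightarrow> c j m = 0"
    and exp: "\<And>j. j \<in> J \<Longrightarrow> s_const (ratfun_of q) * b j = (\<Sum>m\<in>L j. z_monomial m * s_eval t (c j m))"
    by blast+
  define K where "K = (\<Union>j\<in>J. L j) \<union> Poly_Mapping.keys q"
  have K: "finite K" "\<And>m. m \<in> K \<Longrightarrow> Poly_Mapping.keys m \<subseteq> V"
    using assms(1) L(1,2) q(2) by (auto simp: K_def mpoly_vars_def)
  have exp': "s_const (ratfun_of q) * b j = (\<Sum>m\<in>K. z_monomial m * s_eval t (c j m))" if "j \<in> J" for j
    unfolding exp[OF that] using that K(1) L(3)[OF that]
    by (intro sum.mono_neutral_left) (auto simp: K_def)
  \<comment> \<open>The denominator q has its variables in \<open>V\<close> too, so the right-hand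
    side q e has the coefficient q_m e at the monomial m.\<close>
  have q_exp: "s_const (ratfun_of q) = (\<Sum>m\<in>K. z_monomial m * s_scalar (Poly_Mapping.lookup q m))"
  proof -
    have "s_const (ratfun_of q) = (\<Sum>m\<in>Poly_Mapping.keys q. z_monomial m * s_scalar (Poly_Mapping.lookup q m))"
      by (rule s_const_ratfun_of_expand)
    also have "\<dots> = (\<Sum>m\<in>K. z_monomial m * s_scalar (Poly_Mapping.lookup q m))"
      using K(1) by (intro sum.mono_neutral_left) (auto simp: K_def in_keys_iff)
    finally show ?thesis .
  qed
  define u where "u m = (\<Sum>j\<in>J. a j * s_eval t (c j m)) + s_scalar (- Poly_Mapping.lookup q m) * e" for m
  have "(\<Sum>m\<in>K. z_monomial m * u m) = (\<Sum>j\<in>J. a j * (\<Sum>m\<in>K. z_monomial m * s_eval t (c j m)))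
      - (\<Sum>m\<in>K. z_monomial m * s_scalar (Poly_Mapping.lookup q m)) * e"
  proof -
    have "(\<Sum>m\<in>K. z_monomial m * u m) = (\<Sum>m\<in>K. \<Sum>j\<in>J. a j * (z_monomial m * s_eval t (c j m)))
        - (\<Sum>m\<in>K. z_monomial m * s_scalar (Poly_Mapping.lookup q m) * e)"
      by (simp add: u_def s_scalar.hom_uminus right_diff_distrib sum_subtractf sum_distrib_left
          mult.left_commute mult.assoc)
    then show ?thesis
      by (subst (asm) sum.swap) (simp add: sum_distrib_left sum_distrib_right)
  qed
  also have "\<dots> = (\<Sum>j\<in>J. a j * (s_const (ratfun_of q) * b j)) - s_const (ratfun_of q) * e"
    by (simp add: exp' flip: q_exp)
  also have "\<dots> = 0"
    by (simp add: mult.left_commute sum_distrib_left flip: eq)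
  finally have zero: "(\<Sum>m\<in>K. z_monomial m * u m) = 0" .
  have "denominators W s_monomials (u m)" for m
    unfolding u_def using a e t
    by (intro denominators_add denominators_sum denominators_mult denominators_s_eval denominators_scalar
        s_monomials_mult) auto
  then have "u m = 0" if "m \<in> K" for m
    using z_monomials_independent[OF K _ assms(6) zero that] by blast
  then have "(\<Sum>j\<in>J. a j * s_eval t (c j m)) = s_scalar (Poly_Mapping.lookup q m) * e" if "m \<in> K" for m
    using that by (simp add: u_def s_scalar.hom_uminus)
  then show ?thesis
    using q(1) exp' by (intro exI[of _ q] exI[of _ K] exI[of _ c]) (auto simp: K_def)
qed

section \<open>Peeling off a linear factor\<close>

text \<open>If \<open>a \<otimes> b\<close> is divisible by \<open>p = t - \<alpha>\<close> in \<open>A \<otimes>\<^bsub>\<complex>[t]\<^esub> B\<close>, then it vanishes in the tensor product of the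
  vector spaces \<open>A/pA\<close> and \<open>B/pB\<close>, so one of the factors does. The induction below does this by
  hand: a relation \<open>c\<^sub>0 a + \<Sum> c\<^sub>j x\<^sub>j = 0\<close> whose coefficients do not all vanish at \<open>\<alpha>\<close> either
  shows \<open>a \<in> pA\<close> or allows to eliminate one of the \<open>x\<^sub>j\<close>.\<close>

lemma peel_linear_factor:
  fixes t :: smod and \<alpha> :: complex
  defines "p \<equiv> [:- \<alpha>, 1:]"
  assumes A: "\<And>x y. x \<in> A \<Longrightarrow> y \<in> A \<Longrightarrow> x + y \<in> A" "0 \<in> A" "\<And>c x. x \<in> A \<Longrightarrow> s_eval t c * x \<in> A"
    and B: "\<And>x y. x \<in> B \<Longrightarrow> y \<in> B \<Longrightarrow> x + y \<in> B" "0 \<in> B" "\<And>c x. x \<in> B \<Longrightarrow> s_eval t c * x \<in> B"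
    and disjoint: "\<And>a b x y (J :: nat set). finite J \<Longrightarrow> a \<in> A \<Longrightarrow> b \<in> B \<Longrightarrow> b \<noteq> 0
      \<Longrightarrow> (\<And>j. j \<in> J \<Longrightarrow> x j \<in> A \<and> y j \<in> B) \<Longrightarrow> a * b + (\<Sum>j\<in>J. x j * y j) = 0
      \<Longrightarrow> \<exists>c0 c. c0 \<noteq> 0 \<and> s_eval t c0 * a + (\<Sum>j\<in>J. s_eval t (c j) * x j) = 0"
    and inj: "s_eval t p \<noteq> 0"
    and "finite (J :: nat set)" "a \<in> A" "b \<in> B" "\<And>j. j \<in> J \<Longrightarrow> x j \<in> A \<and> y j \<in> B"
    and "a * b = s_eval t p * (\<Sum>j\<in>J. x j * y j)"
  shows "(\<exists>a'\<in>A. a = s_eval t p * a') \<or> (\<exists>b'\<in>B. b = s_eval t p * b')"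
proof -
  let ?E = "s_eval t"
  have A_sum: "sum h K \<in> A" if "\<And>j. j \<in> K \<Longrightarrow> h j \<in> A" for h and K :: "nat set"
    using that by (induction K rule: infinite_finite_induct) (auto intro: A)
  have smult: "?E [:\<gamma>:] = s_scalar \<gamma>" for \<gamma> by (rule s_eval_const)
  have split: "\<exists>d. c = [:poly c \<alpha>:] + p * d" for c
  proof -
    have "poly (c - [:poly c \<alpha>:]) \<alpha> = 0" by simp
    then have "p dvd c - [:poly c \<alpha>:]" unfolding p_def by (simp only: poly_eq_0_iff_dvd)
    then obtain d where "c - [:poly c \<alpha>:] = p * d" by (rule dvdE)
    then show ?thesis by (intro exI[of _ d]) (simp add: algebra_simps)
  qed
  have degree_p: "degree p = 1" and p_0: "p \<noteq> 0" by (simp_all add: p_def)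
  \<comment> \<open>If c does not vanish at \<alpha>, it is a unit modulo p: in c = c(\<alpha>) + p
    d the second term moves to the right-hand side, and the scalar is divided out.\<close>
  have inv: "\<exists>a'\<in>S. a = ?E p * a'"
    if S: "\<And>x y. x \<in> S \<Longrightarrow> y \<in> S \<Longrightarrow> x + y \<in> S" "\<And>c x. x \<in> S \<Longrightarrow> ?E c * x \<in> S"
      and "a \<in> S" "x \<in> S" "?E c * a = ?E p * x" "poly c \<alpha> \<noteq> 0" for S a x c
  proof -
    obtain d where d: "c = [:poly c \<alpha>:] + p * d" using split by blast
    let ?y = "x + ?E (- d) * a" and ?i = "?E [:1 / poly c \<alpha>:]"
    have eq: "?E [:poly c \<alpha>:] * a = ?E p * ?y"
      using that(5) by (subst (asm) d) (simp add: s_eval.hom_add s_eval.hom_mult s_eval.hom_uminus algebra_simps)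
    have "?i * ?E [:poly c \<alpha>:] * a = ?E p * (?i * ?y)"
      unfolding mult.assoc eq by (rule mult.left_commute)
    moreover have "?i * ?E [:poly c \<alpha>:] = 1"
      using that(6) by (simp add: s_eval_const flip: s_scalar.hom_mult)
    ultimately have "a = ?E p * (?i * ?y)" by (simp only: mult_1_left)
    moreover have "?i * ?y \<in> S" using S that(3,4) by blast
    ultimately show ?thesis by (rule bexI)
  qed
  \<comment> \<open>While all coefficients vanish at \<alpha>, the relation can be divided by p; the
    degree of c0 bounds how often.\<close>
  have normalise: "\<exists>c0 c. ?E c0 * a + (\<Sum>j\<in>J. ?E (c j) * x j) = 0 \<and> (poly c0 \<alpha> \<noteq> 0 \<or> (\<exists>j\<in>J. poly (c j) \<alpha> \<noteq> 0))"
    if "c0 \<noteq> 0" "?E c0 * a + (\<Sum>j\<in>J. ?E (c j) * x j) = 0" for c0 c a x and J :: "nat set"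
    using that
  proof (induction "degree c0" arbitrary: c0 c rule: less_induct)
    case less
    show ?case
    proof (cases "poly c0 \<alpha> \<noteq> 0 \<or> (\<exists>j\<in>J. poly (c j) \<alpha> \<noteq> 0)")
      case True
      then show ?thesis using less.prems by blast
    next
      case False
      then have "p dvd c0" "\<forall>j\<in>J. p dvd c j" by (simp_all add: p_def poly_eq_0_iff_dvd)
      then obtain d0 d where d: "c0 = p * d0" "\<And>j. j \<in> J \<Longrightarrow> c j = p * d j"
        unfolding dvd_def by metis
      have "?E p * (?E d0 * a + (\<Sum>j\<in>J. ?E (d j) * x j)) = ?E c0 * a + (\<Sum>j\<in>J. ?E (c j) * x j)"
        by (simp add: d s_eval.hom_mult distrib_left sum_distrib_left mult.assoc)
      then have "?E d0 * a + (\<Sum>j\<in>J. ?E (d j) * x j) = 0"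
        using less.prems(2) inj by simp
      moreover have "d0 \<noteq> 0" using less.prems(1) d by auto
      moreover have "degree d0 < degree c0"
        using \<open>d0 \<noteq> 0\<close> degree_mult_eq[of p d0] unfolding d(1) by (simp only: degree_p p_0, simp)
      ultimately show ?thesis using less.hyps by blast
    qed
  qed
  show ?thesis
    using assms(10-14)
  proof (induction "card J" arbitrary: J b y rule: less_induct)
    case less
    show ?case
    proof (cases "b = 0")
      case True
      then show ?thesis using B(2) by (intro disjI2 bexI[of _ 0]) auto
    next
      case False
      \<comment> \<open>With -p absorbed into the second factors, the given equation becomes a
        relation to which \<open>disjoint\<close> applies.\<close>
      have "a * b + (\<Sum>j\<in>J. x j * (?E (- p) * y j)) = 0"
        using less.prems(5) by (simp add: s_eval.hom_uminus sum_negf sum_distrib_left mult.left_commute)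
      moreover have "\<And>j. j \<in> J \<Longrightarrow> x j \<in> A \<and> ?E (- p) * y j \<in> B"
        using less.prems(4) B(3) by blast
      ultimately obtain c0' c' where "c0' \<noteq> 0" "?E c0' * a + (\<Sum>j\<in>J. ?E (c' j) * x j) = 0"
        using disjoint[OF less.prems(1-3) False, of x "\<lambda>j. ?E (- p) * y j"] by blast
      from normalise[OF this] obtain c0 c where rel: "?E c0 * a + (\<Sum>j\<in>J. ?E (c j) * x j) = 0"
        and nz: "poly c0 \<alpha> \<noteq> 0 \<or> (\<exists>j\<in>J. poly (c j) \<alpha> \<noteq> 0)"
        by blast
      show ?thesis
      proof (cases "\<exists>j\<in>J. poly (c j) \<alpha> \<noteq> 0")
        case True
        then obtain l where l: "l \<in> J" "poly (c l) \<alpha> \<noteq> 0" by blast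
        let ?J = "J - {l}"
        \<comment> \<open>Multiplying the equation by c_l, eliminating c_l x_l through the relation,
          and collecting the multiples of a on the left gives b' and the y'_j. Modulo p B, b' equals
          c_l b with c_l a unit modulo p, so the conclusion for b' returns to b.\<close>
        define b' where "b' = ?E (c l) * b + ?E (p * c0) * y l"
        define y' where "y' j = ?E (c l) * y j + ?E (- c j) * y l" for j
        have xl: "?E (c l) * x l = - (?E c0 * a) - (\<Sum>j\<in>?J. ?E (c j) * x j)"
          using rel less.prems(1) l(1) by (simp add: sum.remove[of J l] algebra_simps eq_neg_iff_add_eq_0)
        have eq: "a * b = ?E p * (x l * y l + (\<Sum>j\<in>?J. x j * y j))"
          using less.prems(1,5) l(1) by (simp add: sum.remove[of J l])
        have "a * b' = ?E (c l) * (a * b) + ?E p * (?E c0 * a) * y l"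
          by (simp add: b'_def s_eval.hom_mult algebra_simps)
        also have "\<dots> = ?E p * ((?E (c l) * x l) * y l + (\<Sum>j\<in>?J. ?E (c l) * (x j * y j))) + ?E p * (?E c0 * a) * y l"
          by (simp add: eq sum_distrib_left algebra_simps)
        also have "\<dots> = ?E p * (\<Sum>j\<in>?J. x j * y' j)"
          unfolding xl y'_def
          by (simp add: s_eval.hom_uminus algebra_simps sum_subtractf sum_distrib_left sum_distrib_right)
        finally have "a * b' = ?E p * (\<Sum>j\<in>?J. x j * y' j)" .
        moreover have "card ?J < card J" using l less.prems(1) by (intro card_Diff1_less)
        moreover have "b' \<in> B" unfolding b'_def using less.prems l by (intro B) auto
        moreover have "x j \<in> A \<and> y' j \<in> B" if "j \<in> ?J" for j
          unfolding y'_def using less.prems l that by (auto intro!: B)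
        ultimately have "(\<exists>a'\<in>A. a = ?E p * a') \<or> (\<exists>b''\<in>B. b' = ?E p * b'')"
          using less.hyps[of ?J b' y'] less.prems(1,2) by blast
        then show ?thesis
        proof
          assume "\<exists>b''\<in>B. b' = ?E p * b''"
          then obtain b'' where b'': "b'' \<in> B" "b' = ?E p * b''" by blast
          then have "?E (c l) * b = ?E p * (b'' + ?E (- c0) * y l)"
            by (simp add: b'_def s_eval.hom_mult s_eval.hom_uminus algebra_simps eq_diff_eq)
          moreover have "b'' + ?E (- c0) * y l \<in> B"
            using b'' less.prems(4) l(1) by (intro B) auto
          ultimately show ?thesis using inv[of B b _ "c l"] B(1,3) l(2) less.prems(3) by blast
        qed blast
      next
        case False
        then have c0: "poly c0 \<alpha> \<noteq> 0" using nz by blast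
        from False have "\<forall>j\<in>J. p dvd c j" by (simp add: p_def poly_eq_0_iff_dvd)
        then obtain d where d: "\<And>j. j \<in> J \<Longrightarrow> c j = p * d j"
          unfolding dvd_def by metis
        have "?E c0 * a = ?E p * (\<Sum>j\<in>J. ?E (- d j) * x j)"
          using rel by (simp add: d s_eval.hom_mult s_eval.hom_uminus sum_distrib_left sum_negf mult.assoc
              eq_neg_iff_add_eq_0)
        moreover have "(\<Sum>j\<in>J. ?E (- d j) * x j) \<in> A"
          using less.prems(4) by (intro A_sum A(3)) auto
        ultimately show ?thesis using inv[of A a _ c0] A(1,3) c0 less.prems(2) by blast
      qed
    qed
  qed
qed

section \<open>Bernstein-Sato polynomials as minimal elements of an ideal\<close>

lemma dmod_s_eval:
  assumes "\<And>x. x \<in> dmod V \<omega> G \<Longrightarrow> t * x \<in> dmod V \<omega> G" "x \<in> dmod V \<omega> G"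
  shows "s_eval t c * x \<in> dmod V \<omega> G"
proof -
  have "\<forall>x\<in>dmod V \<omega> G. s_eval t c * x \<in> dmod V \<omega> G"
    by (rule s_eval_induct)
      (use assms(1) in \<open>auto simp: distrib_right mult.assoc intro: dmod.add dmod.scalar\<close>)
  then show ?thesis using assms(2) by blast
qed

lemma bs_module_s_eval:
  assumes "0 \<notin> set fs" "x \<in> bs_module V fs"
  shows "s_eval (\<Sum>i<length fs. s_var i) c * x \<in> bs_module V fs"
proof (rule dmod_s_eval[OF _ assms(2)])
  fix y assume "y \<in> bs_module V fs"
  then show "(\<Sum>i<length fs. s_var i) * y \<in> bs_module V fs"
    unfolding sum_distrib_right using assms(1) by (intro dmod_sum bs_module_s_var) auto
qed

lemma bs_equation_iff:
  "0 \<notin> set fs \<Longrightarrow> bs_equation V fs b \<longleftrightarrow> s_eval (\<Sum>i<length fs. s_var i) b \<in> bs_module V fs"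
  by (simp add: bs_equation_iff_bs_module s_eval_def)

lemma bs_equation_mult: "0 \<notin> set fs \<Longrightarrow> bs_equation V fs b \<Longrightarrow> bs_equation V fs (c * b)"
  by (simp add: bs_equation_iff s_eval.hom_mult bs_module_s_eval)

lemma bs_equation_diff:
  "0 \<notin> set fs \<Longrightarrow> bs_equation V fs b \<Longrightarrow> bs_equation V fs c \<Longrightarrow> bs_equation V fs (b - c)"
  by (simp add: bs_equation_iff s_eval.hom_diff dmod_diff)

lemma is_bs_poly_exists:
  assumes "0 \<notin> set fs" "bs_equation V fs c" "c \<noteq> 0"
  shows "\<exists>b. is_bs_poly V fs b"
proof -
  obtain d where d: "d \<noteq> 0" "bs_equation V fs d"
    and min: "\<And>e. e \<noteq> 0 \<Longrightarrow> bs_equation V fs e \<Longrightarrow> degree d \<le> degree e"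
    using ex_has_least_nat[of "\<lambda>d. d \<noteq> 0 \<and> bs_equation V fs d" c degree] assms(2,3) by blast
  have "bs_equation V fs (smult (1 / lead_coeff d) d)"
    using bs_equation_mult[OF assms(1) d(2), of "[:1 / lead_coeff d:]"] by simp
  then show ?thesis
    unfolding is_bs_poly_def using d min by (intro exI[of _ "smult (1 / lead_coeff d) d"]) simp
qed

text \<open>Stated for two lists because \<open>bs_poly_ideal\<close> ranges over all generators of
  the ideal.\<close>

lemma is_bs_poly_unique:
  assumes "0 \<notin> set fs" "\<And>c. bs_equation V fs c \<longleftrightarrow> bs_equation V fs' c"
    and "is_bs_poly V fs b" "is_bs_poly V fs' b'"
  shows "b = b'"
proof (rule ccontr)
  assume "b \<noteq> b'"
  have b: "lead_coeff b = 1" "bs_equation V fs b" "\<And>c. c \<noteq> 0 \<Longrightarrow> bs_equation V fs c \<Longrightarrow> degree b \<le> degree c"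
    and b': "lead_coeff b' = 1" "bs_equation V fs b'" "\<And>c. c \<noteq> 0 \<Longrightarrow> bs_equation V fs c \<Longrightarrow> degree b' \<le> degree c"
    using assms(2-4) by (auto simp: is_bs_poly_def)
  have deg: "degree b = degree b'"
    using b b' by (metis le_antisym leading_coeff_0_iff zero_neq_one)
  have "bs_equation V fs (b - b')" using bs_equation_diff[OF assms(1)] b(2) b'(2) .
  then have le: "degree b \<le> degree (b - b')" using b(3) \<open>b \<noteq> b'\<close> by simp
  have "degree (b - b') \<le> degree b" using deg degree_diff_le[of b "degree b" b'] by simp
  moreover have "coeff (b - b') (degree b) = 0" using b(1) b'(1) deg by simp
  ultimately have "lead_coeff (b - b') = 0" using le by (metis le_antisym)
  then have "b - b' = 0" by (simp only: leading_coeff_0_iff)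
  then show False using \<open>b \<noteq> b'\<close> by simp
qed

lemma is_bs_poly_dvd:
  assumes "0 \<notin> set fs" "is_bs_poly V fs b" "bs_equation V fs c"
  shows "b dvd c"
proof (rule ccontr)
  assume "\<not> b dvd c"
  then have "c mod b \<noteq> 0" by (simp add: mod_eq_0_iff_dvd)
  moreover have "c mod b = c - c div b * b" by (simp add: minus_div_mult_eq_mod)
  then have "bs_equation V fs (c mod b)"
    using assms by (simp add: bs_equation_diff bs_equation_mult is_bs_poly_def)
  ultimately have "degree b \<le> degree (c mod b)" using assms(2) by (auto simp: is_bs_poly_def)
  moreover have "b \<noteq> 0" using assms(2) by (auto simp: is_bs_poly_def)
  ultimately show False
    using degree_mod_less'[OF \<open>b \<noteq> 0\<close> \<open>c mod b \<noteq> 0\<close>] by simp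
qed

text \<open>Rests on \<complex> being algebraically closed: a nonconstant cofactor of the minimal
  polynomial h in b c has a root \<alpha>, and \<open>peel\<close> with e = q' h then lowers the
  degree of b or c.\<close>

lemma is_bs_poly_prod:
  assumes fs: "0 \<notin> set fs" "is_bs_poly V fs b" and gs: "0 \<notin> set gs" "is_bs_poly W gs c"
    and hs: "0 \<notin> set hs" "bs_equation U hs (b * c)"
    and peel: "\<And>\<alpha> b c e. bs_equation V fs b \<Longrightarrow> bs_equation W gs c \<Longrightarrow> bs_equation U hs e
      \<Longrightarrow> b * c = [:- \<alpha>, 1:] * e
      \<Longrightarrow> (\<exists>d. b = [:- \<alpha>, 1:] * d \<and> bs_equation V fs d) \<or> (\<exists>d. c = [:- \<alpha>, 1:] * d \<and> bs_equation W gs d)"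
  shows "is_bs_poly U hs (b * c)"
proof -
  have monic: "lead_coeff b = 1" "lead_coeff c = 1" and eqs: "bs_equation V fs b" "bs_equation W gs c"
    and min: "\<And>e. e \<noteq> 0 \<Longrightarrow> bs_equation V fs e \<Longrightarrow> degree b \<le> degree e"
      "\<And>e. e \<noteq> 0 \<Longrightarrow> bs_equation W gs e \<Longrightarrow> degree c \<le> degree e"
    using fs(2) gs(2) by (auto simp: is_bs_poly_def)
  then have nz: "b \<noteq> 0" "c \<noteq> 0" by auto
  then obtain h where h: "is_bs_poly U hs h"
    using is_bs_poly_exists[OF hs] by auto
  then obtain q where q: "b * c = h * q" using is_bs_poly_dvd[OF hs(1) _ hs(2)] by (auto elim: dvdE)
  have "degree q = 0"
  proof (rule ccontr)
    assume "degree q \<noteq> 0"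
    then have "\<not> constant (poly q)" by (simp add: constant_degree)
    then obtain \<alpha> where "poly q \<alpha> = 0" using fundamental_theorem_of_algebra by blast
    then obtain q' where q': "q = [:- \<alpha>, 1:] * q'" by (auto simp: poly_eq_0_iff_dvd elim: dvdE)
    let ?p = "[:- \<alpha>, 1:]"
    have "bs_equation U hs (q' * h)" using bs_equation_mult hs(1) h by (auto simp: is_bs_poly_def)
    moreover have "b * c = ?p * (q' * h)" using q q' by (simp only: mult_ac)
    ultimately consider d where "b = ?p * d" "bs_equation V fs d" | d where "c = ?p * d" "bs_equation W gs d"
      using peel eqs by blast
    then show False
    proof cases
      case 1
      then have "d \<noteq> 0" using nz by auto
      then have "degree b = Suc (degree d)" using 1 degree_mult_eq[of ?p d] by simp
      then show False using min(1)[OF \<open>d \<noteq> 0\<close> 1(2)] by simp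
    next
      case 2
      then have "d \<noteq> 0" using nz by auto
      then have "degree c = Suc (degree d)" using 2 degree_mult_eq[of ?p d] by simp
      then show False using min(2)[OF \<open>d \<noteq> 0\<close> 2(2)] by simp
    qed
  qed
  then obtain x where x: "q = [:x:]" by (rule degree_eq_zeroE)
  have "lead_coeff (b * c) = 1" using monic by (simp add: lead_coeff_mult)
  moreover have "degree (b * c) = degree h"
    using q x nz by (cases "x = 0") auto
  ultimately show ?thesis using hs(2) h by (simp add: is_bs_poly_def)
qed

section \<open>The functional equation of a product\<close>

text \<open>The image of the tensor product in \<open>smod\<close>; what is needed of injectivity
  enters through \<open>linearly_disjoint\<close>.\<close>

inductive_set prod_span :: "smod set \<Rightarrow> smod set \<Rightarrow> smod set" for A B where
  zero: "0 \<in> prod_span A B"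
| add: "z \<in> prod_span A B \<Longrightarrow> a \<in> A \<Longrightarrow> b \<in> B \<Longrightarrow> a * b + z \<in> prod_span A B"

lemma prod_span_add:
  "x \<in> prod_span A B \<Longrightarrow> y \<in> prod_span A B \<Longrightarrow> x + y \<in> prod_span A B"
  by (induction rule: prod_span.induct) (auto simp: add.assoc intro: prod_span.add)

lemma prod_span_gen: "a \<in> A \<Longrightarrow> b \<in> B \<Longrightarrow> a * b \<in> prod_span A B"
  using prod_span.add[OF prod_span.zero] by fastforce

lemma prod_span_map:
  assumes "z \<in> prod_span A B" "\<Phi> 0 = 0" "\<And>x y. \<Phi> (x + y) = \<Phi> x + \<Phi> y"
    and "\<And>a b. a \<in> A \<Longrightarrow> b \<in> B \<Longrightarrow> \<Phi> (a * b) \<in> prod_span A B"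
  shows "\<Phi> z \<in> prod_span A B"
  using assms(1) by induction (auto simp: assms(2,3) intro: prod_span.zero prod_span_add assms(4))

lemma prod_span_family:
  assumes "z \<in> prod_span A B"
  obtains J :: "nat set" and x y where "finite J" "\<And>j. j \<in> J \<Longrightarrow> x j \<in> A \<and> y j \<in> B" "z = (\<Sum>j\<in>J. x j * y j)"
proof -
  have "\<exists>(J :: nat set) x y. finite J \<and> (\<forall>j\<in>J. x j \<in> A \<and> y j \<in> B) \<and> z = (\<Sum>j\<in>J. x j * y j)"
    using assms
  proof induction
    case zero
    show ?case by (intro exI[of _ "{}"]) simp
  next
    case (add z a b)
    then obtain J :: "nat set" and x y where J: "finite J" "\<forall>j\<in>J. x j \<in> A \<and> y j \<in> B"
      and z: "z = (\<Sum>j\<in>J. x j * y j)" by blast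
    obtain l where l: "l \<notin> J" using J(1) ex_new_if_finite infinite_UNIV_nat by blast
    have "(\<Sum>j\<in>J. (x(l := a)) j * (y(l := b)) j) = z"
      unfolding z using l by (intro sum.cong) auto
    then have "a * b + z = (\<Sum>j\<in>insert l J. (x(l := a)) j * (y(l := b)) j)"
      using J(1) l by simp
    then show ?case
      using J add.hyps by (intro exI[of _ "insert l J"] exI[of _ "x(l := a)"] exI[of _ "y(l := b)"]) auto
  qed
  then show ?thesis using that by blast
qed

lemma mpoly_vars_power: "mpoly_vars p \<subseteq> V \<Longrightarrow> mpoly_vars (p ^ n) \<subseteq> V"
proof (induction n)
  case (Suc n)
  then show ?case using mpoly_vars_mult[of p "p ^ n"] by auto
qed simp

lemma denominators_prod:
  "(\<And>i. i \<in> I \<Longrightarrow> denominators V s_monomials (h i)) \<Longrightarrow> denominators V s_monomials (prod h I)"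
proof (induction I rule: infinite_finite_induct)
  case (insert i I)
  then show ?case by (auto intro: denominators_mult s_monomials_mult)
qed (use denominators_scalar[of V 1] in simp_all)

lemma denominators_bs_module:
  assumes "0 \<notin> set fs" "\<And>f. f \<in> set fs \<Longrightarrow> mpoly_vars f \<subseteq> V" "x \<in> bs_module V fs"
  shows "denominators V s_monomials x"
proof (rule denominators_dmod[OF assms(3)])
  have vars: "mpoly_vars (fs ! i) \<subseteq> V" and nz: "fs ! i \<noteq> 0" if "i < length fs" for i
    using that assms(1,2) by (auto dest: nth_mem)
  have falling: "denominators V s_monomials (falling i n)" for i n
  proof -
    have eq: "s_var i - of_nat l = s_var i + s_scalar (- of_nat l)" for l
      by (simp add: s_scalar.hom_uminus s_scalar.hom_of_nat)
    show ?thesis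
      unfolding falling_def eq
      by (intro denominators_prod denominators_add denominators_s_var denominators_scalar)
  qed
  have quotient: "denominators V s_monomials (s_const (ratfun_of (fs ! i) ^ m / ratfun_of (fs ! i) ^ n))"
    if "i < length fs" for i m n
    unfolding ratfun_of.hom_power[symmetric] using vars[OF that] nz[OF that]
    by (intro denominators_const_divide mpoly_vars_power one_s_monomials) auto
  show "denominators V s_monomials g" if "g \<in> shift_elems fs" for g
    using that unfolding shift_elems_def shift_elem_def
    by (auto intro!: denominators_prod denominators_mult falling quotient s_monomials_mult)
  show "denominators V s_monomials (log_form fs j)" for j
    unfolding log_form_def using vars nz
    by (intro denominators_sum denominators_mult denominators_s_var denominators_const_divide
        s_monomials_mult one_s_monomials mpoly_vars_deriv) auto
qed (simp_all add: s_monomials_mult one_s_monomials coeff_deriv_s_monomials)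

lemma powers_mult: "g \<in> {t ^ n | n. True} \<Longrightarrow> h \<in> {t ^ n | n. True} \<Longrightarrow> g * h \<in> {t ^ n | n. True}"
  for t :: smod
  by (force simp flip: power_add)

lemma one_powers: "1 \<in> {t ^ n | n. True}" for t :: smod
  by (auto intro!: exI[of _ 0])

lemma denominators_powers_s_eval: "denominators V {t ^ n | n. True} (s_eval t c)"
proof (rule s_eval_induct)
  show "denominators V {t ^ n | n. True} (s_scalar x)" for x
    unfolding s_scalar_def using denominators_const_divide[of "mpoly_const x" V 1, OF _ _ _ one_powers] by simp
  show "denominators V {t ^ n | n. True} t"
  proof (rule denominators_poly_span)
    have "t \<in> {t ^ n | n. True}" by (rule CollectI, rule exI[of _ 1]) simp
    from poly_span_gen[OF this, of 1 V] show "t \<in> poly_span V {t ^ n | n. True}" by simp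
  qed
qed (rule denominators_add denominators_mult[OF _ _ powers_mult]; assumption)+

text \<open>In contrast to \<open>coeff_deriv_\<rho>\<close>, the substituted elements are constant
  in z, so no correction term appears.\<close>

lemma subst_coeff_deriv:
  assumes "\<And>i. coeff_deriv j (v i) = 0"
  shows "lin_ext s_const (monomial_at v) (coeff_deriv j p) = coeff_deriv j (lin_ext s_const (monomial_at v) p)"
proof -
  interpret h: coeff_hom "lin_ext s_const (monomial_at v)" by (rule s_const.coeff_hom_poly_hom)
  show ?thesis
  proof (induction p rule: smod_induct)
    case (const a)
    then show ?case using s_const.poly_hom_const[of v] by (simp flip: s_const_def)
  next
    case (var i)
    then show ?case using s_const.poly_hom_var[of v i] assms by (simp add: s_var_def)
  qed (simp_all add: h.hom_add h.hom_mult CD.D_add CD.D_mult)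
qed

section \<open>Factorisation of the module of the product\<close>

locale disjoint_product =
  fixes X Y :: "nat set" and fs :: "mpoly list" and g :: mpoly
  assumes disjoint: "X \<inter> Y = {}" and fs_vars: "\<And>f. f \<in> set fs \<Longrightarrow> mpoly_vars f \<subseteq> X"
    and fs_0: "0 \<notin> set fs" and fs_nonempty: "fs \<noteq> []"
    and g_vars: "mpoly_vars g \<subseteq> Y" and g_0: "g \<noteq> 0"
begin

abbreviation "hs \<equiv> map (\<lambda>f. f * g) fs"
abbreviation "\<sigma> \<equiv> (\<Sum>i<length fs. s_var i)"
abbreviation "G \<equiv> s_const (ratfun_of g)"
abbreviation "g_form \<equiv> (\<lambda>j. \<sigma> * s_const (ratfun_of (mpoly_deriv j g) / ratfun_of g))"

text \<open>The module of \<open>g\<close> with its variable \<open>s\<close> replaced by \<open>s\<^sub>1 + \<cdots> + s\<^sub>r\<close>.\<close>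

abbreviation "B \<equiv> dmod Y g_form {s_eval \<sigma> c * G | c. True}"

lemma disjoint': "Y \<inter> X = {}"
  using disjoint by blast

lemma hs_0: "0 \<notin> set hs"
  using fs_0 g_0 by auto

lemma coeff_deriv_\<sigma> [simp]: "coeff_deriv j \<sigma> = 0"
  by (simp add: CD.D_sum)

text \<open>The logarithmic derivative of
  \<open>\<Prod> (f_i g)^{s_i} = (\<Prod> f_i^{s_i}) g^\<sigma>\<close>.\<close>

lemma log_form_hs: "log_form hs j = log_form fs j + g_form j"
proof -
  have "s_const (ratfun_of (mpoly_deriv j (fs ! i * g)) / ratfun_of (fs ! i * g))
      = s_const (ratfun_of (mpoly_deriv j (fs ! i)) / ratfun_of (fs ! i))
        + s_const (ratfun_of (mpoly_deriv j g) / ratfun_of g)" if "i < length fs" for i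
  proof -
    have "ratfun_of (fs ! i) \<noteq> 0" "ratfun_of g \<noteq> 0"
      using that fs_0 g_0 by (auto dest: nth_mem)
    then show ?thesis
      by (simp add: mpoly_deriv_mult ratfun_of.hom_add ratfun_of.hom_mult add_divide_distrib
          flip: s_const.hom_add)
  qed
  then show ?thesis
    by (simp add: log_form_def sum_distrib_right distrib_left sum.distrib)
qed

lemma log_form_hs_X: "j \<in> X \<Longrightarrow> log_form hs j = log_form fs j"
  using mpoly_deriv_outside[OF g_vars, of j] disjoint by (auto simp: log_form_hs)

lemma log_form_hs_Y:
  assumes "j \<in> Y" shows "log_form hs j = g_form j"
proof -
  have "j \<notin> X" using assms disjoint by auto
  then have "mpoly_deriv j (fs ! i) = 0" if "i < length fs" for i
    using mpoly_deriv_outside fs_vars that by (meson nth_mem)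
  then show ?thesis unfolding log_form_hs by (simp add: log_form_def)
qed

lemma B_s_eval: "x \<in> B \<Longrightarrow> s_eval \<sigma> c * x \<in> B"
proof (rule dmod_s_eval)
  fix x assume "x \<in> B"
  then show "\<sigma> * x \<in> B"
  proof (rule dmod_map)
    fix h assume "h \<in> {s_eval \<sigma> c * G | c. True}"
    then obtain c where "h = s_eval \<sigma> c * G" by blast
    then have "\<sigma> * h = s_eval \<sigma> (pCons 0 c) * G" by (simp add: s_eval_pCons mult.assoc)
    then show "\<sigma> * h \<in> B" by (auto intro: dmod.gen)
  qed (simp_all add: conn_mult distrib_left mult.left_commute)
qed

lemma G_in_B: "G \<in> B"
  by (rule dmod.gen, rule CollectI, rule exI[of _ 1]) simp

lemma denominators_A: "x \<in> bs_module X fs \<Longrightarrow> denominators X s_monomials x"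
  using denominators_bs_module fs_0 fs_vars by blast

lemma denominators_B: "x \<in> B \<Longrightarrow> denominators Y {\<sigma> ^ n | n. True} x"
proof (erule denominators_dmod)
  have \<sigma>: "denominators Y {\<sigma> ^ n | n. True} \<sigma>"
    using denominators_powers_s_eval[of Y \<sigma> "[:0, 1:]"] by (simp add: s_eval_pCons)
  have const: "denominators Y {\<sigma> ^ n | n. True} (s_const (ratfun_of p / ratfun_of q))"
    if "mpoly_vars p \<subseteq> Y" "mpoly_vars q \<subseteq> Y" "q \<noteq> 0" for p q
    using that one_powers by (rule denominators_const_divide)
  show "denominators Y {\<sigma> ^ n | n. True} (g_form j)" for j
    by (intro denominators_mult[OF \<sigma> const powers_mult] mpoly_vars_deriv g_vars g_0)
  show "denominators Y {\<sigma> ^ n | n. True} h" if "h \<in> {s_eval \<sigma> c * G | c. True}" for h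
    using that denominators_mult[OF denominators_powers_s_eval const[OF g_vars, of 1] powers_mult] by auto
  show "coeff_deriv j h = 0" if "h \<in> {\<sigma> ^ n | n. True}" for h j
    using that by (auto simp: CD.D_const_power)
qed (rule powers_mult one_powers; assumption)+

lemma coeff_deriv_A: "x \<in> bs_module X fs \<Longrightarrow> j \<in> Y \<Longrightarrow> coeff_deriv j x = 0"
  using denominators_deriv_outside[OF denominators_A] coeff_deriv_s_monomials disjoint by blast

lemma coeff_deriv_B: "x \<in> B \<Longrightarrow> j \<in> X \<Longrightarrow> coeff_deriv j x = 0"
  using denominators_deriv_outside[OF denominators_B] CD.D_const_power disjoint coeff_deriv_\<sigma> by blast

text \<open>The exponent of g is |\<mu>| - |\<nu>| = 1 for every shift, so all generators of the
  product share the one factor g.\<close>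

lemma shift_elem_hs:
  assumes "(\<Sum>i<length fs. \<mu> i) = Suc (\<Sum>i<length fs. \<nu> i)"
  shows "shift_elem hs \<nu> \<mu> = shift_elem fs \<nu> \<mu> * G"
proof -
  have "shift_elem hs \<nu> \<mu> = shift_elem fs \<nu> \<mu> * s_const (\<Prod>i<length fs. ratfun_of g ^ \<mu> i / ratfun_of g ^ \<nu> i)"
  proof -
    have "ratfun_of (f * g) ^ m / ratfun_of (f * g) ^ n
        = ratfun_of f ^ m / ratfun_of f ^ n * (ratfun_of g ^ m / ratfun_of g ^ n)" for f m n
      by (simp add: ratfun_of.hom_mult power_mult_distrib)
    then show ?thesis
      unfolding shift_elem_def s_const.hom_prod prod.distrib[symmetric] length_map
      by (intro prod.cong refl) (simp only: lessThan_iff nth_map s_const.hom_mult mult.assoc)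
  qed
  also have "(\<Prod>i<length fs. ratfun_of g ^ \<mu> i / ratfun_of g ^ \<nu> i) = ratfun_of g"
    using assms g_0 by (simp add: prod_dividef flip: power_sum)
  finally show ?thesis .
qed

lemma A_mult_G: "x \<in> bs_module X fs \<Longrightarrow> x * G \<in> bs_module (X \<union> Y) hs"
proof (induction rule: dmod.induct)
  case (gen h)
  then obtain \<nu> \<mu> where h: "h = shift_elem fs \<nu> \<mu>" "(\<Sum>i<length fs. \<mu> i) = Suc (\<Sum>i<length fs. \<nu> i)"
    by (auto simp: shift_elems_def)
  have "shift_elem fs \<nu> \<mu> * G = shift_elem hs \<nu> \<mu> \<and> (\<Sum>i<length hs. \<mu> i) = Suc (\<Sum>i<length hs. \<nu> i)"
    by (simp add: shift_elem_hs[OF h(2)] h(2))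
  then have "h * G \<in> shift_elems hs" unfolding h(1) shift_elems_def mem_Collect_eq by blast
  then show ?case by (rule dmod.gen)
next
  case (conn x j)
  have "conn (log_form hs) j (x * G) = conn (log_form fs) j x * G"
    using conn log_form_hs_X[of j] mpoly_deriv_outside[OF g_vars, of j] disjoint
    by (auto simp: conn_def CD.D_mult ratfun_deriv_of algebra_simps)
  then show ?case using dmod.conn[OF conn.IH, of j] conn.hyps by simp
qed (auto simp: distrib_right mult.assoc intro: dmod.intros)

text \<open>Elements of the first module are constant for the derivatives in \<open>Y\<close>, so
  building up b by operators in \<open>Y\<close> commutes with multiplication by a; the start is
  \<open>A_mult_G\<close>.\<close>

lemma A_mult_B:
  assumes "a \<in> bs_module X fs" "b \<in> B"
  shows "a * b \<in> bs_module (X \<union> Y) hs"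
  using assms(2)
proof induction
  case (gen h)
  then obtain c where "h = s_eval \<sigma> c * G" by blast
  then have "a * h = s_eval \<sigma> c * (a * G)" by (simp only: mult_ac)
  then show ?case
    using bs_module_s_eval[OF hs_0 A_mult_G[OF assms(1)], of c] by (simp only: length_map)
next
  case (scalar x c)
  then show ?case by (simp add: mult.left_commute[of a] dmod.scalar)
next
  case (var x j)
  then show ?case by (simp add: mult.left_commute[of a] dmod.var)
next
  case (conn x j)
  have "a * conn g_form j x = conn (log_form hs) j (a * x)"
    using coeff_deriv_A[OF assms(1) conn.hyps(2)] log_form_hs_Y[OF conn.hyps(2)]
    by (simp add: conn_def CD.D_mult algebra_simps)
  then show ?case using dmod.conn[OF conn.IH, of j] conn.hyps by simp
qed (auto simp: distrib_left intro: dmod.add dmod.zero)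

text \<open>Each derivative acts on only one factor of a b, the other being constant for it; so the
  span of the products is stable.\<close>

lemma bs_module_hs_prod_span: "x \<in> bs_module (X \<union> Y) hs \<Longrightarrow> x \<in> prod_span (bs_module X fs) B"
proof (induction rule: dmod.induct)
  case (gen h)
  then obtain \<nu> \<mu> where h: "h = shift_elem hs \<nu> \<mu>" "(\<Sum>i<length fs. \<mu> i) = Suc (\<Sum>i<length fs. \<nu> i)"
    by (auto simp: shift_elems_def)
  have "shift_elem fs \<nu> \<mu> \<in> bs_module X fs"
    using h(2) by (auto simp: shift_elems_def intro: dmod.gen)
  then show ?case
    unfolding h(1) shift_elem_hs[OF h(2)] by (rule prod_span_gen) (rule G_in_B)
next
  case (scalar x c)
  from scalar.IH show ?case
  proof (rule prod_span_map)
    show "s_scalar c * (a * b) \<in> prod_span (bs_module X fs) B" if "a \<in> bs_module X fs" "b \<in> B" for a b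
      using that by (auto intro: prod_span_gen dmod.scalar simp flip: mult.assoc)
  qed (simp_all add: distrib_left)
next
  case (var x j)
  from var.IH show ?case
  proof (rule prod_span_map)
    show "z_var j * (a * b) \<in> prod_span (bs_module X fs) B" if "a \<in> bs_module X fs" "b \<in> B" for a b
    proof (cases "j \<in> X")
      case True
      then show ?thesis using that by (auto intro: prod_span_gen dmod.var simp flip: mult.assoc)
    next
      case False
      then have "z_var j * b \<in> B" using that var.hyps by (intro dmod.var) auto
      with that(1) have "a * (z_var j * b) \<in> prod_span (bs_module X fs) B" by (rule prod_span_gen)
      then show ?thesis by (simp add: mult.left_commute)
    qed
  qed (simp_all add: distrib_left)
next
  case (conn x j)
  from conn.IH show ?case
  proof (rule prod_span_map)
    show "conn (log_form hs) j (a * b) \<in> prod_span (bs_module X fs) B" if ab: "a \<in> bs_module X fs" "b \<in> B" for a b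
    proof (cases "j \<in> X")
      case True
      then have "conn (log_form hs) j (a * b) = conn (log_form fs) j a * b"
        using coeff_deriv_B[OF ab(2)] log_form_hs_X by (simp add: conn_def CD.D_mult algebra_simps)
      then show ?thesis using ab True by (auto intro: prod_span_gen dmod.conn)
    next
      case False
      then have j: "j \<in> Y" using conn.hyps by blast
      then have "conn (log_form hs) j (a * b) = a * conn g_form j b"
        using coeff_deriv_A[OF ab(1)] log_form_hs_Y by (simp add: conn_def CD.D_mult algebra_simps)
      then show ?thesis using prod_span_gen[OF ab(1) dmod.conn[OF ab(2) j]] by simp
    qed
  qed (simp_all add: conn_add)
qed (auto intro: prod_span.zero prod_span_add)

section \<open>Passing between s and s_1 + ... + s_r\<close>

definition to_\<sigma> :: "smod \<Rightarrow> smod" where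
  "to_\<sigma> = lin_ext s_const (monomial_at (\<lambda>i. if i = 0 then \<sigma> else 0))"

text \<open>Restriction to the line s_2 = ... = s_r = 0, on which \<sigma> equals s_1; it inverts
  \<open>to_\<sigma>\<close> on polynomials in the first variable.\<close>

definition from_\<sigma> :: "smod \<Rightarrow> smod" where
  "from_\<sigma> = lin_ext s_const (monomial_at (\<lambda>i. if i = 0 then s_var 0 else 0))"

sublocale to_\<sigma>: coeff_hom to_\<sigma>
  unfolding to_\<sigma>_def by (rule s_const.coeff_hom_poly_hom)

sublocale from_\<sigma>: coeff_hom from_\<sigma>
  unfolding from_\<sigma>_def by (rule s_const.coeff_hom_poly_hom)

lemma to_\<sigma>_const [simp]: "to_\<sigma> (s_const a) = s_const a"
  unfolding to_\<sigma>_def s_const_def[of a] by (simp only: s_const.poly_hom_const) (rule s_const_def)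

lemma from_\<sigma>_const [simp]: "from_\<sigma> (s_const a) = s_const a"
  unfolding from_\<sigma>_def s_const_def[of a] by (simp only: s_const.poly_hom_const) (rule s_const_def)

lemma to_\<sigma>_var: "to_\<sigma> (s_var i) = (if i = 0 then \<sigma> else 0)"
  unfolding to_\<sigma>_def s_var_def by (rule s_const.poly_hom_var)

lemma from_\<sigma>_var: "from_\<sigma> (s_var i) = (if i = 0 then s_var 0 else 0)"
  unfolding from_\<sigma>_def s_var_def[of i] by (rule s_const.poly_hom_var)

lemma from_\<sigma>_\<sigma>: "from_\<sigma> \<sigma> = s_var 0"
  using fs_nonempty by (simp add: from_\<sigma>.hom_sum from_\<sigma>_var)

lemma to_\<sigma>_s_eval: "to_\<sigma> (s_eval t c) = s_eval (to_\<sigma> t) c"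
  by (rule coeff_hom_apply_s_eval) (unfold_locales, simp add: s_scalar_def)

lemma from_\<sigma>_s_eval: "from_\<sigma> (s_eval t c) = s_eval (from_\<sigma> t) c"
  by (rule coeff_hom_apply_s_eval) (unfold_locales, simp add: s_scalar_def)

lemma conn_to_\<sigma>: "to_\<sigma> (conn (log_form [g]) j x) = conn g_form j (to_\<sigma> x)"
proof -
  have "to_\<sigma> (coeff_deriv j x) = coeff_deriv j (to_\<sigma> x)"
    unfolding to_\<sigma>_def by (rule subst_coeff_deriv) simp
  then show ?thesis
    by (simp add: conn_def to_\<sigma>.hom_add to_\<sigma>.hom_mult log_form_def to_\<sigma>_var)
qed

lemma conn_from_\<sigma>: "from_\<sigma> (conn g_form j x) = conn (log_form [g]) j (from_\<sigma> x)"
proof -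
  have "from_\<sigma> (coeff_deriv j x) = coeff_deriv j (from_\<sigma> x)"
    unfolding from_\<sigma>_def by (rule subst_coeff_deriv) simp
  then show ?thesis
    by (simp add: conn_def from_\<sigma>.hom_add from_\<sigma>.hom_mult from_\<sigma>_\<sigma> log_form_def)
qed

lemma to_\<sigma>_B: "x \<in> bs_module Y [g] \<Longrightarrow> to_\<sigma> x \<in> B"
proof (erule dmod_map)
  fix h assume "h \<in> shift_elems [g]"
  then obtain \<nu> \<mu> where h: "h = shift_elem [g] \<nu> \<mu>" "\<mu> 0 = Suc (\<nu> 0)"
    by (auto simp: shift_elems_def)
  have "h = falling 0 (\<nu> 0) * G"
    using g_0 by (simp add: h shift_elem_def)
  moreover have "to_\<sigma> (falling 0 n) = s_eval \<sigma> (\<Prod>l<n. [:- of_nat l, 1:])" for n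
    by (simp add: falling_def to_\<sigma>.hom_prod s_eval.hom_prod to_\<sigma>.hom_diff to_\<sigma>.hom_of_nat to_\<sigma>_var
        s_eval_pCons s_scalar.hom_uminus s_scalar.hom_of_nat)
  ultimately have "to_\<sigma> h = s_eval \<sigma> (\<Prod>l<\<nu> 0. [:- of_nat l, 1:]) * G"
    by (simp add: to_\<sigma>.hom_mult)
  then show "to_\<sigma> h \<in> B" by (auto intro: dmod.gen)
qed (simp_all add: to_\<sigma>.hom_add to_\<sigma>.hom_mult conn_to_\<sigma>)

lemma from_\<sigma>_B: "x \<in> B \<Longrightarrow> from_\<sigma> x \<in> bs_module Y [g]"
proof (erule dmod_map)
  fix h assume "h \<in> {s_eval \<sigma> c * G | c. True}"
  then obtain c where h: "h = s_eval \<sigma> c * G" by blast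
  have "G \<in> shift_elems [g]"
    unfolding shift_elems_def mem_Collect_eq
    by (rule exI[of _ "\<lambda>_. 0"], rule exI[of _ "\<lambda>_. 1"]) (simp add: shift_elem_def)
  then have "G \<in> bs_module Y [g]" by (rule dmod.gen)
  then show "from_\<sigma> h \<in> bs_module Y [g]"
    using bs_module_s_eval[of "[g]" G Y c] g_0
    by (simp add: h from_\<sigma>.hom_mult from_\<sigma>_s_eval from_\<sigma>_\<sigma>)
qed (simp_all add: from_\<sigma>.hom_add from_\<sigma>.hom_mult conn_from_\<sigma>)

section \<open>From the product back to the factors\<close>

lemma bs_equation_g: "bs_equation Y [g] c \<longleftrightarrow> s_eval \<sigma> c \<in> B"
proof -
  have "bs_equation Y [g] c \<longleftrightarrow> s_eval (s_var 0) c \<in> bs_module Y [g]"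
    using bs_equation_iff[of "[g]"] g_0 by simp
  also have "\<dots> \<longleftrightarrow> s_eval \<sigma> c \<in> B"
    using to_\<sigma>_B[of "s_eval (s_var 0) c"] from_\<sigma>_B[of "s_eval \<sigma> c"]
    by (auto simp: to_\<sigma>_s_eval to_\<sigma>_var from_\<sigma>_s_eval from_\<sigma>_\<sigma>)
  finally show ?thesis .
qed

text \<open>On the line only powers of s_1 survive, so that restricted elements of the first module
  can serve as second factors in \<open>sum_coefficients\<close>.\<close>

lemma denominators_from_\<sigma>:
  assumes "denominators V s_monomials x"
  shows "denominators V {s_var 0 ^ n | n. True} (from_\<sigma> x)"
proof -
  obtain q where q: "q \<noteq> 0" "mpoly_vars q \<subseteq> V" "s_const (ratfun_of q) * x \<in> poly_span V s_monomials"
    using assms by (auto simp: denominators_def)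
  have monomial: "from_\<sigma> (Poly_Mapping.single m 1) \<in> insert 0 {s_var 0 ^ n | n. True}" for m
  proof (induction m rule: exponent_induct)
    case zero
    then show ?case by (auto intro!: exI[of _ 0])
  next
    case (add m i)
    have "from_\<sigma> (Poly_Mapping.single (m + Poly_Mapping.single i 1) 1)
        = from_\<sigma> (Poly_Mapping.single m 1) * from_\<sigma> (s_var i)"
      by (simp add: s_var_def mult_single flip: from_\<sigma>.hom_mult)
    moreover have "s_var 0 ^ n * s_var 0 = (s_var 0 ^ Suc n :: smod)" for n by (rule power_Suc2[symmetric])
    ultimately show ?case
      using add by (fastforce simp: from_\<sigma>_var simp del: power_Suc)
  qed
  have "from_\<sigma> y \<in> poly_span V {s_var 0 ^ n | n. True}" if "y \<in> poly_span V s_monomials" for y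
    using that
  proof induction
    case (add y h p)
    have "from_\<sigma> h = 0 \<or> from_\<sigma> h \<in> {s_var 0 ^ n | n. True}"
      using add.hyps(2) monomial by (auto simp: s_monomials_def)
    then show ?case
      using poly_span.add[OF add.IH _ add.hyps(3)] add.IH
      by (auto simp: from_\<sigma>.hom_add from_\<sigma>.hom_mult)
  qed (simp add: poly_span.zero)
  from this[OF q(3)] show ?thesis
    unfolding denominators_def using q by (auto simp: from_\<sigma>.hom_mult)
qed

lemma \<sigma>_denominators: "denominators V s_monomials \<sigma>"
  by (intro denominators_sum denominators_s_var)

lemma bs_equation_hs_fs:
  assumes "bs_equation (X \<union> Y) hs d"
  shows "bs_equation X fs d"
proof -
  let ?A = "bs_module X fs"
  have "s_eval \<sigma> d \<in> prod_span ?A B"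
    using assms bs_equation_iff[OF hs_0] bs_module_hs_prod_span by simp
  then obtain J :: "nat set" and x y where J: "finite J" and xy: "\<And>j. j \<in> J \<Longrightarrow> x j \<in> ?A \<and> y j \<in> B"
    and eq: "s_eval \<sigma> d = (\<Sum>j\<in>J. x j * y j)" by (rule prod_span_family) blast
  have den_x: "\<forall>j\<in>J. denominators X s_monomials (x j)"
    using xy denominators_A by blast
  have den_y: "\<forall>j\<in>J. denominators Y {\<sigma> ^ n | n. True} (y j)"
    using xy denominators_B by blast
  obtain q :: mpoly and K c where "q \<noteq> 0" "Poly_Mapping.keys q \<subseteq> K"
    and coeffs: "\<forall>m\<in>K. (\<Sum>j\<in>J. x j * s_eval \<sigma> (c j m)) = s_scalar (Poly_Mapping.lookup q m) * s_eval \<sigma> d"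
    using sum_coefficients[OF J den_x den_y denominators_s_eval[OF \<sigma>_denominators] \<sigma>_denominators
        disjoint' eq[symmetric]] by (elim exE conjE) (rule that)
  \<comment> \<open>At a monomial of the denominator q the right-hand side is a nonzero scalar times
    d(\<sigma>), while the left-hand side is a \<complex>[\<sigma>]-combination of elements of the
    first module.\<close>
  obtain m where m: "m \<in> Poly_Mapping.keys q" using \<open>q \<noteq> 0\<close> by fastforce
  have "(\<Sum>j\<in>J. x j * s_eval \<sigma> (c j m)) \<in> ?A"
    using xy bs_module_s_eval[OF fs_0] by (intro dmod_sum) (simp add: mult.commute)
  then have "s_scalar (Poly_Mapping.lookup q m) * s_eval \<sigma> d \<in> ?A"
    using coeffs m \<open>Poly_Mapping.keys q \<subseteq> K\<close> by auto
  from dmod.scalar[OF this, of "1 / Poly_Mapping.lookup q m"] have "s_eval \<sigma> d \<in> ?A"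
    using m by (simp add: in_keys_iff flip: mult.assoc s_scalar.hom_mult)
  then show ?thesis using bs_equation_iff[OF fs_0] by simp
qed

text \<open>The factors exchange roles in the comparison of coefficients. Elements of the first
  module need not be polynomials in \<sigma>, so everything is restricted by
  \<open>from_\<sigma>\<close> beforehand.\<close>

lemma bs_equation_hs_g:
  assumes "bs_equation (X \<union> Y) hs d"
  shows "bs_equation Y [g] d"
proof -
  let ?A = "bs_module X fs" and ?B = "bs_module Y [g]" and ?s = "s_var 0"
  have g': "0 \<notin> set [g]" using g_0 by simp
  have "s_eval \<sigma> d \<in> prod_span ?A B"
    using assms bs_equation_iff[OF hs_0] bs_module_hs_prod_span by simp
  then obtain J :: "nat set" and x y where J: "finite J" and xy: "\<And>j. j \<in> J \<Longrightarrow> x j \<in> ?A \<and> y j \<in> B"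
    and sum: "s_eval \<sigma> d = (\<Sum>j\<in>J. x j * y j)" by (rule prod_span_family) blast
  have "from_\<sigma> (\<Sum>j\<in>J. x j * y j) = s_eval ?s d"
    by (simp only: sum[symmetric] from_\<sigma>_s_eval from_\<sigma>_\<sigma>)
  then have eq: "(\<Sum>j\<in>J. from_\<sigma> (y j) * from_\<sigma> (x j)) = s_eval ?s d"
    by (simp only: from_\<sigma>.hom_sum from_\<sigma>.hom_mult mult.commute)
  have y: "from_\<sigma> (y j) \<in> ?B" if "j \<in> J" for j
    using xy that from_\<sigma>_B by blast
  have den_y: "\<forall>j\<in>J. denominators Y s_monomials (from_\<sigma> (y j))"
    using denominators_bs_module[OF g' _ y] g_vars by simp
  have den_x: "\<forall>j\<in>J. denominators X {?s ^ n | n. True} (from_\<sigma> (x j))"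
    using xy denominators_A denominators_from_\<sigma> by blast
  obtain q :: mpoly and K c where "q \<noteq> 0" "Poly_Mapping.keys q \<subseteq> K"
    and coeffs: "\<forall>m\<in>K.
      (\<Sum>j\<in>J. from_\<sigma> (y j) * s_eval ?s (c j m)) = s_scalar (Poly_Mapping.lookup q m) * s_eval ?s d"
    using sum_coefficients[OF J den_y den_x denominators_s_eval[OF denominators_s_var]
        denominators_s_var disjoint eq] by (elim exE conjE) (rule that)
  obtain m where m: "m \<in> Poly_Mapping.keys q" using \<open>q \<noteq> 0\<close> by fastforce
  have "(\<Sum>j\<in>J. from_\<sigma> (y j) * s_eval ?s (c j m)) \<in> ?B"
    using y bs_module_s_eval[OF g'] by (intro dmod_sum) (simp add: mult.commute)
  then have "s_scalar (Poly_Mapping.lookup q m) * s_eval ?s d \<in> ?B"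
    using coeffs m \<open>Poly_Mapping.keys q \<subseteq> K\<close> by auto
  from dmod.scalar[OF this, of "1 / Poly_Mapping.lookup q m"] have "s_eval ?s d \<in> ?B"
    using m by (simp add: in_keys_iff flip: mult.assoc s_scalar.hom_mult)
  then show ?thesis using bs_equation_iff[OF g'] by simp
qed

text \<open>Evaluation at s = (\<alpha>, 0, ..., 0), a point with \<sigma> = \<alpha>; it exists
  because the list is nonempty.\<close>

lemma s_eval_point:
  obtains \<tau> :: "smod \<Rightarrow> ratfun" where "coeff_hom \<tau>"
    "\<And>c. \<tau> (s_eval \<sigma> c) = ratfun_of (mpoly_const (poly c \<alpha>))"
proof -
  have id: "coeff_hom (\<lambda>x :: ratfun. x)" by unfold_locales simp_all
  define v where "v i = (if i = 0 then ratfun_of (mpoly_const \<alpha>) else 0)" for i :: nat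
  define \<tau> where "\<tau> = lin_ext (\<lambda>x :: ratfun. x) (monomial_at v)"
  interpret \<tau>: coeff_hom \<tau> unfolding \<tau>_def by (rule coeff_hom.coeff_hom_poly_hom[OF id])
  have const: "\<tau> (s_const a) = a" for a
    by (simp add: \<tau>_def s_const_def coeff_hom.poly_hom_const[OF id])
  have var: "\<tau> (s_var i) = v i" for i
    unfolding \<tau>_def s_var_def by (rule coeff_hom.poly_hom_var[OF id])
  have \<sigma>: "\<tau> \<sigma> = ratfun_of (mpoly_const \<alpha>)"
    using fs_nonempty by (simp add: \<tau>.hom_sum var v_def)
  have "\<tau> (s_eval \<sigma> c) = ratfun_of (mpoly_const (poly c \<alpha>))" for c
    by (induction c)
      (simp_all add: s_eval_pCons \<tau>.hom_add \<tau>.hom_mult \<sigma> s_scalar_def const mpoly_const.hom_add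
        mpoly_const.hom_mult ratfun_of.hom_add ratfun_of.hom_mult)
  then show ?thesis using that \<tau>.coeff_hom_axioms by blast
qed

lemma mpoly_const_eq_0_iff [simp]: "mpoly_const c = 0 \<longleftrightarrow> c = 0"
  by (metis lookup_single_eq lookup_zero mpoly_const.hom_0 mpoly_const_def)

text \<open>The cofactor x is any element of \<open>smod\<close>: evaluation at a point with
  \<sigma> = \<alpha> kills the product in any case.\<close>

lemma s_eval_linear_factor:
  assumes "s_eval \<sigma> c = s_eval \<sigma> [:- \<alpha>, 1:] * x"
  shows "[:- \<alpha>, 1:] dvd c"
proof -
  obtain \<tau> where "coeff_hom \<tau>" and \<tau>: "\<And>c. \<tau> (s_eval \<sigma> c) = ratfun_of (mpoly_const (poly c \<alpha>))"
    using s_eval_point[of \<alpha>] by blast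
  then interpret \<tau>: coeff_hom \<tau> by simp
  have "\<tau> (s_eval \<sigma> c) = 0"
    unfolding assms \<tau>.hom_mult \<tau> by simp
  then have "poly c \<alpha> = 0" by (simp add: \<tau>)
  then show ?thesis by (simp only: poly_eq_0_iff_dvd)
qed

lemma s_eval_linear_nonzero: "s_eval \<sigma> [:- \<alpha>, 1:] \<noteq> 0"
proof
  assume 0: "s_eval \<sigma> [:- \<alpha>, 1:] = 0"
  \<comment> \<open>Where \<sigma> = \<alpha> + 1, the factor \<sigma> - \<alpha> takes the value
    1.\<close>
  obtain \<tau> where "coeff_hom \<tau>" and \<tau>: "\<And>c. \<tau> (s_eval \<sigma> c) = ratfun_of (mpoly_const (poly c (\<alpha> + 1)))"
    using s_eval_point[of "\<alpha> + 1"] by blast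
  then interpret \<tau>: coeff_hom \<tau> by simp
  show False using \<tau>[of "[:- \<alpha>, 1:]"] 0 by simp
qed

text \<open>The term a b joins the sum under a fresh index l. As b \<noteq> 0, some monomial occurs
  in q b with a nonzero coefficient c_l(\<sigma>), and comparing coefficients at this monomial gives
  the relation.\<close>

lemma linearly_disjoint:
  fixes J :: "nat set"
  assumes "finite J" "a \<in> bs_module X fs" "b \<in> B" "b \<noteq> 0"
    and xy: "\<And>j. j \<in> J \<Longrightarrow> x j \<in> bs_module X fs \<and> y j \<in> B" and eq: "a * b + (\<Sum>j\<in>J. x j * y j) = 0"
  shows "\<exists>c0 c. c0 \<noteq> 0 \<and> s_eval \<sigma> c0 * a + (\<Sum>j\<in>J. s_eval \<sigma> (c j) * x j) = 0"
proof -
  obtain l where l: "l \<notin> J" using assms(1) ex_new_if_finite infinite_UNIV_nat by blast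
  define x' y' where "x' = x(l := a)" and "y' = y(l := b)"
  have x': "x' l = a" "\<And>j. j \<in> J \<Longrightarrow> x' j = x j" and y': "y' l = b" "\<And>j. j \<in> J \<Longrightarrow> y' j = y j"
    using l by (auto simp: x'_def y'_def)
  let ?J = "insert l J"
  have den_x: "\<forall>j\<in>?J. denominators X s_monomials (x' j)"
    using assms(2) xy x' denominators_A by simp
  have den_y: "\<forall>j\<in>?J. denominators Y {\<sigma> ^ n | n. True} (y' j)"
    using assms(3) xy y' denominators_B by simp
  have "(\<Sum>j\<in>?J. x' j * y' j) = a * b + (\<Sum>j\<in>J. x j * y j)"
    using l assms(1) x' y' by simp
  then have "(\<Sum>j\<in>?J. x' j * y' j) = 0" using eq by simp
  from sum_coefficients[OF finite.insertI[OF assms(1)] den_x den_y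
      denominators_poly_span[OF poly_span.zero] \<sigma>_denominators disjoint' this]
  obtain q K c where q: "q \<noteq> 0"
    and exp: "\<forall>j\<in>?J. s_const (ratfun_of q) * y' j = (\<Sum>m\<in>K. z_monomial m * s_eval \<sigma> (c j m))"
    and coeffs: "\<forall>m\<in>K. (\<Sum>j\<in>?J. x' j * s_eval \<sigma> (c j m)) = s_scalar (Poly_Mapping.lookup q m) * 0"
    by blast
  have "(\<Sum>m\<in>K. z_monomial m * s_eval \<sigma> (c l m)) = s_const (ratfun_of q) * b"
    using bspec[OF exp insertI1] unfolding y'(1) by (rule sym)
  also have "\<dots> \<noteq> 0" using q assms(4) by simp
  finally obtain m where m: "m \<in> K" "z_monomial m * s_eval \<sigma> (c l m) \<noteq> 0"
    by (rule sum.not_neutral_contains_not_neutral)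
  then have "c l m \<noteq> 0" by auto
  have "s_eval \<sigma> (c l m) * a + (\<Sum>j\<in>J. s_eval \<sigma> (c j m) * x j) = 0"
    using bspec[OF coeffs m(1)] l assms(1) x' by (simp add: mult.commute)
  with \<open>c l m \<noteq> 0\<close> show ?thesis
    by (intro exI[of _ "c l m"] exI[of _ "\<lambda>j. c j m"] conjI)
qed

lemma bs_equation_peel:
  assumes "bs_equation X fs b" "bs_equation Y [g] c" "bs_equation (X \<union> Y) hs e" "b * c = [:- \<alpha>, 1:] * e"
  shows "(\<exists>d. b = [:- \<alpha>, 1:] * d \<and> bs_equation X fs d) \<or> (\<exists>d. c = [:- \<alpha>, 1:] * d \<and> bs_equation Y [g] d)"
proof -
  let ?A = "bs_module X fs" and ?p = "[:- \<alpha>, 1:]"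
  have "s_eval \<sigma> e \<in> prod_span ?A B"
    using assms(3) bs_equation_iff[OF hs_0] bs_module_hs_prod_span by simp
  then obtain J :: "nat set" and x y where J: "finite J" and xy: "\<And>j. j \<in> J \<Longrightarrow> x j \<in> ?A \<and> y j \<in> B"
    and "s_eval \<sigma> e = (\<Sum>j\<in>J. x j * y j)" by (rule prod_span_family) blast
  then have eq: "s_eval \<sigma> b * s_eval \<sigma> c = s_eval \<sigma> ?p * (\<Sum>j\<in>J. x j * y j)"
    using arg_cong[OF assms(4), of "s_eval \<sigma>"] by (simp only: s_eval.hom_mult)
  have b: "s_eval \<sigma> b \<in> ?A" using assms(1) bs_equation_iff[OF fs_0] by simp
  have c: "s_eval \<sigma> c \<in> B" using assms(2) bs_equation_g by simp
  \<comment> \<open>Divisibility by \<sigma> - \<alpha> in \<open>smod\<close> comes from one of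
    polynomials, so the quotient found in either module has the form d'(\<sigma>) and solves the
    functional equation there.\<close>
  have cancel: "\<exists>d'. d = ?p * d' \<and> s_eval \<sigma> d' = z" if factor: "s_eval \<sigma> d = s_eval \<sigma> ?p * z" for d z
  proof -
    obtain d' where d': "d = ?p * d'" using s_eval_linear_factor[OF factor] by (rule dvdE)
    have "s_eval \<sigma> ?p * s_eval \<sigma> d' = s_eval \<sigma> ?p * z"
      using factor unfolding d' s_eval.hom_mult mult.assoc .
    then show ?thesis using d' s_eval_linear_nonzero[of \<alpha>] by auto
  qed
  have "(\<exists>a'\<in>?A. s_eval \<sigma> b = s_eval \<sigma> ?p * a') \<or> (\<exists>b'\<in>B. s_eval \<sigma> c = s_eval \<sigma> ?p * b')"
  proof (rule peel_linear_factor[where t = \<sigma> and A = ?A and B = B, OF dmod.add dmod.zero _ dmod.add dmod.zero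
        _ _ s_eval_linear_nonzero J b c xy eq])
    show "s_eval \<sigma> c * x \<in> ?A" if "x \<in> ?A" for c x
      using bs_module_s_eval[OF fs_0 that] .
    show "s_eval \<sigma> c * x \<in> B" if "x \<in> B" for c x
      using B_s_eval[OF that] .
    show "\<exists>c0 c. c0 \<noteq> 0 \<and> s_eval \<sigma> c0 * a + (\<Sum>j\<in>J. s_eval \<sigma> (c j) * x j) = 0"
      if "finite J" "a \<in> ?A" "b \<in> B" "b \<noteq> 0" "\<And>j. j \<in> J \<Longrightarrow> x j \<in> ?A \<and> y j \<in> B"
        "a * b + (\<Sum>j\<in>J. x j * y j) = 0" for a b x y and J :: "nat set"
      using linearly_disjoint[OF that] .
  qed
  then show ?thesis
  proof (elim disjE bexE)
    fix z assume z: "z \<in> ?A" "s_eval \<sigma> b = s_eval \<sigma> ?p * z"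
    obtain d where "b = ?p * d" "s_eval \<sigma> d = z" using cancel[OF z(2)] by (elim exE conjE)
    then show ?thesis using z(1) bs_equation_iff[OF fs_0, of X d] by (intro disjI1 exI[of _ d] conjI) simp_all
  next
    fix z assume z: "z \<in> B" "s_eval \<sigma> c = s_eval \<sigma> ?p * z"
    obtain d where "c = ?p * d" "s_eval \<sigma> d = z" using cancel[OF z(2)] by (elim exE conjE)
    then show ?thesis using z(1) bs_equation_g[of d] by (intro disjI2 exI[of _ d] conjI) simp_all
  qed
qed

theorem is_bs_poly_hs:
  assumes "is_bs_poly X fs b" "is_bs_poly Y [g] c"
  shows "is_bs_poly (X \<union> Y) hs (b * c)"
proof (rule is_bs_poly_prod[OF fs_0 assms(1) _ assms(2) hs_0 _ bs_equation_peel])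
  have "s_eval \<sigma> b \<in> bs_module X fs" "s_eval \<sigma> c \<in> B"
    using assms bs_equation_iff[OF fs_0] bs_equation_g by (simp_all add: is_bs_poly_def)
  from A_mult_B[OF this] show "bs_equation (X \<union> Y) hs (b * c)"
    using bs_equation_iff[OF hs_0] by (simp add: s_eval.hom_mult)
qed (use g_0 in auto)

theorem is_bs_poly_hs_factors:
  assumes "is_bs_poly (X \<union> Y) hs d"
  shows "\<exists>b. is_bs_poly X fs b" "\<exists>c. is_bs_poly Y [g] c"
proof -
  have d: "bs_equation (X \<union> Y) hs d" "d \<noteq> 0" using assms by (auto simp: is_bs_poly_def)
  show "\<exists>b. is_bs_poly X fs b"
    using is_bs_poly_exists[OF fs_0 bs_equation_hs_fs[OF d(1)] d(2)] .
  show "\<exists>c. is_bs_poly Y [g] c"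
    using is_bs_poly_exists[OF _ bs_equation_hs_g[OF d(1)] d(2)] g_0 by simp
qed

end

section \<open>Ideals and their generators\<close>

lemma mem_carrier_mpoly_ring [simp]: "p \<in> carrier (mpoly_ring V) \<longleftrightarrow> mpoly_vars p \<subseteq> V"
  by (simp add: mpoly_ring_def)

lemma mpoly_ring_simps [simp]:
  "p \<otimes>\<^bsub>mpoly_ring V\<^esub> q = p * q" "p \<oplus>\<^bsub>mpoly_ring V\<^esub> q = p + q"
  "\<one>\<^bsub>mpoly_ring V\<^esub> = 1" "\<zero>\<^bsub>mpoly_ring V\<^esub> = 0"
  by (simp_all add: mpoly_ring_def)

lemma mpoly_vars_add_subset: "mpoly_vars p \<subseteq> V \<Longrightarrow> mpoly_vars q \<subseteq> V \<Longrightarrow> mpoly_vars (p + q) \<subseteq> V"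
  using mpoly_vars_add[of p q] by blast

lemma mpoly_vars_mult_subset: "mpoly_vars p \<subseteq> V \<Longrightarrow> mpoly_vars q \<subseteq> V \<Longrightarrow> mpoly_vars (p * q) \<subseteq> V"
  using mpoly_vars_mult[of p q] by blast

lemma mpoly_vars_sum_subset: "(\<And>i. i \<in> I \<Longrightarrow> mpoly_vars (h i) \<subseteq> V) \<Longrightarrow> mpoly_vars (sum h I) \<subseteq> V"
  by (induction I rule: infinite_finite_induct) (simp_all add: mpoly_vars_add_subset)

lemma cring_mpoly_ring: "cring (mpoly_ring V)"
proof (rule cringI)
  show "abelian_group (mpoly_ring V)"
  proof (rule abelian_groupI)
    show "\<exists>y\<in>carrier (mpoly_ring V). y \<oplus>\<^bsub>mpoly_ring V\<^esub> x = \<zero>\<^bsub>mpoly_ring V\<^esub>"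
      if "x \<in> carrier (mpoly_ring V)" for x
      using that by (intro bexI[of _ "- x"]) simp_all
  qed (simp_all add: mpoly_vars_add_subset add_ac)
  show "Group.comm_monoid (mpoly_ring V)"
    by (rule comm_monoidI) (simp_all add: mpoly_vars_mult_subset mult_ac)
qed (simp add: distrib_right)

lemma idealI_mpoly:
  assumes "I \<subseteq> {p. mpoly_vars p \<subseteq> V}" "0 \<in> I" "\<And>p q. p \<in> I \<Longrightarrow> q \<in> I \<Longrightarrow> p + q \<in> I"
    and "\<And>p q. p \<in> I \<Longrightarrow> mpoly_vars q \<subseteq> V \<Longrightarrow> q * p \<in> I"
  shows "ideal I (mpoly_ring V)"
proof -
  interpret cring "mpoly_ring V" by (rule cring_mpoly_ring)
  have minus: "\<ominus>\<^bsub>mpoly_ring V\<^esub> p = - p" if "mpoly_vars p \<subseteq> V" for p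
    using that minus_equality[of "- p" p] by simp
  show ?thesis
  proof (rule idealI)
    show "subgroup I (add_monoid (mpoly_ring V))"
    proof (rule add.subgroupI)
      show "\<ominus>\<^bsub>mpoly_ring V\<^esub> p \<in> I" if "p \<in> I" for p
        using assms(4)[OF that, of "- 1"] minus[of p] that assms(1) by auto
    qed (use assms in auto)
  qed (use assms ring_axioms in \<open>auto simp: mult.commute\<close>)
qed

lemma ideal_mpoly_closed:
  assumes "ideal I (mpoly_ring V)"
  shows "p \<in> I \<Longrightarrow> mpoly_vars p \<subseteq> V" "0 \<in> I" "p \<in> I \<Longrightarrow> q \<in> I \<Longrightarrow> p + q \<in> I"
    and "p \<in> I \<Longrightarrow> mpoly_vars q \<subseteq> V \<Longrightarrow> q * p \<in> I"
proof -
  interpret ideal I "mpoly_ring V" by (rule assms)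
  show "p \<in> I \<Longrightarrow> mpoly_vars p \<subseteq> V" using a_Hcarr by simp
  show "0 \<in> I" using additive_subgroup.zero_closed[OF is_additive_subgroup] by simp
  show "p \<in> I \<Longrightarrow> q \<in> I \<Longrightarrow> p + q \<in> I" using additive_subgroup.a_closed[OF is_additive_subgroup, of p q] by simp
  show "p \<in> I \<Longrightarrow> mpoly_vars q \<subseteq> V \<Longrightarrow> q * p \<in> I" using I_l_closed[of p q] by simp
qed

lemma ideal_mpoly_sum:
  "ideal I (mpoly_ring V) \<Longrightarrow> (\<And>k. k \<in> K \<Longrightarrow> h k \<in> I) \<Longrightarrow> sum h K \<in> I"
  by (induction K rule: infinite_finite_induct) (simp_all add: ideal_mpoly_closed)

lemma genideal_mpoly_ideal: "S \<subseteq> {p. mpoly_vars p \<subseteq> V} \<Longrightarrow> ideal (genideal (mpoly_ring V) S) (mpoly_ring V)"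
  by (rule ring.genideal_ideal[OF cring.axioms(1)[OF cring_mpoly_ring]]) auto

lemma genideal_mpoly_superset: "S \<subseteq> {p. mpoly_vars p \<subseteq> V} \<Longrightarrow> S \<subseteq> genideal (mpoly_ring V) S"
  by (rule ring.genideal_self[OF cring.axioms(1)[OF cring_mpoly_ring]]) auto

lemma genideal_mpoly_minimal: "ideal I (mpoly_ring V) \<Longrightarrow> S \<subseteq> I \<Longrightarrow> genideal (mpoly_ring V) S \<subseteq> I"
  by (rule ring.genideal_minimal[OF cring.axioms(1)[OF cring_mpoly_ring]])

lemma genideal_list_combination:
  assumes "set fs \<subseteq> {p. mpoly_vars p \<subseteq> V}" "p \<in> genideal (mpoly_ring V) (set fs)"
  shows "\<exists>a. (\<forall>i<length fs. mpoly_vars (a i) \<subseteq> V) \<and> p = (\<Sum>i<length fs. a i * fs ! i)"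
proof -
  let ?I = "{p. \<exists>a. (\<forall>i<length fs. mpoly_vars (a i) \<subseteq> V) \<and> p = (\<Sum>i<length fs. a i * fs ! i)}"
  have "ideal ?I (mpoly_ring V)"
  proof (rule idealI_mpoly)
    show "?I \<subseteq> {p. mpoly_vars p \<subseteq> V}"
    proof clarify
      fix a j assume a: "\<forall>i<length fs. mpoly_vars (a i) \<subseteq> V" and j: "j \<in> mpoly_vars (\<Sum>i<length fs. a i * fs ! i)"
      have "mpoly_vars (fs ! i) \<subseteq> V" if "i < length fs" for i
        using assms(1) nth_mem[OF that] by blast
      then have "mpoly_vars (\<Sum>i<length fs. a i * fs ! i) \<subseteq> V"
        using a by (intro mpoly_vars_sum_subset mpoly_vars_mult_subset) auto
      then show "j \<in> V" using j by blast
    qed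
    show "0 \<in> ?I" by (intro CollectI exI[of _ "\<lambda>_. 0"]) simp
    show "p + q \<in> ?I" if pq: "p \<in> ?I" "q \<in> ?I" for p q
    proof -
      obtain a b where "\<forall>i<length fs. mpoly_vars (a i) \<subseteq> V" "p = (\<Sum>i<length fs. a i * fs ! i)"
        "\<forall>i<length fs. mpoly_vars (b i) \<subseteq> V" "q = (\<Sum>i<length fs. b i * fs ! i)" using pq by blast
      then show ?thesis
        by (intro CollectI exI[of _ "\<lambda>i. a i + b i"])
          (simp add: distrib_right sum.distrib mpoly_vars_add_subset)
    qed
    show "q * p \<in> ?I" if p: "p \<in> ?I" and q: "mpoly_vars q \<subseteq> V" for p q
    proof -
      obtain a where "\<forall>i<length fs. mpoly_vars (a i) \<subseteq> V" "p = (\<Sum>i<length fs. a i * fs ! i)"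
        using p by blast
      then show ?thesis
        using q by (intro CollectI exI[of _ "\<lambda>i. q * a i"])
          (simp add: sum_distrib_left mult.assoc mpoly_vars_mult_subset)
    qed
  qed
  moreover have "set fs \<subseteq> ?I"
  proof
    fix f assume "f \<in> set fs"
    then obtain i where i: "i < length fs" "f = fs ! i" by (auto simp: in_set_conv_nth)
    then have "f = (\<Sum>l<length fs. (if l = i then 1 else 0) * fs ! l)"
      by (simp add: if_distrib[of "\<lambda>x. x * _"] cong: if_cong)
    then show "f \<in> ?I" by (intro CollectI exI[of _ "\<lambda>l. if l = i then 1 else 0"]) auto
  qed
  ultimately have "genideal (mpoly_ring V) (set fs) \<subseteq> ?I" by (rule genideal_mpoly_minimal)
  then show ?thesis using assms(2) by blast
qed

lemma ideal_generators_simp: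
  "ideal_generators V I fs \<longleftrightarrow>
    set fs \<subseteq> {p. mpoly_vars p \<subseteq> V} \<and> 0 \<notin> set fs \<and> I = genideal (mpoly_ring V) (set fs)"
  unfolding ideal_generators_def by (auto simp: subset_iff)

proposition bs_equation_generators:
  assumes "ideal_generators V I fs" "ideal_generators V I fs'"
  shows "bs_equation V fs c \<longleftrightarrow> bs_equation V fs' c"
proof -
  have transfer: "bs_equation V gs' c"
    if gs: "ideal_generators V I gs" and gs': "ideal_generators V I gs'" and "bs_equation V gs c" for gs gs'
  proof -
    have sub: "set gs \<subseteq> {p. mpoly_vars p \<subseteq> V}" "set gs' \<subseteq> {p. mpoly_vars p \<subseteq> V}"
      and nz: "0 \<notin> set gs" "0 \<notin> set gs'"
      and I: "I = genideal (mpoly_ring V) (set gs)" "I = genideal (mpoly_ring V) (set gs')"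
      using gs gs' by (auto simp: ideal_generators_simp)
    have "\<forall>k<length gs'. \<exists>a. (\<forall>i<length gs. mpoly_vars (a i) \<subseteq> V) \<and> gs' ! k = (\<Sum>i<length gs. a i * gs ! i)"
      using genideal_list_combination[OF sub(1)] genideal_mpoly_superset[OF sub(2)] I nth_mem[of _ gs'] by blast
    then obtain a where a: "\<forall>k<length gs'. (\<forall>i<length gs. mpoly_vars (a k i) \<subseteq> V) \<and> gs' ! k = (\<Sum>i<length gs. a k i * gs ! i)"
      by metis
    have "\<forall>k<length gs. \<exists>a. (\<forall>i<length gs'. mpoly_vars (a i) \<subseteq> V) \<and> gs ! k = (\<Sum>i<length gs'. a i * gs' ! i)"
      using genideal_list_combination[OF sub(2)] genideal_mpoly_superset[OF sub(1)] I nth_mem[of _ gs] by blast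
    then obtain b where b: "\<forall>k<length gs. (\<forall>i<length gs'. mpoly_vars (b k i) \<subseteq> V) \<and> gs ! k = (\<Sum>i<length gs'. b k i * gs' ! i)"
      by metis
    interpret generator_change V gs gs' a b
      by unfold_locales (use a b in blast)+
    show ?thesis using bs_equation_transfer nz that(3) by blast
  qed
  show ?thesis using transfer assms by blast
qed

section \<open>Well-definedness on ideals\<close>

lemma the_or_zero_eq: "Q b \<Longrightarrow> (\<And>c. Q c \<Longrightarrow> c = b) \<Longrightarrow> the_or_zero Q = b"
  unfolding the_or_zero_def by (metis (mono_tags) the_equality)

lemma the_or_zero_none: "(\<And>b. \<not> Q b) \<Longrightarrow> the_or_zero Q = 0"
  unfolding the_or_zero_def by auto

lemma bs_poly_ideal_eq:
  assumes "ideal_generators V I fs" "is_bs_poly V fs b"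
  shows "bs_poly_ideal V I = b"
  unfolding bs_poly_ideal_def
proof (rule the_or_zero_eq)
  fix c assume "\<exists>gs. ideal_generators V I gs \<and> is_bs_poly V gs c"
  then obtain gs where gs: "ideal_generators V I gs" "is_bs_poly V gs c" by blast
  show "c = b"
  proof (rule is_bs_poly_unique[OF _ _ gs(2) assms(2)])
    show "0 \<notin> set gs" using gs(1) by (simp add: ideal_generators_simp)
    show "bs_equation V gs d \<longleftrightarrow> bs_equation V fs d" for d
      using bs_equation_generators[OF gs(1) assms(1)] .
  qed
qed (use assms in blast)

lemma bs_poly_ideal_none:
  assumes "\<And>fs b. ideal_generators V I fs \<Longrightarrow> \<not> is_bs_poly V fs b"
  shows "bs_poly_ideal V I = 0"
  unfolding bs_poly_ideal_def using assms by (intro the_or_zero_none) blast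

lemma is_bs_poly_independent:
  assumes "ideal_generators V I fs" "ideal_generators V I fs'" "is_bs_poly V fs b"
  shows "is_bs_poly V fs' b"
  using assms(3) bs_equation_generators[OF assms(1,2)] by (simp add: is_bs_poly_def)

lemma bs_poly_eq: "g \<noteq> 0 \<Longrightarrow> is_bs_poly V [g] b \<Longrightarrow> bs_poly V g = b"
  unfolding bs_poly_def by (rule the_or_zero_eq, assumption, rule is_bs_poly_unique[of "[g]" V "[g]"]) simp_all

section \<open>Generators of the product ideal\<close>

lemma ideal_generators_product:
  assumes "ideal_generators X \<aa> fs" "mpoly_vars g \<subseteq> Y" "g \<noteq> 0"
  shows "ideal_generators (X \<union> Y) (genideal (mpoly_ring (X \<union> Y)) {f * g | f. f \<in> \<aa>}) (map (\<lambda>f. f * g) fs)"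
proof -
  have fs: "set fs \<subseteq> {p. mpoly_vars p \<subseteq> X}" "0 \<notin> set fs" and a: "\<aa> = genideal (mpoly_ring X) (set fs)"
    using assms(1) by (auto simp: ideal_generators_simp)
  have vars: "mpoly_vars (f * g) \<subseteq> X \<union> Y" if "mpoly_vars f \<subseteq> X" for f
    using mpoly_vars_mult[of f g] that assms(2) by blast
  have sub: "set (map (\<lambda>f. f * g) fs) \<subseteq> {p. mpoly_vars p \<subseteq> X \<union> Y}"
    using fs(1) vars by auto
  have a_vars: "mpoly_vars f \<subseteq> X" if "f \<in> \<aa>" for f
    using ideal_mpoly_closed(1)[OF genideal_mpoly_ideal[OF fs(1)]] that a by blast
  let ?J = "genideal (mpoly_ring (X \<union> Y)) {f * g | f. f \<in> \<aa>}"
  let ?K = "genideal (mpoly_ring (X \<union> Y)) (set (map (\<lambda>f. f * g) fs))"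
  have K: "ideal ?K (mpoly_ring (X \<union> Y))" by (rule genideal_mpoly_ideal[OF sub])
  have "?J \<subseteq> ?K"
  proof (rule genideal_mpoly_minimal[OF K])
    show "{f * g | f. f \<in> \<aa>} \<subseteq> ?K"
    proof clarify
      fix f assume "f \<in> \<aa>"
      then obtain b where b: "\<forall>i<length fs. mpoly_vars (b i) \<subseteq> X" "f = (\<Sum>i<length fs. b i * fs ! i)"
        using genideal_list_combination[OF fs(1)] a by blast
      have "b i * (fs ! i * g) \<in> ?K" if "i < length fs" for i
      proof (rule ideal_mpoly_closed(4)[OF K])
        have "fs ! i * g \<in> set (map (\<lambda>f. f * g) fs)" using nth_mem[OF that] by auto
        then show "fs ! i * g \<in> ?K" using genideal_mpoly_superset[OF sub] by blast
        show "mpoly_vars (b i) \<subseteq> X \<union> Y" using that b(1) by blast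
      qed
      then have "(\<Sum>i<length fs. b i * (fs ! i * g)) \<in> ?K" by (intro ideal_mpoly_sum[OF K]) auto
      then show "f * g \<in> ?K" by (simp add: b(2) sum_distrib_right mult.assoc)
    qed
  qed
  moreover have S: "{f * g | f. f \<in> \<aa>} \<subseteq> {p. mpoly_vars p \<subseteq> X \<union> Y}"
    using a_vars vars by auto
  have "?K \<subseteq> ?J"
  proof (rule genideal_mpoly_minimal[OF genideal_mpoly_ideal[OF S]])
    have "set fs \<subseteq> \<aa>" using genideal_mpoly_superset[OF fs(1)] a by simp
    then have "set (map (\<lambda>f. f * g) fs) \<subseteq> {f * g | f. f \<in> \<aa>}" by auto
    then show "set (map (\<lambda>f. f * g) fs) \<subseteq> ?J" using genideal_mpoly_superset[OF S] by blast
  qed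
  ultimately show ?thesis
    using sub fs(2) assms(3) by (auto simp: ideal_generators_simp)
qed

text \<open>Setting the variables outside \<open>X\<close> to 0 turns generators of the product into generators
  of the ideal; this spares us Hilbert's basis theorem.\<close>

lemma ideal_generators_descend:
  assumes disj: "X \<inter> Y = {}" and a: "ideal \<aa> (mpoly_ring X)" and g: "mpoly_vars g \<subseteq> Y" "g \<noteq> 0"
    and gens: "ideal_generators (X \<union> Y) (genideal (mpoly_ring (X \<union> Y)) {f * g | f. f \<in> \<aa>}) hs"
  shows "\<exists>fs. ideal_generators X \<aa> fs"
proof -
  define \<pi> where "\<pi> = lin_ext mpoly_const (monomial_at (\<lambda>j. if j \<in> X then mpoly_var j else 0))"
  interpret proj: coeff_hom \<pi> unfolding \<pi>_def by (rule mpoly_const.coeff_hom_poly_hom)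
  have \<pi>_const: "\<pi> (mpoly_const c) = mpoly_const c" for c
    unfolding \<pi>_def mpoly_const_def[of c] by (simp only: mpoly_const.poly_hom_const) (rule mpoly_const_def)
  have \<pi>_var: "\<pi> (mpoly_var j) = (if j \<in> X then mpoly_var j else 0)" for j
  proof -
    have "lin_ext mpoly_const (monomial_at v) (mpoly_var j) = v j" for v
      unfolding mpoly_var_def by (rule mpoly_const.poly_hom_var)
    then show ?thesis by (simp add: \<pi>_def)
  qed
  have \<pi>_id: "\<pi> p = p" if "mpoly_vars p \<subseteq> X" for p
    using that by (induction rule: mpoly_vars_induct) (simp_all add: \<pi>_const \<pi>_var proj.hom_add proj.hom_mult)
  have \<pi>_vars: "mpoly_vars (\<pi> p) \<subseteq> X" for p
  proof -
    have "mpoly_vars p \<subseteq> UNIV" by simp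
    then show ?thesis
      by (induction rule: mpoly_vars_induct)
        (simp_all add: \<pi>_const \<pi>_var proj.hom_add proj.hom_mult mpoly_vars_add_subset mpoly_vars_mult_subset)
  qed
  let ?R = "mpoly_ring (X \<union> Y)" and ?S = "{f * g | f. f \<in> \<aa>}"
  note closed = ideal_mpoly_closed[OF a]
  have hs: "set hs \<subseteq> {p. mpoly_vars p \<subseteq> X \<union> Y}" and J: "genideal ?R ?S = genideal ?R (set hs)"
    using gens by (auto simp: ideal_generators_simp)
  have S: "?S \<subseteq> {p. mpoly_vars p \<subseteq> X \<union> Y}"
    using closed(1) g(1) by (auto dest!: mpoly_vars_mult[THEN subsetD])
  \<comment> \<open>The condition on the quotient h is chosen so that it holds for h in \<aa> and is
    stable under the ideal operations; it therefore holds for the quotients of the given generators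
    by g.\<close>
  let ?T = "{h * g | h. mpoly_vars h \<subseteq> X \<union> Y \<and> \<pi> h \<in> \<aa>}"
  have "ideal ?T ?R"
  proof (rule idealI_mpoly)
    show "?T \<subseteq> {p. mpoly_vars p \<subseteq> X \<union> Y}"
      using g(1) by (auto dest!: mpoly_vars_mult[THEN subsetD])
    show "0 \<in> ?T" by (intro CollectI exI[of _ 0]) (simp add: closed(2))
    show "p + q \<in> ?T" if pq: "p \<in> ?T" "q \<in> ?T" for p q
    proof -
      obtain h k where "p = h * g" "mpoly_vars h \<subseteq> X \<union> Y" "\<pi> h \<in> \<aa>"
        "q = k * g" "mpoly_vars k \<subseteq> X \<union> Y" "\<pi> k \<in> \<aa>" using pq by blast
      then show ?thesis
        by (intro CollectI exI[of _ "h + k"])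
          (simp add: distrib_right proj.hom_add closed(3) mpoly_vars_add_subset)
    qed
    show "q * p \<in> ?T" if p: "p \<in> ?T" and q: "mpoly_vars q \<subseteq> X \<union> Y" for p q
    proof -
      obtain h where "p = h * g" "mpoly_vars h \<subseteq> X \<union> Y" "\<pi> h \<in> \<aa>" using p by blast
      then show ?thesis
        using q by (intro CollectI exI[of _ "q * h"])
          (simp add: mult.assoc proj.hom_mult closed(4) \<pi>_vars mpoly_vars_mult_subset)
    qed
  qed
  moreover have "?S \<subseteq> ?T"
    using closed(1) \<pi>_id by fastforce
  ultimately have "genideal ?R ?S \<subseteq> ?T" by (rule genideal_mpoly_minimal)
  then have "\<forall>h\<in>set hs. \<exists>k. h = k * g \<and> \<pi> k \<in> \<aa>"
    using J genideal_mpoly_superset[OF hs] by blast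
  then obtain k where k: "\<And>h. h \<in> set hs \<Longrightarrow> h = k h * g" "\<And>h. h \<in> set hs \<Longrightarrow> \<pi> (k h) \<in> \<aa>"
    by metis
  \<comment> \<open>\<pi> may kill a quotient, and \<open>ideal_generators\<close> excludes
    0.\<close>
  define fs where "fs = filter (\<lambda>f. f \<noteq> 0) (map (\<lambda>h. \<pi> (k h)) hs)"
  have fs: "set fs \<subseteq> \<aa>" "set fs \<subseteq> {p. mpoly_vars p \<subseteq> X}"
    using k(2) \<pi>_vars by (auto simp: fs_def)
  let ?I = "genideal (mpoly_ring X) (set fs)"
  have I: "ideal ?I (mpoly_ring X)" by (rule genideal_mpoly_ideal[OF fs(2)])
  have "f \<in> ?I" if f: "f \<in> \<aa>" for f
  proof -
    have "f * g \<in> genideal ?R (set hs)"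
      using genideal_mpoly_superset[OF S] f J by blast
    then obtain a where "f * g = (\<Sum>i<length hs. a i * hs ! i)"
      using genideal_list_combination[OF hs] by blast
    also have "\<dots> = (\<Sum>i<length hs. a i * k (hs ! i)) * g"
      unfolding sum_distrib_right by (intro sum.cong refl) (metis k(1) lessThan_iff mult.assoc nth_mem)
    \<comment> \<open>\<pi> may send g to 0, so g is cancelled before \<pi> is applied.\<close>
    finally have "f = (\<Sum>i<length hs. a i * k (hs ! i))" using g(2) by simp
    then have "\<pi> f = (\<Sum>i<length hs. \<pi> (a i) * \<pi> (k (hs ! i)))"
      by (simp only: proj.hom_sum proj.hom_mult)
    moreover have "\<pi> (k (hs ! i)) \<in> ?I" if "i < length hs" for i
    proof (cases "\<pi> (k (hs ! i)) = 0")
      case False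
      then have "\<pi> (k (hs ! i)) \<in> set fs" using that by (auto simp: fs_def)
      then show ?thesis using genideal_mpoly_superset[OF fs(2)] by blast
    qed (simp add: ideal_mpoly_closed(2)[OF I])
    then have "(\<Sum>i<length hs. \<pi> (a i) * \<pi> (k (hs ! i))) \<in> ?I"
      using \<pi>_vars by (intro ideal_mpoly_sum[OF I] ideal_mpoly_closed(4)[OF I]) auto
    ultimately show ?thesis using \<pi>_id[OF closed(1)[OF f]] by simp
  qed
  then have "\<aa> = ?I" using genideal_mpoly_minimal[OF a fs(1)] by blast
  then show ?thesis
    using fs(2) by (intro exI[of _ fs]) (auto simp: ideal_generators_simp fs_def)
qed

theorem proposition1p9:
  fixes X Y :: "nat set" and \<aa> :: "mpoly set" and g :: mpoly
  assumes "finite X" and "finite Y" and "X \<inter> Y = {}"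
    and "ideal \<aa> (mpoly_ring X)" and "\<aa> \<noteq> {0}"
    and "g \<in> carrier (mpoly_ring Y)" and "g \<noteq> 0"
  shows "bs_poly_ideal X \<aa> * bs_poly Y g =
         bs_poly_ideal (X \<union> Y) (genideal (mpoly_ring (X \<union> Y)) {f * g | f. f \<in> \<aa>})"
proof -
  have g: "mpoly_vars g \<subseteq> Y" using assms(6) by simp
  let ?J = "genideal (mpoly_ring (X \<union> Y)) {f * g | f. f \<in> \<aa>}"
  have product: "disjoint_product X Y fs g" if "ideal_generators X \<aa> fs" for fs
  proof
    \<comment> \<open>Here \<aa> \<noteq> {0} enters: the empty list generates the zero
      ideal.\<close>
    show "fs \<noteq> []"
    proof
      assume "fs = []"
      then have "\<aa> \<subseteq> {0}"
        using that genideal_mpoly_minimal[of "{0}" X "{}"] idealI_mpoly[of "{0}" X]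
        by (simp add: ideal_generators_simp)
      then show False using assms(5) ideal_mpoly_closed(2)[OF assms(4)] by blast
    qed
  qed (use that assms(3,7) g in \<open>auto simp: ideal_generators_simp\<close>)
  show ?thesis
  proof (cases "\<exists>fs b c. ideal_generators X \<aa> fs \<and> is_bs_poly X fs b \<and> is_bs_poly Y [g] c")
    case True
    then obtain fs b c where fs: "ideal_generators X \<aa> fs" and b: "is_bs_poly X fs b" and c: "is_bs_poly Y [g] c"
      by blast
    interpret disjoint_product X Y fs g by (rule product[OF fs])
    show ?thesis
      using bs_poly_ideal_eq[OF fs b] bs_poly_eq[OF assms(7) c]
        bs_poly_ideal_eq[OF ideal_generators_product[OF fs g assms(7)] is_bs_poly_hs[OF b c]] by simp
  next
    case False
    \<comment> \<open>One factor takes the default value 0, and the product must do so too: a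
      solution for any generators of the product ideal would produce generators of \<aa> and
      solutions for both factors.\<close>
    have "bs_poly_ideal X \<aa> = 0 \<or> bs_poly Y g = 0"
      using False bs_poly_ideal_none[of X \<aa>] the_or_zero_none[of "is_bs_poly Y [g]"]
      unfolding bs_poly_def by blast
    moreover have "bs_poly_ideal (X \<union> Y) ?J = 0"
    proof (rule bs_poly_ideal_none, rule notI)
      fix hs d assume hs: "ideal_generators (X \<union> Y) ?J hs" "is_bs_poly (X \<union> Y) hs d"
      obtain fs where fs: "ideal_generators X \<aa> fs"
        using ideal_generators_descend[OF assms(3,4) g assms(7) hs(1)] by blast
      interpret disjoint_product X Y fs g by (rule product[OF fs])
      have "is_bs_poly (X \<union> Y) (map (\<lambda>f. f * g) fs) d"
        using is_bs_poly_independent[OF hs(1) ideal_generators_product[OF fs g assms(7)] hs(2)] .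
      from is_bs_poly_hs_factors[OF this] show False using False fs by blast
    qed
    ultimately show ?thesis by auto
  qed
qed

end
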